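(* Let $f:\mathbb{R}\to\mathbb{R}_+$ be measurable and either bounded or Lipschitz continuous, and let $h(t)=\sum_{i=1}^L c_i e^{-\alpha_i t}\frac{t^{n_i}}{n_i!}$, $t\ge0$, where $c_i\in\mathbb{R}$, $\alpha_i>0$, $n_i\in\mathbb{N}$ for $1\le i\le L$. Fix any initial condition $\eta$ (a deterministic point process on $]-\infty,0]$) such that $\int_{]-\infty,0]}h(t-s)\,\eta(ds)<\infty$ for all $t\ge0$, and put, for each $1\le i\le L$ and $0\le k\le n_i$, $$x_0^{(i,k)}=\int_{]-\infty,0]}c_i e^{\alpha_i s}\frac{(-s)^{n_i-k}}{(n_i-k)!}\,\eta(ds)$$ (these integrals being well defined and finite). Let $X=(X_t)_{t\ge0}$ be the Markov process with generator $$\mathcal{L}g(x)=\langle F(x),\nabla g(x)\rangle+f\Big(\sum_{i=1}^L x^{(i,0)}\Big)\Big(g\big(x+\sum_{i=1}^L c_i e_{(i,n_i)}\big)-g(x)\Big),$$ starting from $X_0=x_0$. Then $X$ is non-explosive, i.e. $X$ has $P_{x_0}$-almost surely a finite number of jumps on each interval $[s,t]$, $0\le s<t<\infty$. Finally, let $N_t=\sum_{s\le t}1_{\{\Delta X_s\ne0\}}$ be the counting process associated to the jumps of $X$. Then $(N_t)_{t\ge0}$ is a non-linear Hawkes process with intensity $$\lambda_t=f\left(\int_{]-\infty,0]}h(t-s)\,\eta(ds)+\int_{]0,t[}h(t-s)\,dN_s\right).$$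
   Context: $\mathbb{N}$ denotes the non-negative integers; $\kappa=L+\sum_{i=1}^L n_i$. Elements of $\mathbb{R}^\kappa$ are written $x=(x^{(1)},\ldots,x^{(L)})$ with $x^{(i)}=(x^{(i,0)},\ldots,x^{(i,n_i)})$; $e_{(i,n_i)}\in\mathbb{R}^\kappa$ is the unit vector with entry $1$ in coordinate $(i,n_i)$. $F:\mathbb{R}^\kappa\to\mathbb{R}^\kappa$ is the vector field with $F^{(i,k)}(x)=-\alpha_i x^{(i,k)}+x^{(i,k+1)}$ for $0\le k<n_i$ and $F^{(i,n_i)}(x)=-\alpha_i x^{(i,n_i)}$. The Markov process with generator $\mathcal{L}$ (given for smooth test functions $g$) is the càdlàg piecewise deterministic process in $\mathbb{R}^\kappa$ which between jumps follows the flow of $\dot x=F(x)$, jumps at rate $f(\sum_i x^{(i,0)})$ when in state $x$, and at each jump is increased by $\sum_i c_i e_{(i,n_i)}$. $P_{x_0}$ is its law when $X_0=x_0$. A Hawkes process with parameters $(f,h)$ and initial condition $\eta$ is (the law of) a simple point process on $(0,\infty)$ with counting process $(N_t)_{t\ge0}$, $N_t=N((0,t])$, whose compensator, with respect to the filtration $\mathcal{F}_t=\sigma\{N(A):A\in\mathcal{B}((0,t])\}$, is $(\int_0^t\lambda_s\,ds)_{t\ge0}$ where $\lambda_t$ is the non-negative predictable process $\lambda_t=f\big(\int_{]-\infty,0]}h(t-s)\,\eta(ds)+\int_{]0,t[}h(t-s)\,dN_s\big)$, called its intensity.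
   Formalization: The Hawkes conclusion is proved when some c_i is nonzero; if all c_i = 0 then ΔX = 0 and N = 0 although the stated intensity is f(0). That the integrals defining x_0 are well defined and finite is taken as an assumption. *)

theory Defs
  imports "HOL-Probability.Probability"
begin

section \<open>Point measures\<close>

text \<open>
  Locally finite integer-valued Borel measures on the line which are carried by \<open>D\<close>. Local
  finiteness refers to the compact subsets of the whole line, so for \<open>D = {0<..}\<close> each set
  \<open>{0<..t}\<close> has finite mass.
\<close>

definition point_configuration :: "real set \<Rightarrow> real measure \<Rightarrow> bool" where
  "point_configuration D \<mu> \<longleftrightarrow>
     sets \<mu> = sets borel \<and>
     (\<forall>A\<in>sets borel. emeasure \<mu> A \<in> range ennreal_of_enat) \<and>
     emeasure \<mu> (- D) = 0 \<and>
     (\<forall>K. compact K \<longrightarrow> emeasure \<mu> K < \<infinity>)"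

definition simple_point_configuration :: "real set \<Rightarrow> real measure \<Rightarrow> bool" where
  "simple_point_configuration D \<mu> \<longleftrightarrow> point_configuration D \<mu> \<and> (\<forall>t. emeasure \<mu> {t} \<le> 1)"

text \<open>The measure \<open>A \<mapsto> #(A \<inter> J)\<close> on the Borel sets.\<close>

definition counting_measure :: "real set \<Rightarrow> real measure" where
  "counting_measure J = distr (count_space J) borel (\<lambda>t. t)"


section \<open>Local martingales and compensators\<close>

text \<open>
  Filtrations are indexed by all reals, but only the indices \<open>t \<ge> 0\<close> matter.
\<close>

definition martingale :: "'w measure \<Rightarrow> (real \<Rightarrow> 'w measure) \<Rightarrow> (real \<Rightarrow> 'w \<Rightarrow> real) \<Rightarrow> bool" where
  "martingale M F Y \<longleftrightarrow>
     (\<forall>t\<ge>0. Y t \<in> borel_measurable (F t) \<and> integrable M (Y t)) \<and>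
     (\<forall>s t. 0 \<le> s \<longrightarrow> s \<le> t \<longrightarrow> (AE \<omega> in M. real_cond_exp M (F s) (Y t) \<omega> = Y s \<omega>))"

text \<open>
  Finite localizing times are no restriction, since \<open>\<tau> n\<close> may be replaced by \<open>min (\<tau> n) n\<close>.
\<close>

definition local_martingale :: "'w measure \<Rightarrow> (real \<Rightarrow> 'w measure) \<Rightarrow> (real \<Rightarrow> 'w \<Rightarrow> real) \<Rightarrow> bool" where
  "local_martingale M F Y \<longleftrightarrow>
     (\<exists>\<tau> :: nat \<Rightarrow> 'w \<Rightarrow> real.
        (\<forall>n. stopping_time F (\<tau> n) \<and> (\<forall>\<omega>\<in>space M. 0 \<le> \<tau> n \<omega>)) \<and>
        (AE \<omega> in M. incseq (\<lambda>n. \<tau> n \<omega>) \<and> filterlim (\<lambda>n. \<tau> n \<omega>) at_top sequentially) \<and>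
        (\<forall>n. martingale M F (\<lambda>t \<omega>. Y (min t (\<tau> n \<omega>)) \<omega>)))"

definition predictable_sigma :: "'w measure \<Rightarrow> (real \<Rightarrow> 'w measure) \<Rightarrow> (real \<times> 'w) measure" where
  "predictable_sigma M F =
     sigma ({0<..} \<times> space M) {{s<..t} \<times> A | s t A. 0 \<le> s \<and> s \<le> t \<and> A \<in> sets (F s)}"

definition predictable :: "'w measure \<Rightarrow> (real \<Rightarrow> 'w measure) \<Rightarrow> (real \<Rightarrow> 'w \<Rightarrow> real) \<Rightarrow> bool" where
  "predictable M F Y \<longleftrightarrow> (\<lambda>(t, \<omega>). Y t \<omega>) \<in> borel_measurable (predictable_sigma M F)"

definition compensator ::
  "'w measure \<Rightarrow> (real \<Rightarrow> 'w measure) \<Rightarrow> (real \<Rightarrow> 'w \<Rightarrow> real) \<Rightarrow> (real \<Rightarrow> 'w \<Rightarrow> real) \<Rightarrow> bool" where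
  "compensator M F Y A \<longleftrightarrow>
     predictable M F A \<and>
     (AE \<omega> in M. A 0 \<omega> = 0 \<and> mono_on {0..} (\<lambda>t. A t \<omega>) \<and>
        (\<forall>t\<ge>0. continuous (at_right t) (\<lambda>u. A u \<omega>))) \<and>
     local_martingale M F (\<lambda>t \<omega>. Y t \<omega> - A t \<omega>)"


section \<open>Hawkes processes\<close>

definition natural_filtration :: "'w measure \<Rightarrow> ('w \<Rightarrow> real measure) \<Rightarrow> real \<Rightarrow> 'w measure" where
  "natural_filtration M N t =
     sigma (space M)
       {(\<lambda>\<omega>. emeasure (N \<omega>) A) -` B \<inter> space M | A B.
          A \<in> sets borel \<and> A \<subseteq> {0<..t} \<and> B \<in> sets borel}"

definition hawkes_intensity ::
  "(real \<Rightarrow> real) \<Rightarrow> (real \<Rightarrow> real) \<Rightarrow> real measure \<Rightarrow> ('w \<Rightarrow> real measure) \<Rightarrow> real \<Rightarrow> 'w \<Rightarrow> real" where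
  "hawkes_intensity f h \<eta> N t \<omega> =
     f ((LINT s:{..0}|\<eta>. h (t - s)) + (LINT s:{0<..<t}|N \<omega>. h (t - s)))"

text \<open>
  The local integrability of the intensity is required explicitly because the Bochner integral of a
  non-integrable function is \<open>0\<close>.
\<close>

definition hawkes_process ::
  "'w measure \<Rightarrow> (real \<Rightarrow> real) \<Rightarrow> (real \<Rightarrow> real) \<Rightarrow> real measure \<Rightarrow> ('w \<Rightarrow> real measure) \<Rightarrow> bool" where
  "hawkes_process M f h \<eta> N \<longleftrightarrow>
     prob_space M \<and>
     (\<forall>\<omega>\<in>space M. sets (N \<omega>) = sets borel) \<and>
     (\<forall>A\<in>sets borel. (\<lambda>\<omega>. emeasure (N \<omega>) A) \<in> borel_measurable M) \<and>
     (AE \<omega> in M. simple_point_configuration {0<..} (N \<omega>)) \<and>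
     (let F = natural_filtration M N; l = hawkes_intensity f h \<eta> N in
        (\<forall>t>0. \<forall>\<omega>\<in>space M. 0 \<le> l t \<omega>) \<and>
        predictable M F l \<and>
        (AE \<omega> in M. \<forall>t\<ge>0. set_integrable lborel {0<..t} (\<lambda>s. l s \<omega>)) \<and>
        compensator M F (\<lambda>t \<omega>. measure (N \<omega>) {0<..t}) (\<lambda>t \<omega>. LINT s:{0<..t}|lborel. l s \<omega>))"


section \<open>Piecewise deterministic Markov processes\<close>

text \<open>\<open>\<phi> t x\<close> is the position at time \<open>t\<close> of the solution of \<open>x' = F x\<close> that starts at \<open>x\<close>.\<close>

definition flow_on ::
  "('p \<Rightarrow> real) set \<Rightarrow> (('p \<Rightarrow> real) \<Rightarrow> 'p \<Rightarrow> real) \<Rightarrow> (real \<Rightarrow> ('p \<Rightarrow> real) \<Rightarrow> 'p \<Rightarrow> real) \<Rightarrow> bool" where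
  "flow_on S F \<phi> \<longleftrightarrow>
     (\<forall>x\<in>S. \<phi> 0 x = x \<and>
       (\<forall>t\<ge>0. \<phi> t x \<in> S \<and>
         (\<forall>p. ((\<lambda>u. \<phi> u x p) has_real_derivative F (\<phi> t x) p) (at t within {0..}))))"

text \<open>
  The Markov process in \<open>S\<close> with generator \<open>g \<mapsto> \<langle>F, \<nabla>g\<rangle> + r * (g(\<cdot> + \<delta>) - g)\<close>: a piecewise
  deterministic process that follows the flow \<open>\<phi>\<close> of \<open>F\<close> between jumps, jumps at rate \<open>r x\<close> in
  state \<open>x\<close>, and is increased by \<open>\<delta>\<close> at each jump. Here \<open>T 0 = 0\<close>, and \<open>T (Suc k)\<close> is the
  \<open>(k+1)\<close>-st jump time (\<open>\<infinity>\<close> if there are at most \<open>k\<close> jumps). Jumping at rate \<open>r\<close> means that, given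
  the past up to the \<open>k\<close>-th jump, the next waiting time exceeds \<open>t\<close> with probability
  \<open>exp (- \<integral>\<^sub>0\<^sup>t r (\<phi> s Z) ds)\<close>, where \<open>Z\<close> is the state right after that jump. As the jump sizes and
  the flow are deterministic, the past is generated by the jump times.

  Explosion is not excluded: the process is defined on \<open>[0, lifetime)\<close>, and nothing is assumed
  about the values of \<open>X\<close> afterwards.
\<close>

locale pdmp = prob_space M
  for M :: "'w measure"
    and S :: "('p \<Rightarrow> real) set"
    and F :: "('p \<Rightarrow> real) \<Rightarrow> 'p \<Rightarrow> real"
    and r :: "('p \<Rightarrow> real) \<Rightarrow> real"
    and \<delta> x0 :: "'p \<Rightarrow> real"
    and \<phi> :: "real \<Rightarrow> ('p \<Rightarrow> real) \<Rightarrow> 'p \<Rightarrow> real"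
    and T :: "nat \<Rightarrow> 'w \<Rightarrow> ennreal"
    and X :: "real \<Rightarrow> 'w \<Rightarrow> 'p \<Rightarrow> real" +
  assumes flow: "flow_on S F \<phi>"
    and start_in: "x0 \<in> S"
    and shift_in: "\<And>x. x \<in> S \<Longrightarrow> (\<lambda>p. x p + \<delta> p) \<in> S"
    and T_measurable: "\<And>k. T k \<in> borel_measurable M"
    and T_0: "\<And>\<omega>. \<omega> \<in> space M \<Longrightarrow> T 0 \<omega> = 0"
    and T_Suc: "\<And>k \<omega>. \<omega> \<in> space M \<Longrightarrow> T k \<omega> < \<infinity> \<Longrightarrow> T k \<omega> < T (Suc k) \<omega>"
    and T_top: "\<And>k \<omega>. \<omega> \<in> space M \<Longrightarrow> T k \<omega> = \<infinity> \<Longrightarrow> T (Suc k) \<omega> = \<infinity>"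
    and X_0: "\<And>\<omega>. \<omega> \<in> space M \<Longrightarrow> X 0 \<omega> = x0"
    and X_flow: "\<And>k t \<omega>. \<omega> \<in> space M \<Longrightarrow> 0 \<le> t \<Longrightarrow> T k \<omega> \<le> ennreal t \<Longrightarrow> ennreal t < T (Suc k) \<omega> \<Longrightarrow>
      X t \<omega> = \<phi> (t - enn2real (T k \<omega>)) (X (enn2real (T k \<omega>)) \<omega>)"
    and X_jump: "\<And>k p \<omega>. \<omega> \<in> space M \<Longrightarrow> T (Suc k) \<omega> < \<infinity> \<Longrightarrow>
      X (enn2real (T (Suc k) \<omega>)) \<omega> p =
        \<phi> (enn2real (T (Suc k) \<omega>) - enn2real (T k \<omega>)) (X (enn2real (T k \<omega>)) \<omega>) p + \<delta> p"
    and jump_rate: "\<And>k t. 0 \<le> t \<Longrightarrow> AE \<omega> in M. T k \<omega> < \<infinity> \<longrightarrow>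
      real_cond_exp M
        (sigma (space M) {T j -` B \<inter> space M | j B. j \<le> k \<and> B \<in> sets borel})
        (indicator {\<omega>' \<in> space M. T k \<omega>' + ennreal t < T (Suc k) \<omega>'}) \<omega>
      = exp (- (LINT s:{0..t}|lborel. r (\<phi> s (X (enn2real (T k \<omega>)) \<omega>))))"

definition lifetime :: "(nat \<Rightarrow> 'w \<Rightarrow> ennreal) \<Rightarrow> 'w \<Rightarrow> ennreal" where
  "lifetime T \<omega> = (SUP k. T k \<omega>)"

text \<open>\<open>\<Delta>X\<^sub>t = X\<^sub>t - X\<^sub>t\<^sub>-\<close>, coordinatewise.\<close>

definition jump_size :: "(real \<Rightarrow> 'w \<Rightarrow> 'p \<Rightarrow> real) \<Rightarrow> real \<Rightarrow> 'w \<Rightarrow> 'p \<Rightarrow> real" where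
  "jump_size X t \<omega> p = X t \<omega> p - Lim (at_left t) (\<lambda>u. X u \<omega> p)"

text \<open>
  The point process with counting process \<open>N\<^sub>t = \<Sum>s\<le>t. 1{\<Delta>X\<^sub>s \<noteq> 0}\<close>. The sum is taken over times
  before the lifetime, which is no restriction on the paths without explosion.
\<close>

definition jump_process ::
  "(nat \<Rightarrow> 'w \<Rightarrow> ennreal) \<Rightarrow> (real \<Rightarrow> 'w \<Rightarrow> 'p \<Rightarrow> real) \<Rightarrow> 'w \<Rightarrow> real measure" where
  "jump_process T X \<omega> =
     counting_measure {s. 0 < s \<and> ennreal s < lifetime T \<omega> \<and> jump_size X s \<omega> \<noteq> (\<lambda>p. 0)}"


section \<open>Erlang kernels\<close>

text \<open>
  The space \<open>\<real>\<^sup>\<kappa>\<close> with \<open>\<kappa> = L + \<Sum>i=1..L. n i\<close> is represented by the functions on pairs that vanish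
  off the \<open>\<kappa>\<close> pairs in \<open>erlang_index L n\<close>.
\<close>

definition erlang_index :: "nat \<Rightarrow> (nat \<Rightarrow> nat) \<Rightarrow> (nat \<times> nat) set" where
  "erlang_index L n = (SIGMA i:{1..L}. {0..n i})"

definition erlang_space :: "nat \<Rightarrow> (nat \<Rightarrow> nat) \<Rightarrow> (nat \<times> nat \<Rightarrow> real) set" where
  "erlang_space L n = {x. \<forall>p. p \<notin> erlang_index L n \<longrightarrow> x p = 0}"

definition erlang_kernel ::
  "nat \<Rightarrow> (nat \<Rightarrow> real) \<Rightarrow> (nat \<Rightarrow> real) \<Rightarrow> (nat \<Rightarrow> nat) \<Rightarrow> real \<Rightarrow> real" where
  "erlang_kernel L c \<alpha> n t = (\<Sum>i=1..L. c i * exp (- \<alpha> i * t) * (t ^ n i / fact (n i)))"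

definition erlang_field ::
  "nat \<Rightarrow> (nat \<Rightarrow> real) \<Rightarrow> (nat \<Rightarrow> nat) \<Rightarrow> (nat \<times> nat \<Rightarrow> real) \<Rightarrow> nat \<times> nat \<Rightarrow> real" where
  "erlang_field L \<alpha> n x = (\<lambda>(i, k).
     if i \<in> {1..L} \<and> k < n i then - \<alpha> i * x (i, k) + x (i, Suc k)
     else if i \<in> {1..L} \<and> k = n i then - \<alpha> i * x (i, n i)
     else 0)"

definition erlang_jump :: "nat \<Rightarrow> (nat \<Rightarrow> real) \<Rightarrow> (nat \<Rightarrow> nat) \<Rightarrow> nat \<times> nat \<Rightarrow> real" where
  "erlang_jump L c n p = (\<Sum>i=1..L. c i * indicator {(i, n i)} p)"

definition erlang_init_integrand ::
  "(nat \<Rightarrow> real) \<Rightarrow> (nat \<Rightarrow> real) \<Rightarrow> (nat \<Rightarrow> nat) \<Rightarrow> nat \<times> nat \<Rightarrow> real \<Rightarrow> real" where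
  "erlang_init_integrand c \<alpha> n = (\<lambda>(i, k) s.
     c i * exp (\<alpha> i * s) * ((- s) ^ (n i - k) / fact (n i - k)))"

definition erlang_init ::
  "nat \<Rightarrow> (nat \<Rightarrow> real) \<Rightarrow> (nat \<Rightarrow> real) \<Rightarrow> (nat \<Rightarrow> nat) \<Rightarrow> real measure \<Rightarrow> nat \<times> nat \<Rightarrow> real" where
  "erlang_init L c \<alpha> n \<eta> p =
     (if p \<in> erlang_index L n then LINT s:{..0}|\<eta>. erlang_init_integrand c \<alpha> n p s else 0)"

end

theory Submission
  imports Defs
begin

text \<open>
  Between jumps the state solves a linear system which is triangular in each block \<open>i\<close>, so it has a
  closed form (\<open>erlang_path\<close>): coordinate \<open>(i, k)\<close> at time \<open>u\<close> is a combination of the functions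
  \<open>exp (- \<alpha> i * u) * u ^ j / fact j\<close>, whose coefficients are initial coordinates, plus one term
  \<open>c i * exp (- \<alpha> i * (u - s)) * (u - s) ^ (n i - k) / fact (n i - k)\<close> for each past jump time \<open>s\<close>.
  For \<open>k = 0\<close> the jump terms sum up over \<open>i\<close> to the kernel \<open>h (u - s)\<close>, and the choice of the initial
  state turns the rest into \<open>\<integral> h (u - s) \<eta>(ds)\<close>, by the binomial theorem (\<open>memory_erlang_init\<close>).
  So the jump rate of the Markov process along its path is the Hawkes intensity.

  It remains to see that times \<open>T 1 < T 2 < \<dots>\<close> with a prescribed hazard rate \<open>\<rho> k\<close> between \<open>T k\<close> and
  \<open>T (k + 1)\<close>, given \<open>T 0, \<dots>, T k\<close>, form a point process whose intensity is \<open>\<rho> k\<close> on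
  \<open>(T k, T (k + 1)]\<close>. This holds for arbitrary times (locale \<open>hazard_times\<close>). The key is the identity
  \<open>P (B \<inter> {T (k + 1) \<le> t}) = E [1\<^sub>B * \<integral>\<^sub>0\<^sup>t \<rho> k u * 1 {T k \<le> u < T (k + 1)} du]\<close> for events \<open>B\<close> of the past
  of \<open>T k\<close> (\<open>jump_compensation\<close>). Its proof evaluates the right-hand side by Fubini, using that given
  the past the next jump comes after \<open>u\<close> with probability \<open>exp (- \<integral> \<rho>)\<close>, and
  \<open>\<integral> \<rho> * exp (- \<integral> \<rho>) = 1 - exp (- \<integral> \<rho>)\<close>.

  The identity has two consequences. First, the linear growth of \<open>f\<close> bounds \<open>\<rho> k\<close> on \<open>[T k, t]\<close> by
  \<open>a + b * k\<close>, so \<open>P (T (k + 1) \<le> t) / (a + b * k)\<close> is at most the expected time which \<open>[0, t]\<close> shares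
  with \<open>[T k, T (k + 1))\<close>. These times add up to at most \<open>t\<close>, whereas \<open>\<Sum>k. 1 / (a + b * k)\<close> diverges:
  with probability one, the jump times do not all lie below \<open>t\<close> (\<open>non_explosion\<close>).

  Second, each process \<open>1 {T (k + 1) \<le> t} - \<integral>\<^sub>0\<^sup>t \<rho> k u * 1 {T k < u \<le> T (k + 1)} du\<close> is a martingale for the
  history of the point process. It is constant after \<open>T (k + 1)\<close>, and before \<open>T (k + 1)\<close> an event
  of the history up to \<open>s\<close> coincides with an event of the past of \<open>T k\<close>
  (\<open>trace_before_jump\<close>), for which the identity applies. The counting process minus the integrated
  intensity, stopped at the time \<open>min (T m) m\<close>, is the sum of the first \<open>m\<close> of these martingales, stopped at \<open>m\<close>
  (\<open>stopped_decomposition\<close>), and by non-explosion these times localize.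
\<close>

section \<open>The flow of the Erlang field\<close>

definition decay :: "real \<Rightarrow> nat \<Rightarrow> real \<Rightarrow> real" where
  "decay a m t = exp (- a * t) * (t ^ m / fact m)"

lemma decay_at_0: "decay a m 0 = (if m = 0 then 1 else 0)"
  by (simp add: decay_def)

lemma continuous_on_decay [continuous_intros]: "continuous_on A (decay a m)"
  unfolding decay_def[abs_def] by (intro continuous_intros) auto

lemma decay_measurable [measurable]: "decay a m \<in> borel_measurable borel"
  by (intro borel_measurable_continuous_onI continuous_on_decay)

lemma has_real_derivative_decay:
  "(decay a m has_real_derivative
     (- a * decay a m t + (if m = 0 then 0 else decay a (m - 1) t))) (at t within A)"
proof (cases m)
  case 0
  then show ?thesis
    unfolding decay_def[abs_def] by (auto intro!: derivative_eq_intros)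
next
  case (Suc j)
  have 1: "((\<lambda>t. t ^ Suc j / fact (Suc j)) has_real_derivative (t ^ j / fact j)) (at t within A)"
    using DERIV_cdivide[OF DERIV_pow[of "Suc j" t A], of "fact (Suc j)"]
    by (simp only: fact_Suc of_nat_mult mult_divide_mult_cancel_left_if diff_Suc_1) simp
  have 2: "((\<lambda>t. exp (- a * t)) has_real_derivative (- a * exp (- a * t))) (at t within A)"
    by (auto intro!: derivative_eq_intros)
  from DERIV_mult[OF 2 1]
  show ?thesis
    unfolding decay_def[abs_def] Suc by (simp add: algebra_simps)
qed

text \<open>
  The integrating factor \<open>exp (a * t)\<close> turns the solution into a constant.
\<close>

lemma linear_ode_zero:
  fixes d :: "real \<Rightarrow> real"
  assumes d: "\<And>t. 0 \<le> t \<Longrightarrow> (d has_real_derivative - a * d t) (at t within {0..})"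
    and "d 0 = 0" and "0 \<le> t"
  shows "d t = 0"
proof -
  have "((\<lambda>t. exp (a * t) * d t) has_real_derivative 0) (at t within {0..})" if "t \<in> {0..}" for t
  proof -
    have "((\<lambda>t. exp (a * t)) has_real_derivative a * exp (a * t)) (at t within {0..})"
      by (auto intro!: derivative_eq_intros)
    from DERIV_mult[OF this d] that show ?thesis by (simp add: algebra_simps)
  qed
  from has_field_derivative_zero_constant[OF convex_real_interval(1) this]
  obtain C where "\<And>t. 0 \<le> t \<Longrightarrow> exp (a * t) * d t = C" by auto
  from this[of t] this[of 0] assms(2,3) show ?thesis by auto
qed

text \<open>
  Within the block \<open>i\<close>, the coordinate \<open>(i, n i)\<close> evolves on its own, and each \<open>(i, k)\<close> is driven only
  by \<open>(i, k + 1)\<close>. So the difference of two solutions vanishes at \<open>k = n i\<close> and then, one coordinate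
  after the other, down to \<open>k = 0\<close>, each time by the scalar equation.
\<close>

lemma erlang_field_unique:
  assumes y: "\<And>t p. 0 \<le> t \<Longrightarrow>
      ((\<lambda>u. y u p) has_real_derivative erlang_field L \<alpha> n (y t) p) (at t within {0..})"
    and z: "\<And>t p. 0 \<le> t \<Longrightarrow>
      ((\<lambda>u. z u p) has_real_derivative erlang_field L \<alpha> n (z t) p) (at t within {0..})"
    and init: "y 0 = z 0" and t: "0 \<le> t"
  shows "y t = z t"
proof
  fix p :: "nat \<times> nat"
  obtain i k where p: "p = (i, k)" by force
  have D: "((\<lambda>u. y u q - z u q) has_real_derivative
      erlang_field L \<alpha> n (y t) q - erlang_field L \<alpha> n (z t) q) (at t within {0..})"
    if "0 \<le> t" for t q
    using DERIV_diff[OF y z] that by auto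
  have I: "y 0 q - z 0 q = 0" for q using init by simp
  have top: "y t (i, n i) = z t (i, n i)" if "0 \<le> t" "i \<in> {1..L}" for t
  proof -
    have "((\<lambda>u. y u (i, n i) - z u (i, n i)) has_real_derivative
        - \<alpha> i * (y t (i, n i) - z t (i, n i))) (at t within {0..})" if "0 \<le> t" for t
      using D[OF that, of "(i, n i)"] \<open>i \<in> {1..L}\<close> by (simp add: erlang_field_def right_diff_distrib)
    from linear_ode_zero[OF this I that(1)] show ?thesis by simp
  qed
  have chain: "\<forall>t\<ge>0. y t (i, n i - j) = z t (i, n i - j)" if i: "i \<in> {1..L}" for j
  proof (induction j)
    case (Suc j)
    show ?case
    proof (cases "j < n i")
      case False
      then show ?thesis using Suc by simp
    next
      case True
      then have *: "Suc (n i - Suc j) = n i - j" "n i - Suc j < n i" by auto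
      have "((\<lambda>u. y u (i, n i - Suc j) - z u (i, n i - Suc j)) has_real_derivative
          - \<alpha> i * (y t (i, n i - Suc j) - z t (i, n i - Suc j))) (at t within {0..})"
        if "0 \<le> t" for t
      proof -
        have "y t (i, n i - j) = z t (i, n i - j)" using Suc that by blast
        then have "erlang_field L \<alpha> n (y t) (i, n i - Suc j) - erlang_field L \<alpha> n (z t) (i, n i - Suc j)
            = - \<alpha> i * (y t (i, n i - Suc j) - z t (i, n i - Suc j))"
          using i * by (simp add: erlang_field_def right_diff_distrib del: Suc_diff_Suc)
        with D[OF that, of "(i, n i - Suc j)"] show ?thesis by simp
      qed
      from linear_ode_zero[OF this I] show ?thesis by simp
    qed
  qed (use top i in auto)
  show "y t p = z t p"
  proof (cases "i \<in> {1..L} \<and> k \<le> n i")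
    case True
    then show ?thesis using chain[of "n i - k"] t p by auto
  next
    case False
    then have "((\<lambda>u. y u p - z u p) has_real_derivative - 0 * (y t p - z t p)) (at t within {0..})"
      if "0 \<le> t" for t
      using D[OF that, of p] p by (auto simp: erlang_field_def)
    from linear_ode_zero[OF this I t] show ?thesis by simp
  qed
qed

text \<open>
  The state at time \<open>u\<close> in closed form, if the process starts in \<open>x\<close> and has jumped at
  \<open>\<tau> 1, \<dots>, \<tau> K\<close>. The coordinate \<open>(i, n i)\<close> receives the jump \<open>c i\<close>, which reaches \<open>(i, k)\<close> through
  \<open>n i - k\<close> successive integrations. The formula is used also at times \<open>u\<close> after the next jump, as the
  continuation of the state along the flow.
\<close>

definition erlang_path ::
  "nat \<Rightarrow> (nat \<Rightarrow> real) \<Rightarrow> (nat \<Rightarrow> real) \<Rightarrow> (nat \<Rightarrow> nat) \<Rightarrow> (nat \<times> nat \<Rightarrow> real) \<Rightarrow>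
    (nat \<Rightarrow> real) \<Rightarrow> nat \<Rightarrow> real \<Rightarrow> nat \<times> nat \<Rightarrow> real" where
  "erlang_path L c \<alpha> n x \<tau> K u = (\<lambda>(i, k).
     if (i, k) \<in> erlang_index L n
     then (\<Sum>j\<le>n i - k. x (i, k + j) * decay (\<alpha> i) j u)
       + (\<Sum>m=1..K. c i * decay (\<alpha> i) (n i - k) (u - \<tau> m))
     else 0)"

lemma sum_decay_derivative:
  "((\<lambda>u. \<Sum>j\<le>N. b j * decay a j u) has_real_derivative
     (- a * (\<Sum>j\<le>N. b j * decay a j u) + (\<Sum>j<N. b (Suc j) * decay a j u))) (at u within A)"
proof -
  have "(\<Sum>j\<le>N. b j * (- a * decay a j u + (if j = 0 then 0 else decay a (j - 1) u)))
     = - a * (\<Sum>j\<le>N. b j * decay a j u) + (\<Sum>j\<le>N. b j * (if j = 0 then 0 else decay a (j - 1) u))"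
    unfolding sum_distrib_left sum.distrib[symmetric] by (intro sum.cong) (simp_all add: algebra_simps)
  also have "(\<Sum>j\<le>N. b j * (if j = 0 then 0 else decay a (j - 1) u)) = (\<Sum>j<N. b (Suc j) * decay a j u)"
    by (subst sum.atMost_shift) (auto intro!: sum.cong)
  finally have *: "(\<Sum>j\<le>N. b j * (- a * decay a j u + (if j = 0 then 0 else decay a (j - 1) u)))
     = - a * (\<Sum>j\<le>N. b j * decay a j u) + (\<Sum>j<N. b (Suc j) * decay a j u)" .
  show ?thesis
    unfolding *[symmetric] by (intro DERIV_sum DERIV_cmult has_real_derivative_decay)
qed

lemma erlang_path_derivative:
  "((\<lambda>v. erlang_path L c \<alpha> n x \<tau> K (s + v) p) has_real_derivative
      erlang_field L \<alpha> n (erlang_path L c \<alpha> n x \<tau> K (s + v)) p) (at v within A)"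
proof -
  obtain i k where p: "p = (i, k)" by force
  show ?thesis
  proof (cases "(i, k) \<in> erlang_index L n")
    case False
    then have "erlang_field L \<alpha> n y p = 0" for y
      by (auto simp: p erlang_field_def erlang_index_def)
    with False show ?thesis by (simp add: erlang_path_def p)
  next
    case True
    then have ik: "i \<in> {1..L}" "k \<le> n i" by (auto simp: erlang_index_def)
    let ?N = "n i - k" and ?u = "s + v"
    have shift: "((\<lambda>v. g (r + v)) has_real_derivative g' (r + v)) (at v within A)"
      if "\<And>u A. (g has_real_derivative g' u) (at u within A)" for g g' :: "real \<Rightarrow> real" and r
    proof -
      have "(g has_real_derivative g' (r + v)) (at (v + r))"
        using that[of "r + v" UNIV] by (simp add: add.commute)
      then have "((\<lambda>v. g (r + v)) has_real_derivative g' (r + v)) (at v)"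
        unfolding DERIV_shift by (simp add: add.commute)
      then show ?thesis by (rule has_field_derivative_at_within)
    qed
    have "((\<lambda>v. (\<Sum>j\<le>?N. x (i, k + j) * decay (\<alpha> i) j (s + v))
          + (\<Sum>m=1..K. c i * decay (\<alpha> i) ?N ((s - \<tau> m) + v))) has_real_derivative
        (- \<alpha> i * (\<Sum>j\<le>?N. x (i, k + j) * decay (\<alpha> i) j ?u)
          + (\<Sum>j<?N. x (i, k + Suc j) * decay (\<alpha> i) j ?u))
        + (\<Sum>m=1..K. c i * (- \<alpha> i * decay (\<alpha> i) ?N ((s - \<tau> m) + v)
            + (if ?N = 0 then 0 else decay (\<alpha> i) (?N - 1) ((s - \<tau> m) + v))))) (at v within A)"
      by (intro DERIV_add DERIV_sum DERIV_cmult shift[OF has_real_derivative_decay]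
          shift[OF sum_decay_derivative])
    moreover have "(- \<alpha> i * (\<Sum>j\<le>?N. x (i, k + j) * decay (\<alpha> i) j ?u)
          + (\<Sum>j<?N. x (i, k + Suc j) * decay (\<alpha> i) j ?u))
        + (\<Sum>m=1..K. c i * (- \<alpha> i * decay (\<alpha> i) ?N ((s - \<tau> m) + v)
            + (if ?N = 0 then 0 else decay (\<alpha> i) (?N - 1) ((s - \<tau> m) + v))))
      = erlang_field L \<alpha> n (erlang_path L c \<alpha> n x \<tau> K ?u) p"
    proof (cases "k < n i")
      case True
      then have "{..<?N} = {..n i - Suc k}" "(i, Suc k) \<in> erlang_index L n" "?N \<noteq> 0"
        "?N - 1 = n i - Suc k"
        using ik by (auto simp: erlang_index_def)
      then show ?thesis using True ik \<open>(i, k) \<in> erlang_index L n\<close>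
        by (simp add: erlang_field_def erlang_path_def p sum.distrib sum_distrib_left algebra_simps
            sum_subtractf sum_negf)
    next
      case False
      then show ?thesis using ik \<open>(i, k) \<in> erlang_index L n\<close>
        by (auto simp: erlang_field_def erlang_path_def p sum.distrib sum_distrib_left algebra_simps)
    qed
    moreover have "(\<lambda>v. erlang_path L c \<alpha> n x \<tau> K (s + v) p) =
      (\<lambda>v. (\<Sum>j\<le>?N. x (i, k + j) * decay (\<alpha> i) j (s + v))
          + (\<Sum>m=1..K. c i * decay (\<alpha> i) ?N ((s - \<tau> m) + v)))"
      using True by (auto simp: erlang_path_def p fun_eq_iff algebra_simps)
    ultimately show ?thesis by metis
  qed
qed

lemma erlang_path_0:
  assumes "x \<in> erlang_space L n"
  shows "erlang_path L c \<alpha> n x \<tau> 0 0 = x"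
proof
  fix p :: "nat \<times> nat"
  obtain i k where p: "p = (i, k)" by force
  have "(\<Sum>j\<le>n i - k. x (i, k + j) * decay (\<alpha> i) j 0)
      = (\<Sum>j\<le>n i - k. if j = 0 then x (i, k) else 0)"
    by (intro sum.cong) (auto simp: decay_at_0)
  then show "erlang_path L c \<alpha> n x \<tau> 0 0 p = x p"
    using assms by (auto simp: erlang_path_def erlang_space_def p)
qed

lemma erlang_jump_eq:
  "erlang_jump L c n (i, k) = (if (i, k) \<in> erlang_index L n \<and> k = n i then c i else 0)"
proof -
  have "erlang_jump L c n (i, k) = (\<Sum>i'=1..L. if i' = i then (if k = n i then c i else 0) else 0)"
    unfolding erlang_jump_def by (intro sum.cong) (auto simp: indicator_def)
  then show ?thesis
    by (auto simp: erlang_index_def)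
qed

text \<open>
  At the time of a jump its own term is \<open>c i * decay (\<alpha> i) (n i - k) 0\<close>, which vanishes unless
  \<open>k = n i\<close>: adding one more jump to the closed form adds exactly \<open>erlang_jump\<close>.
\<close>

lemma erlang_path_jump:
  "erlang_path L c \<alpha> n x \<tau> K (\<tau> (Suc K)) p + erlang_jump L c n p
    = erlang_path L c \<alpha> n x \<tau> (Suc K) (\<tau> (Suc K)) p"
proof -
  obtain i k where p: "p = (i, k)" by force
  show ?thesis
    unfolding p by (auto simp: erlang_path_def erlang_jump_eq decay_at_0 erlang_index_def)
qed

lemma erlang_kernel_decay: "erlang_kernel L c \<alpha> n t = (\<Sum>i=1..L. c i * decay (\<alpha> i) (n i) t)"
  by (simp add: erlang_kernel_def decay_def mult.assoc)

text \<open>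
  The contribution of the initial state to \<open>\<Sum>i. x (i, 0)\<close>, the argument of \<open>f\<close>.
\<close>

definition memory ::
  "nat \<Rightarrow> (nat \<Rightarrow> real) \<Rightarrow> (nat \<Rightarrow> nat) \<Rightarrow> (nat \<times> nat \<Rightarrow> real) \<Rightarrow> real \<Rightarrow> real" where
  "memory L \<alpha> n x u = (\<Sum>i=1..L. \<Sum>j\<le>n i. x (i, j) * decay (\<alpha> i) j u)"

lemma sum_erlang_path:
  "(\<Sum>i=1..L. erlang_path L c \<alpha> n x \<tau> K u (i, 0))
    = memory L \<alpha> n x u + (\<Sum>m=1..K. erlang_kernel L c \<alpha> n (u - \<tau> m))"
proof -
  have "(\<Sum>i=1..L. erlang_path L c \<alpha> n x \<tau> K u (i, 0))
    = (\<Sum>i=1..L. (\<Sum>j\<le>n i. x (i, j) * decay (\<alpha> i) j u)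
        + (\<Sum>m=1..K. c i * decay (\<alpha> i) (n i) (u - \<tau> m)))"
    by (intro sum.cong) (auto simp: erlang_path_def erlang_index_def)
  also have "\<dots> = memory L \<alpha> n x u + (\<Sum>m=1..K. \<Sum>i=1..L. c i * decay (\<alpha> i) (n i) (u - \<tau> m))"
    unfolding sum.distrib memory_def by (intro arg_cong2[where f="(+)"] refl sum.swap)
  finally show ?thesis by (simp add: erlang_kernel_decay)
qed

text \<open>
  The binomial theorem separates \<open>u\<close> from \<open>s\<close>. The factors that depend on \<open>s\<close> are those in
  \<open>erlang_init_integrand\<close>.
\<close>

lemma decay_shift:
  "decay a N (u - s) = (\<Sum>j\<le>N. decay a j u * (exp (a * s) * ((- s) ^ (N - j) / fact (N - j))))"
proof -
  have "(u - s) ^ N / fact N = (\<Sum>j\<le>N. (u ^ j / fact j) * ((- s) ^ (N - j) / fact (N - j)))"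
  proof -
    have "(u + (- s)) ^ N = (\<Sum>j\<le>N. real (N choose j) * u ^ j * (- s) ^ (N - j))"
      by (rule binomial_ring)
    then have "(u - s) ^ N / fact N = (\<Sum>j\<le>N. real (N choose j) * u ^ j * (- s) ^ (N - j)) / fact N"
      by simp
    also have "\<dots> = (\<Sum>j\<le>N. (u ^ j / fact j) * ((- s) ^ (N - j) / fact (N - j)))"
      unfolding sum_divide_distrib
      by (intro sum.cong refl) (simp add: binomial_fact field_simps)
    finally show ?thesis .
  qed
  moreover have "exp (- a * (u - s)) = exp (- a * u) * exp (a * s)"
    by (simp add: exp_add[symmetric] algebra_simps)
  ultimately show ?thesis
    unfolding decay_def by (simp add: sum_distrib_left mult_ac)
qed

text \<open>
  The initial state stores the past \<open>\<eta>\<close> in finitely many moments, and these are all that the kernel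
  needs at any later time.
\<close>

lemma memory_erlang_init:
  assumes init: "\<And>p. p \<in> erlang_index L n \<Longrightarrow>
      set_integrable \<eta> {..0} (erlang_init_integrand c \<alpha> n p)"
  shows "(LINT s:{..0}|\<eta>. erlang_kernel L c \<alpha> n (u - s)) = memory L \<alpha> n (erlang_init L c \<alpha> n \<eta>) u"
proof -
  have idx: "(i, j) \<in> erlang_index L n" if "i \<in> {1..L}" "j \<le> n i" for i j
    using that by (auto simp: erlang_index_def)
  have int: "integrable \<eta> (\<lambda>s. indicator {..0} s * erlang_init_integrand c \<alpha> n (i, j) s)"
    if "i \<in> {1..L}" "j \<le> n i" for i j
    using init[OF idx[OF that]] by (simp add: set_integrable_def)
  have "erlang_kernel L c \<alpha> n (u - s)
      = (\<Sum>i=1..L. \<Sum>j\<le>n i. decay (\<alpha> i) j u * erlang_init_integrand c \<alpha> n (i, j) s)" for s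
    unfolding erlang_kernel_decay decay_shift erlang_init_integrand_def
    by (simp add: sum_distrib_left mult_ac)
  then have "(LINT s:{..0}|\<eta>. erlang_kernel L c \<alpha> n (u - s)) =
     (LINT s|\<eta>. (\<Sum>i=1..L. \<Sum>j\<le>n i.
        decay (\<alpha> i) j u * (indicator {..0} s * erlang_init_integrand c \<alpha> n (i, j) s)))"
    unfolding set_lebesgue_integral_def by (simp add: sum_distrib_left mult_ac)
  also have "\<dots> = (\<Sum>i=1..L. LINT s|\<eta>. (\<Sum>j\<le>n i.
        decay (\<alpha> i) j u * (indicator {..0} s * erlang_init_integrand c \<alpha> n (i, j) s)))"
    by (intro Bochner_Integration.integral_sum Bochner_Integration.integrable_sum
        integrable_mult_right int) auto
  also have "\<dots> = (\<Sum>i=1..L. \<Sum>j\<le>n i. decay (\<alpha> i) j u *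
      (LINT s|\<eta>. indicator {..0} s * erlang_init_integrand c \<alpha> n (i, j) s))"
    by (intro sum.cong refl, subst Bochner_Integration.integral_sum)
      (auto intro!: integrable_mult_right int)
  also have "\<dots> = memory L \<alpha> n (erlang_init L c \<alpha> n \<eta>) u"
    unfolding memory_def erlang_init_def set_lebesgue_integral_def
    by (intro sum.cong refl) (auto simp: idx mult_ac)
  finally show ?thesis .
qed

section \<open>Survival functions of bounded hazard rates\<close>

text \<open>
  For measurable \<open>g\<close> the integral \<open>G\<close> need not be differentiable everywhere, so the fundamental
  theorem of calculus is not applied to \<open>exp (- G)\<close>. Instead, between \<open>x\<close> and \<open>y\<close> both
  \<open>exp (- G x) - exp (- G y)\<close> and \<open>\<integral> g * exp (- G)\<close> lie between \<open>exp (- G y) * (G y - G x)\<close> and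
  \<open>exp (- G x) * (G y - G x)\<close>. Hence they differ by at most \<open>(G y - G x)\<^sup>2\<close>, which is quadratic in
  \<open>y - x\<close>, and \<open>exp (- G) + \<integral> g * exp (- G)\<close> has derivative \<open>0\<close>.
\<close>

lemma exp_cumulative_hazard:
  fixes g :: "real \<Rightarrow> real"
  assumes g[measurable]: "g \<in> borel_measurable borel"
    and nonneg: "\<And>s. 0 \<le> g s"
    and bound: "\<And>s. 0 \<le> s \<Longrightarrow> s \<le> v \<Longrightarrow> g s \<le> C"
    and v: "0 \<le> v"
  defines "G \<equiv> \<lambda>x. LINT s:{0..x}|lborel. g s"
  shows "\<And>x y. 0 \<le> x \<Longrightarrow> x \<le> y \<Longrightarrow> y \<le> v \<Longrightarrow> 0 \<le> G y - G x \<and> G y - G x \<le> C * (y - x)"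
    and "(\<integral>\<^sup>+s. ennreal (indicator {0..v} s * (g s * exp (- G s))) \<partial>lborel) = ennreal (1 - exp (- G v))"
proof -
  have C: "0 \<le> C" using nonneg[of 0] bound[of 0] v by simp
  have int: "set_integrable lborel A g" if "A \<subseteq> {0..v}" "A \<in> sets borel" for A
    unfolding set_integrable_def
  proof (rule Bochner_Integration.integrable_bound[of _ "\<lambda>s. C * indicator {0..v} s"])
    show "(\<lambda>x. indicat_real A x *\<^sub>R g x) \<in> borel_measurable lborel"
      using that by measurable
    show "AE x in lborel. norm (indicat_real A x *\<^sub>R g x) \<le> norm (C * indicat_real {0..v} x)"
    proof (intro AE_I2)
      fix s show "norm (indicat_real A s *\<^sub>R g s) \<le> norm (C * indicat_real {0..v} s)"
        using that(1) nonneg[of s] bound[of s] C by (auto simp: indicator_def split: if_splits)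
    qed
    show "integrable lborel (\<lambda>s. C * indicat_real {0..v} s)"
      using v by (intro integrable_mult_right integrable_real_indicator) (simp_all add: ennreal_less_top)
  qed
  have split: "{0..y} = {0..x} \<union> {x<..y}" if "0 \<le> x" "x \<le> y" for x y :: real
    using that by auto
  have G_diff: "G y - G x = (LINT s:{x<..y}|lborel. g s)" if "0 \<le> x" "x \<le> y" "y \<le> v" for x y
    unfolding G_def split[OF that(1,2)]
    using that by (subst set_integral_Un) (auto intro!: int)
  show 1: "0 \<le> G y - G x \<and> G y - G x \<le> C * (y - x)" if "0 \<le> x" "x \<le> y" "y \<le> v" for x y
  proof
    show "0 \<le> G y - G x"
      unfolding G_diff[OF that] set_lebesgue_integral_def
      by (intro Bochner_Integration.integral_nonneg) (simp add: nonneg)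
    have "(LINT s:{x<..y}|lborel. g s) \<le> (LINT s:{x<..y}|lborel. C)"
      using that by (intro set_integral_mono int) (auto intro!: bound integrable_mult_left
          integrable_real_indicator simp: set_integrable_def ennreal_less_top)
    also have "\<dots> = C * (y - x)"
      using that by (simp add: set_lebesgue_integral_def)
    finally show "G y - G x \<le> C * (y - x)" unfolding G_diff[OF that] .
  qed
  have point: "(LINT s:{0..0::real}|lborel. f s) = 0" for f :: "real \<Rightarrow> real"
    unfolding set_lebesgue_integral_def
    using AE_lborel_singleton[of "0 :: real"]
    by (intro integral_eq_zero_AE) (elim eventually_mono, simp)
  have G0: "G 0 = 0" by (simp only: G_def point)
  have G_nonneg: "0 \<le> G x" if "0 \<le> x" for x
    unfolding G_def set_lebesgue_integral_def
    by (intro Bochner_Integration.integral_nonneg) (simp add: nonneg)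
  have G_measurable[measurable]: "G \<in> borel_measurable borel"
    unfolding G_def set_lebesgue_integral_def atLeastAtMost_def atLeast_def atMost_def by measurable
  let ?e = "\<lambda>s. g s * exp (- G s)"
  have int_e: "set_integrable lborel A ?e" if "A \<subseteq> {0..v}" "A \<in> sets borel" for A
    unfolding set_integrable_def
  proof (rule Bochner_Integration.integrable_bound[OF int[OF that, unfolded set_integrable_def]])
    show "(\<lambda>x. indicat_real A x *\<^sub>R ?e x) \<in> borel_measurable lborel"
      using that by measurable
    show "AE x in lborel. norm (indicat_real A x *\<^sub>R ?e x) \<le> norm (indicat_real A x *\<^sub>R g x)"
    proof (intro AE_I2)
      fix s show "norm (indicat_real A s *\<^sub>R ?e s) \<le> norm (indicat_real A s *\<^sub>R g s)"
        using that(1) nonneg[of s] mult_left_mono[of "exp (- G s)" 1 "g s"] G_nonneg[of s]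
        by (cases "s \<in> A") (auto simp: subset_eq)
    qed
  qed
  define E where "E x = (LINT s:{0..x}|lborel. ?e s)" for x
  have E_diff: "E y - E x = (LINT s:{x<..y}|lborel. ?e s)" if "0 \<le> x" "x \<le> y" "y \<le> v" for x y
    unfolding E_def split[OF that(1,2)]
    using that by (subst set_integral_Un) (auto intro!: int_e)
  have E0: "E 0 = 0" by (simp only: E_def point)
  define D where "D x = exp (- G x) + E x" for x
  have D_diff: "\<bar>D y - D x\<bar> \<le> (C * (y - x))\<^sup>2" if xy: "0 \<le> x" "x \<le> y" "y \<le> v" for x y
  proof -
    let ?d = "G y - G x"
    have d: "0 \<le> ?d" "?d \<le> C * (y - x)" using 1[OF xy] by auto
    have "E y - E x \<le> (LINT s:{x<..y}|lborel. g s * exp (- G x))"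
      unfolding E_diff[OF xy] using xy nonneg 1[of x]
      by (intro set_integral_mono int_e set_integrable_mult_left int) (auto intro!: mult_left_mono)
    also have "\<dots> = exp (- G x) * ?d" unfolding G_diff[OF xy] by simp
    finally have u: "E y - E x \<le> exp (- G x) * ?d" .
    have "exp (- G y) * ?d = (LINT s:{x<..y}|lborel. g s * exp (- G y))"
      unfolding G_diff[OF xy] by simp
    also have "\<dots> \<le> E y - E x"
      unfolding E_diff[OF xy] using xy nonneg 1[of _ y]
      by (intro set_integral_mono int_e set_integrable_mult_left int) (auto intro!: mult_left_mono)
    finally have l: "exp (- G y) * ?d \<le> E y - E x" .
    have e: "exp (- G y) = exp (- G x) * exp (- ?d)" by (simp add: exp_add[symmetric])
    have e1: "1 - ?d \<le> exp (- ?d)" using exp_ge_add_one_self[of "- ?d"] by linarith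
    have e2: "1 + ?d \<le> exp ?d" using exp_ge_add_one_self[of ?d] by linarith
    have gx: "exp (- G x) \<le> 1" using G_nonneg[OF xy(1)] by simp
    have A: "exp (- G x) - exp (- G y) \<le> exp (- G x) * ?d"
      unfolding e using mult_left_mono[OF e1, of "exp (- G x)"] by (simp add: algebra_simps)
    have "exp (- G x) = exp (- G y) * exp ?d" by (simp add: exp_add[symmetric])
    then have B: "exp (- G y) * ?d \<le> exp (- G x) - exp (- G y)"
      using mult_left_mono[OF e2, of "exp (- G y)"] by (simp add: algebra_simps)
    have "\<bar>D y - D x\<bar> \<le> (exp (- G x) - exp (- G y)) * ?d"
      using u l A B unfolding D_def abs_le_iff by (simp add: algebra_simps)
    also have "\<dots> \<le> (exp (- G x) * ?d) * ?d"
      using A d by (intro mult_right_mono) auto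
    also have "\<dots> \<le> (1 * ?d) * ?d"
      using gx d by (intro mult_right_mono) auto
    also have "\<dots> \<le> (C * (y - x))\<^sup>2"
      using d by (simp add: power2_eq_square mult_mono)
    finally show ?thesis .
  qed
  have "(D has_real_derivative 0) (at x within {0..v})" if x: "x \<in> {0..v}" for x
    unfolding has_field_derivative_iff
  proof (rule Lim_null_comparison)
    show "((\<lambda>y. C\<^sup>2 * \<bar>y - x\<bar>) \<longlongrightarrow> 0) (at x within {0..v})"
      by (auto intro!: tendsto_eq_intros)
    show "\<forall>\<^sub>F y in at x within {0..v}. norm ((D y - D x) / (y - x)) \<le> C\<^sup>2 * \<bar>y - x\<bar>"
      unfolding eventually_at_filter
    proof (rule always_eventually, intro allI impI)
      fix y assume "y \<noteq> x" "y \<in> {0..v}"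
      then have "\<bar>D y - D x\<bar> \<le> (C * \<bar>y - x\<bar>)\<^sup>2"
        using D_diff[of x y] D_diff[of y x] x by (cases "x \<le> y") (auto simp: abs_minus_commute)
      with \<open>y \<noteq> x\<close> show "norm ((D y - D x) / (y - x)) \<le> C\<^sup>2 * \<bar>y - x\<bar>"
        by (simp add: divide_le_eq power2_eq_square mult_ac)
    qed
  qed
  from has_field_derivative_zero_constant[OF convex_real_interval(5) this]
  obtain K where K: "\<And>x. x \<in> {0..v} \<Longrightarrow> D x = K" by auto
  have "E v = 1 - exp (- G v)"
    using K[of 0] K[of v] v by (simp add: D_def E0 G0)
  moreover have "(\<integral>\<^sup>+s. ennreal (indicator {0..v} s * ?e s) \<partial>lborel) = ennreal (E v)"
    using int_e[of "{0..v}"] nonneg unfolding E_def set_lebesgue_integral_def set_integrable_def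
    by (subst nn_integral_eq_integral) auto
  ultimately show "(\<integral>\<^sup>+s. ennreal (indicator {0..v} s * ?e s) \<partial>lborel) = ennreal (1 - exp (- G v))"
    by simp
qed

section \<open>Random times with prescribed hazard rates\<close>

text \<open>
  The approximation is strictly from above, because survival probabilities are right-continuous.
\<close>

lemma grid_approximation:
  fixes V :: real
  defines "W \<equiv> \<lambda>m. (real_of_int \<lfloor>real (Suc m) * V\<rfloor> + 1) / real (Suc m)"
  shows "V < W m" and "W m \<le> V + inverse (real (Suc m))" and "W \<longlonglongrightarrow> V"
proof -
  show 1: "V < W m" for m
    unfolding W_def by (simp add: less_divide_eq mult.commute)
  show 2: "W m \<le> V + inverse (real (Suc m))" for m
  proof -
    have "W m = real_of_int \<lfloor>real (Suc m) * V\<rfloor> / real (Suc m) + inverse (real (Suc m))"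
      by (simp only: W_def add_divide_distrib inverse_eq_divide)
    also have "real_of_int \<lfloor>real (Suc m) * V\<rfloor> / real (Suc m) \<le> V"
      by (subst divide_le_eq) (simp add: mult.commute del: of_nat_Suc)
    finally show ?thesis by simp
  qed
  show "W \<longlonglongrightarrow> V"
  proof (rule tendsto_sandwich[OF always_eventually always_eventually tendsto_const])
    show "(\<lambda>m. V + inverse (real (Suc m))) \<longlonglongrightarrow> V"
      using tendsto_add[OF tendsto_const LIMSEQ_inverse_real_of_nat] by simp
  qed (use 1 2 less_imp_le in blast)+
qed

definition past :: "'w measure \<Rightarrow> (nat \<Rightarrow> 'w \<Rightarrow> ennreal) \<Rightarrow> nat \<Rightarrow> 'w measure" where
  "past M T k = sigma (space M) {T j -` B \<inter> space M | j B. j \<le> k \<and> B \<in> sets borel}"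

lemma space_past [simp]: "space (past M T k) = space M"
  unfolding past_def by (intro space_measure_of) auto

lemma past_time_measurable:
  assumes "j \<le> k"
  shows "T j \<in> borel_measurable (past M T k)"
proof (rule measurableI)
  fix B :: "ennreal set" assume "B \<in> sets borel"
  with assms show "T j -` B \<inter> space (past M T k) \<in> sets (past M T k)"
    unfolding space_past by (auto simp: past_def sets_measure_of_conv)
qed simp

lemma le_ennreal_iff_enn2real_le:
  "x < \<infinity> \<Longrightarrow> 0 \<le> u \<Longrightarrow> x \<le> ennreal u \<longleftrightarrow> enn2real x \<le> u"
  by (cases x rule: ennreal_cases) auto

text \<open>
  Given \<open>T 0, \<dots>, T k\<close>, the time \<open>T (k + 1)\<close> has the hazard rate \<open>\<rho> k u\<close> at the time \<open>u\<close> after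
  \<open>T k\<close>. The bound is affine in \<open>k\<close>, with coefficients that may depend on the time horizon; this
  excludes explosion without bounding the rates uniformly.
\<close>

locale hazard_times = prob_space M
  for M :: "'w measure"
    and T :: "nat \<Rightarrow> 'w \<Rightarrow> ennreal"
    and \<rho> :: "nat \<Rightarrow> real \<Rightarrow> 'w \<Rightarrow> real" +
  assumes T_measurable[measurable]: "\<And>k. T k \<in> borel_measurable M"
    and T_0: "\<And>\<omega>. \<omega> \<in> space M \<Longrightarrow> T 0 \<omega> = 0"
    and T_Suc: "\<And>k \<omega>. \<omega> \<in> space M \<Longrightarrow> T k \<omega> < \<infinity> \<Longrightarrow> T k \<omega> < T (Suc k) \<omega>"
    and T_top: "\<And>k \<omega>. \<omega> \<in> space M \<Longrightarrow> T k \<omega> = \<infinity> \<Longrightarrow> T (Suc k) \<omega> = \<infinity>"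
    and rate_measurable: "\<And>k. (\<lambda>(\<omega>, u). \<rho> k u \<omega>) \<in> borel_measurable (past M T k \<Otimes>\<^sub>M borel)"
    and rate_nonneg: "\<And>k u \<omega>. 0 \<le> \<rho> k u \<omega>"
    and rate_bound: "\<And>t. \<exists>a>0. \<exists>b\<ge>0. \<forall>k u. \<forall>\<omega>\<in>space M.
      0 \<le> u \<longrightarrow> u \<le> t \<longrightarrow> T k \<omega> \<le> ennreal u \<longrightarrow> \<rho> k u \<omega> \<le> a + b * real k"
    and hazard: "\<And>k v. 0 \<le> v \<Longrightarrow> AE \<omega> in M. T k \<omega> < \<infinity> \<longrightarrow>
      real_cond_exp M (past M T k)
        (indicator {\<omega>' \<in> space M. T k \<omega>' + ennreal v < T (Suc k) \<omega>'}) \<omega>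
      = exp (- (LINT s:{0..v}|lborel. \<rho> k (enn2real (T k \<omega>) + s) \<omega>))"
begin

abbreviation \<tau> :: "nat \<Rightarrow> 'w \<Rightarrow> real" where "\<tau> k \<omega> \<equiv> enn2real (T k \<omega>)"

abbreviation P :: "nat \<Rightarrow> 'w measure" where "P k \<equiv> past M T k"

definition hazard_integral :: "nat \<Rightarrow> real \<Rightarrow> 'w \<Rightarrow> real" where
  "hazard_integral k v \<omega> = (LINT s:{0..v}|lborel. \<rho> k (\<tau> k \<omega> + s) \<omega>)"

lemma past_subalgebra: "subalgebra M (P k)"
proof -
  have "sets (P k) \<subseteq> sets M"
    unfolding past_def by (subst sets_measure_of) (auto intro!: sets.sigma_sets_subset measurable_sets)
  then show ?thesis by (simp add: subalgebra_def)
qed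

lemma past_sigma_finite: "sigma_finite_subalgebra M (P k)"
proof -
  interpret finite_measure_subalgebra M "P k"
    by unfold_locales (rule past_subalgebra)
  show ?thesis by unfold_locales
qed

lemma past_sets: "A \<in> sets (P k) \<Longrightarrow> A \<in> sets M"
  using past_subalgebra by (auto simp: subalgebra_def)

lemma measurable_past: "f \<in> measurable (P k) N \<Longrightarrow> f \<in> measurable M N"
  using measurable_from_subalg[OF past_subalgebra] .

lemma T_past[measurable]: "T k \<in> borel_measurable (P k)"
  by (rule past_time_measurable) simp

lemma rate_measurable_at[measurable (raw)]:
  assumes [measurable]: "f \<in> measurable N (P k)" "g \<in> borel_measurable N"
  shows "(\<lambda>x. \<rho> k (g x) (f x)) \<in> borel_measurable N"
proof -
  have "(\<lambda>x. (f x, g x)) \<in> measurable N (P k \<Otimes>\<^sub>M borel)" by measurable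
  from measurable_compose[OF this rate_measurable] show ?thesis by simp
qed

lemma hazard_integral_measurable[measurable (raw)]:
  assumes [measurable]: "f \<in> measurable N (P k)" "g \<in> borel_measurable N"
  shows "(\<lambda>x. hazard_integral k (g x) (f x)) \<in> borel_measurable N"
  unfolding hazard_integral_def set_lebesgue_integral_def atLeastAtMost_def atLeast_def atMost_def
  by measurable

lemma hazard_integral_nonneg: "0 \<le> hazard_integral k v \<omega>"
  unfolding hazard_integral_def set_lebesgue_integral_def
  by (intro Bochner_Integration.integral_nonneg) (simp add: rate_nonneg)

lemma T_mono: "\<omega> \<in> space M \<Longrightarrow> j \<le> k \<Longrightarrow> T j \<omega> \<le> T k \<omega>"
proof (induction k rule: nat_induct)
  case (Suc k)
  have "T k \<omega> \<le> T (Suc k) \<omega>"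
    using T_Suc[of \<omega> k] T_top[of \<omega> k] Suc.prems(1) by (cases "T k \<omega> = \<infinity>") (auto simp: less_top)
  with Suc show ?case by (cases "j = Suc k") (auto simp: le_Suc_eq)
qed simp

lemma T_strict: "\<omega> \<in> space M \<Longrightarrow> j < k \<Longrightarrow> T j \<omega> < \<infinity> \<Longrightarrow> T j \<omega> < T k \<omega>"
  using T_Suc[of \<omega> j] T_mono[of \<omega> "Suc j" k] by (auto intro: less_le_trans)

lemma hazard_integral_props:
  assumes \<omega>: "\<omega> \<in> space M" "T k \<omega> < \<infinity>" and v: "0 \<le> v"
  shows "\<exists>C\<ge>0. \<forall>x y. 0 \<le> x \<longrightarrow> x \<le> y \<longrightarrow> y \<le> v \<longrightarrow>
       0 \<le> hazard_integral k y \<omega> - hazard_integral k x \<omega> \<and>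
       hazard_integral k y \<omega> - hazard_integral k x \<omega> \<le> C * (y - x)"
    and "(\<integral>\<^sup>+s. ennreal (indicator {0..v} s * (\<rho> k (\<tau> k \<omega> + s) \<omega> * exp (- hazard_integral k s \<omega>))) \<partial>lborel)
      = ennreal (1 - exp (- hazard_integral k v \<omega>))"
proof -
  obtain a b where ab: "a > 0" "b \<ge> 0" "\<And>u. 0 \<le> u \<Longrightarrow> u \<le> \<tau> k \<omega> + v \<Longrightarrow> T k \<omega> \<le> ennreal u \<Longrightarrow>
      \<rho> k u \<omega> \<le> a + b * real k"
    using rate_bound[of "\<tau> k \<omega> + v"] \<omega>(1) by blast
  have g: "(\<lambda>s. \<rho> k (\<tau> k \<omega> + s) \<omega>) \<in> borel_measurable borel"
    using \<omega> by (intro rate_measurable_at) auto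
  have bd: "\<rho> k (\<tau> k \<omega> + s) \<omega> \<le> a + b * real k" if "0 \<le> s" "s \<le> v" for s
    using that \<omega>(2) by (intro ab(3)) (simp_all add: le_ennreal_iff_enn2real_le)
  note * = exp_cumulative_hazard[OF g rate_nonneg bd v, folded hazard_integral_def]
  show "\<exists>C\<ge>0. \<forall>x y. 0 \<le> x \<longrightarrow> x \<le> y \<longrightarrow> y \<le> v \<longrightarrow>
       0 \<le> hazard_integral k y \<omega> - hazard_integral k x \<omega> \<and>
       hazard_integral k y \<omega> - hazard_integral k x \<omega> \<le> C * (y - x)"
    using *(1) ab(1,2) by (intro exI[of _ "a + b * real k"] conjI) auto
  show "(\<integral>\<^sup>+s. ennreal (indicator {0..v} s * (\<rho> k (\<tau> k \<omega> + s) \<omega> * exp (- hazard_integral k s \<omega>))) \<partial>lborel)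
      = ennreal (1 - exp (- hazard_integral k v \<omega>))"
    by (rule *(2))
qed

lemma survival_at_constant:
  assumes A: "A \<in> sets (P k)" "A \<subseteq> {\<omega>. T k \<omega> < \<infinity>}" and v: "0 \<le> v"
  shows "(\<integral>\<omega>. indicator A \<omega> * indicator {\<omega>' \<in> space M. T k \<omega>' + ennreal v < T (Suc k) \<omega>'} \<omega> \<partial>M)
    = (\<integral>\<omega>. indicator A \<omega> * exp (- hazard_integral k v \<omega>) \<partial>M)"
proof -
  interpret S: sigma_finite_subalgebra M "P k" by (rule past_sigma_finite)
  let ?I = "indicator {\<omega>' \<in> space M. T k \<omega>' + ennreal v < T (Suc k) \<omega>'} :: 'w \<Rightarrow> real"
  have [measurable]: "A \<in> sets M" by (rule past_sets[OF A(1)])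
  have [measurable]: "(\<lambda>\<omega>. hazard_integral k v \<omega>) \<in> borel_measurable M"
    by (rule measurable_past[of _ k]) measurable
  have "integrable M ?I" by (intro integrable_real_indicator) (auto simp: less_top[symmetric])
  from S.real_cond_exp_intA[OF this A(1)]
  have "(\<integral>\<omega>. indicator A \<omega> * ?I \<omega> \<partial>M) = (\<integral>\<omega>. indicator A \<omega> * real_cond_exp M (P k) ?I \<omega> \<partial>M)"
    by (simp add: set_lebesgue_integral_def)
  also have "\<dots> = (\<integral>\<omega>. indicator A \<omega> * exp (- hazard_integral k v \<omega>) \<partial>M)"
  proof (intro integral_cong_AE)
    show "AE \<omega> in M. indicator A \<omega> * real_cond_exp M (P k) ?I \<omega>
        = indicator A \<omega> * exp (- hazard_integral k v \<omega>)"
      using hazard[OF v, of k, folded hazard_integral_def] A(2)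
      by (elim eventually_mono) (auto simp: indicator_def)
  qed measurable
  finally show ?thesis .
qed

text \<open>
  The hazard rates are given for waiting times that do not depend on \<open>\<omega>\<close>, but a fixed time \<open>u\<close> is the waiting
  time \<open>u - T k\<close>, which is random and known at \<open>T k\<close>. It is approximated by waiting times with values in a grid,
  where the constant case applies on each of finitely many events of the past.
\<close>

lemma survival_at_time:
  assumes A: "A \<in> sets (P k)" "A \<subseteq> {\<omega>. T k \<omega> \<le> ennreal u}" and u: "0 \<le> u"
  shows "(\<integral>\<omega>. indicator A \<omega> * indicator {\<omega>' \<in> space M. ennreal u < T (Suc k) \<omega>'} \<omega> \<partial>M)
    = (\<integral>\<omega>. indicator A \<omega> * exp (- hazard_integral k (u - \<tau> k \<omega>) \<omega>) \<partial>M)"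
proof -
  define V where "V \<omega> = u - \<tau> k \<omega>" for \<omega>
  define W where "W m \<omega> = (real_of_int \<lfloor>real (Suc m) * V \<omega>\<rfloor> + 1) / real (Suc m)" for m \<omega>
  define S where "S v = (indicator {\<omega>' \<in> space M. T k \<omega>' + ennreal v < T (Suc k) \<omega>'} :: 'w \<Rightarrow> real)" for v
  have [measurable]: "V \<in> borel_measurable (P k)" "W m \<in> borel_measurable (P k)" for m
    unfolding V_def W_def by measurable
  have [measurable]: "V \<in> borel_measurable M" "W m \<in> borel_measurable M" for m
    by (auto intro!: measurable_past[of _ k])
  have [measurable]: "A \<in> sets M" by (rule past_sets[OF A(1)])
  have AM: "\<omega> \<in> A \<Longrightarrow> \<omega> \<in> space M" for \<omega> using sets.sets_into_space[OF A(1)] by auto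
  have fin: "T k \<omega> < \<infinity>" if "\<omega> \<in> A" for \<omega> using A(2) that by (auto intro: le_less_trans)
  have V: "0 \<le> V \<omega>" "V \<omega> \<le> u" if "\<omega> \<in> A" for \<omega>
    using A(2) that fin[OF that] u by (auto simp: V_def le_ennreal_iff_enn2real_le)
  have W: "V \<omega> < W m \<omega>" "W m \<omega> \<le> V \<omega> + inverse (real (Suc m))" "(\<lambda>m. W m \<omega>) \<longlonglongrightarrow> V \<omega>" for m \<omega>
    unfolding W_def by (rule grid_approximation)+
  have Hm[measurable]: "(\<lambda>\<omega>. hazard_integral k (v \<omega>) \<omega>) \<in> borel_measurable M"
    if [measurable]: "v \<in> borel_measurable (P k)" for v
    by (rule measurable_past[of _ k]) measurable
  have step: "(\<integral>\<omega>. indicator A \<omega> * S (W m \<omega>) \<omega> \<partial>M)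
      = (\<integral>\<omega>. indicator A \<omega> * exp (- hazard_integral k (W m \<omega>) \<omega>) \<partial>M)" for m
  proof -
    \<comment> \<open>\<open>J \<omega>\<close> is the index of the grid point below \<open>V \<omega>\<close>, and \<open>W m \<omega>\<close> is the next grid point.\<close>
    define J where "J \<omega> = nat \<lfloor>real (Suc m) * V \<omega>\<rfloor>" for \<omega>
    define N where "N = nat \<lfloor>real (Suc m) * u\<rfloor>"
    define q where "q j = real (Suc j) / real (Suc m)" for j
    define B where "B j = {\<omega> \<in> A. J \<omega> = j}" for j
    have J: "J \<omega> \<le> N" "W m \<omega> = q (J \<omega>)" if "\<omega> \<in> A" for \<omega>
    proof -
      show "J \<omega> \<le> N"
        unfolding J_def N_def using V(2)[OF that] by (intro nat_mono floor_mono mult_left_mono) auto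
      have "0 \<le> \<lfloor>real (Suc m) * V \<omega>\<rfloor>" using V(1)[OF that] by simp
      then show "W m \<omega> = q (J \<omega>)"
        unfolding W_def q_def J_def by simp
    qed
    have [measurable]: "J \<in> measurable (P k) (count_space UNIV)"
      unfolding J_def by measurable
    have BP: "B j \<in> sets (P k)" for j
    proof -
      have "B j = A \<inter> {\<omega> \<in> space (P k). J \<omega> = j}" using AM by (auto simp: B_def)
      moreover have "{\<omega> \<in> space (P k). J \<omega> = j} \<in> sets (P k)" by measurable
      ultimately show ?thesis using A(1) by (metis sets.Int)
    qed
    then have [measurable]: "B j \<in> sets M" for j by (rule past_sets)
    have decomp: "indicator A \<omega> * g (W m \<omega>) = (\<Sum>j\<le>N. indicator (B j) \<omega> * g (q j))"
      for g :: "real \<Rightarrow> real" and \<omega>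
    proof (cases "\<omega> \<in> A")
      case True
      then have "(\<Sum>j\<le>N. indicator (B j) \<omega> * g (q j)) = (\<Sum>j\<le>N. if j = J \<omega> then g (q j) else 0)"
        by (intro sum.cong) (auto simp: B_def)
      with True J show ?thesis by simp
    qed (simp add: B_def)
    have bdd: "integrable M (\<lambda>\<omega>. indicator (B j) \<omega> * S v \<omega>)" for j v
      unfolding S_def
      by (rule integrable_const_bound[of _ 1]) (auto simp: indicator_def)
    have bdd': "integrable M (\<lambda>\<omega>. indicator (B j) \<omega> * exp (- hazard_integral k v \<omega>))" for j v
      by (rule integrable_const_bound[of _ 1]) (auto simp: indicator_def hazard_integral_nonneg)
    have decomp_H: "indicator A \<omega> * exp (- hazard_integral k (W m \<omega>) \<omega>)
        = (\<Sum>j\<le>N. indicator (B j) \<omega> * exp (- hazard_integral k (q j) \<omega>))" for \<omega>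
      by (rule decomp)
    have "(\<integral>\<omega>. indicator A \<omega> * S (W m \<omega>) \<omega> \<partial>M) = (\<Sum>j\<le>N. \<integral>\<omega>. indicator (B j) \<omega> * S (q j) \<omega> \<partial>M)"
      by (subst decomp) (intro Bochner_Integration.integral_sum bdd)
    also have "\<dots> = (\<Sum>j\<le>N. \<integral>\<omega>. indicator (B j) \<omega> * exp (- hazard_integral k (q j) \<omega>) \<partial>M)"
      unfolding S_def using BP fin
      by (intro sum.cong refl survival_at_constant) (auto simp: B_def q_def)
    also have "\<dots> = (\<integral>\<omega>. indicator A \<omega> * exp (- hazard_integral k (W m \<omega>) \<omega>) \<partial>M)"
      unfolding decomp_H by (intro Bochner_Integration.integral_sum[symmetric] bdd')
    finally show ?thesis .
  qed
  have Tk: "T k \<omega> + ennreal v = ennreal (\<tau> k \<omega> + v)" if "\<omega> \<in> A" "0 \<le> v" for \<omega> v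
    using fin[OF that(1)] that(2) by (cases "T k \<omega>" rule: ennreal_cases) auto
  have lim_S: "(\<lambda>m. indicator A \<omega> * S (W m \<omega>) \<omega>)
      \<longlonglongrightarrow> indicator A \<omega> * indicator {\<omega>' \<in> space M. ennreal u < T (Suc k) \<omega>'} \<omega>" for \<omega>
  proof (cases "\<omega> \<in> A")
    case True
    have W0: "0 \<le> W m \<omega>" for m using V(1)[OF True] W(1)[of \<omega> m] by simp
    have lim: "(\<lambda>m. ennreal (\<tau> k \<omega> + W m \<omega>)) \<longlonglongrightarrow> ennreal u"
    proof (rule tendsto_ennrealI)
      show "(\<lambda>m. \<tau> k \<omega> + W m \<omega>) \<longlonglongrightarrow> u"
        using tendsto_add[OF tendsto_const W(3)[of \<omega>], of "\<tau> k \<omega>"] by (simp add: V_def)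
    qed
    show ?thesis
    proof (cases "ennreal u < T (Suc k) \<omega>")
      case less: True
      have "\<forall>\<^sub>F m in sequentially. S (W m \<omega>) \<omega> = 1"
        using order_tendstoD(2)[OF lim less] by eventually_elim (use True AM W0 in \<open>auto simp: S_def Tk\<close>)
      then show ?thesis using True AM less by (intro tendsto_eventually) (auto elim: eventually_mono)
    next
      case False
      have "S (W m \<omega>) \<omega> = 0" for m
      proof -
        have "T (Suc k) \<omega> \<le> ennreal u" using False by simp
        also have "\<dots> \<le> ennreal (\<tau> k \<omega> + W m \<omega>)" using W(1)[of \<omega> m] by (intro ennreal_leI) (simp add: V_def)
        also have "\<dots> = T k \<omega> + ennreal (W m \<omega>)" by (rule Tk[OF True W0, symmetric])
        finally show ?thesis by (auto simp: S_def indicator_def)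
      qed
      then show ?thesis using False by simp
    qed
  qed simp
  have lim_H: "(\<lambda>m. indicator A \<omega> * exp (- hazard_integral k (W m \<omega>) \<omega>))
      \<longlonglongrightarrow> indicator A \<omega> * exp (- hazard_integral k (u - \<tau> k \<omega>) \<omega>)" for \<omega>
  proof (cases "\<omega> \<in> A")
    case True
    have V1: "0 \<le> V \<omega> + 1" using V(1)[OF True] by simp
    obtain C where C: "0 \<le> C" "\<And>x y. 0 \<le> x \<Longrightarrow> x \<le> y \<Longrightarrow> y \<le> V \<omega> + 1 \<Longrightarrow>
       0 \<le> hazard_integral k y \<omega> - hazard_integral k x \<omega> \<and>
       hazard_integral k y \<omega> - hazard_integral k x \<omega> \<le> C * (y - x)"
      using hazard_integral_props(1)[OF AM[OF True] fin[OF True] V1] by blast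
    have "(\<lambda>m. hazard_integral k (W m \<omega>) \<omega> - hazard_integral k (V \<omega>) \<omega>) \<longlonglongrightarrow> 0"
    proof (rule Lim_null_comparison[OF always_eventually])
      show "(\<lambda>m. C * (W m \<omega> - V \<omega>)) \<longlonglongrightarrow> 0"
        using tendsto_mult_right_zero[OF LIM_zero[OF W(3)[of \<omega>]]] by simp
      show "\<forall>m. norm (hazard_integral k (W m \<omega>) \<omega> - hazard_integral k (V \<omega>) \<omega>) \<le> C * (W m \<omega> - V \<omega>)"
      proof
        fix m
        have "inverse (real (Suc m)) \<le> 1" by (simp add: inverse_le_1_iff)
        with W(2)[of m \<omega>] have "W m \<omega> \<le> V \<omega> + 1" by linarith
        with C(2)[OF V(1)[OF True] less_imp_le[OF W(1)[of \<omega> m]]]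
        show "norm (hazard_integral k (W m \<omega>) \<omega> - hazard_integral k (V \<omega>) \<omega>) \<le> C * (W m \<omega> - V \<omega>)"
          by simp
      qed
    qed
    then show ?thesis
      unfolding V_def[symmetric] by (intro tendsto_intros) (simp add: LIM_zero_iff)
  qed simp
  have [measurable]: "(\<lambda>\<omega>. S (W m \<omega>) \<omega>) \<in> borel_measurable M" for m
    unfolding S_def indicator_def by measurable
  have 1: "(\<lambda>m. \<integral>\<omega>. indicator A \<omega> * S (W m \<omega>) \<omega> \<partial>M)
      \<longlonglongrightarrow> (\<integral>\<omega>. indicator A \<omega> * indicator {\<omega>' \<in> space M. ennreal u < T (Suc k) \<omega>'} \<omega> \<partial>M)"
  proof (rule integral_dominated_convergence[where w = "\<lambda>_. 1"])
    show "AE \<omega> in M. (\<lambda>m. indicator A \<omega> * S (W m \<omega>) \<omega>)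
        \<longlonglongrightarrow> indicator A \<omega> * indicator {\<omega>' \<in> space M. ennreal u < T (Suc k) \<omega>'} \<omega>"
      by (intro AE_I2 lim_S)
    show "AE \<omega> in M. norm (indicator A \<omega> * S (W m \<omega>) \<omega>) \<le> 1" for m
      by (intro AE_I2) (auto simp: indicator_def S_def)
  qed simp_all
  have 2: "(\<lambda>m. \<integral>\<omega>. indicator A \<omega> * exp (- hazard_integral k (W m \<omega>) \<omega>) \<partial>M)
      \<longlonglongrightarrow> (\<integral>\<omega>. indicator A \<omega> * exp (- hazard_integral k (u - \<tau> k \<omega>) \<omega>) \<partial>M)"
  proof (rule integral_dominated_convergence[where w = "\<lambda>_. 1"])
    show "AE \<omega> in M. (\<lambda>m. indicator A \<omega> * exp (- hazard_integral k (W m \<omega>) \<omega>))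
        \<longlonglongrightarrow> indicator A \<omega> * exp (- hazard_integral k (u - \<tau> k \<omega>) \<omega>)"
      by (intro AE_I2 lim_H)
    show "AE \<omega> in M. norm (indicator A \<omega> * exp (- hazard_integral k (W m \<omega>) \<omega>)) \<le> 1" for m
      by (intro AE_I2) (auto simp: indicator_def hazard_integral_nonneg)
  qed simp_all
  from LIMSEQ_unique[OF 1[unfolded step] 2] show ?thesis .
qed

lemma integrable_survival:
  assumes [measurable]: "A \<in> sets M" "v \<in> borel_measurable (P k)"
  shows "integrable M (\<lambda>\<omega>. indicator A \<omega> * exp (- hazard_integral k (v \<omega>) \<omega>))"
proof -
  have [measurable]: "(\<lambda>\<omega>. hazard_integral k (v \<omega>) \<omega>) \<in> borel_measurable M"
    by (rule measurable_past[of _ k]) measurable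
  show ?thesis
    by (rule integrable_const_bound[of _ 1]) (auto simp: indicator_def hazard_integral_nonneg)
qed

text \<open>
  In terms of conditional expectations: given the past of \<open>T k\<close>, the event that \<open>u\<close> lies in
  \<open>[T k, T (k + 1))\<close> has on \<open>{T k \<le> u}\<close> the probability \<open>exp (- \<integral> \<rho> k)\<close>, with the integral from
  \<open>T k\<close> to \<open>u\<close>.
\<close>

lemma nn_survival:
  assumes g[measurable]: "g \<in> borel_measurable (P k)" and u: "0 \<le> u"
  shows "(\<integral>\<^sup>+\<omega>. g \<omega> * (if T k \<omega> \<le> ennreal u \<and> ennreal u < T (Suc k) \<omega> then 1 else 0) \<partial>M)
    = (\<integral>\<^sup>+\<omega>. g \<omega> * (if T k \<omega> \<le> ennreal u
         then ennreal (exp (- hazard_integral k (u - \<tau> k \<omega>) \<omega>)) else 0) \<partial>M)"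
    (is "(\<integral>\<^sup>+\<omega>. g \<omega> * ?S \<omega> \<partial>M) = (\<integral>\<^sup>+\<omega>. g \<omega> * ?E \<omega> \<partial>M)")
proof -
  interpret S: sigma_finite_subalgebra M "P k" by (rule past_sigma_finite)
  have E[measurable]: "?E \<in> borel_measurable (P k)" by measurable
  have S[measurable]: "?S \<in> borel_measurable M" by measurable
  have set_eq: "(\<integral>\<^sup>+\<omega>\<in>A. ?S \<omega> \<partial>M) = (\<integral>\<^sup>+\<omega>\<in>A. ?E \<omega> \<partial>M)" if A: "A \<in> sets (P k)" for A
  proof -
    define A' where "A' = A \<inter> {\<omega> \<in> space (P k). T k \<omega> \<le> ennreal u}"
    have "{\<omega> \<in> space (P k). T k \<omega> \<le> ennreal u} \<in> sets (P k)" by measurable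
    with A have A': "A' \<in> sets (P k)" unfolding A'_def by blast
    note [measurable] = past_sets[OF A']
    have AM: "\<omega> \<in> A \<Longrightarrow> \<omega> \<in> space M" for \<omega> using sets.sets_into_space[OF A] by auto
    let ?I = "indicator {\<omega>' \<in> space M. ennreal u < T (Suc k) \<omega>'} :: 'w \<Rightarrow> real"
    have "(\<integral>\<^sup>+\<omega>\<in>A. ?S \<omega> \<partial>M) = (\<integral>\<^sup>+\<omega>. ennreal (indicator A' \<omega> * ?I \<omega>) \<partial>M)"
      using AM by (intro nn_integral_cong) (auto simp: A'_def indicator_def)
    also have "\<dots> = ennreal (\<integral>\<omega>. indicator A' \<omega> * ?I \<omega> \<partial>M)"
      by (intro nn_integral_eq_integral integrable_const_bound[of _ 1]) (auto simp: indicator_def)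
    also have "(\<integral>\<omega>. indicator A' \<omega> * ?I \<omega> \<partial>M)
        = (\<integral>\<omega>. indicator A' \<omega> * exp (- hazard_integral k (u - \<tau> k \<omega>) \<omega>) \<partial>M)"
      by (rule survival_at_time[OF A' _ u]) (auto simp: A'_def)
    also have "ennreal \<dots> = (\<integral>\<^sup>+\<omega>. ennreal (indicator A' \<omega> * exp (- hazard_integral k (u - \<tau> k \<omega>) \<omega>)) \<partial>M)"
      by (intro nn_integral_eq_integral[symmetric] integrable_survival) auto
    also have "\<dots> = (\<integral>\<^sup>+\<omega>\<in>A. ?E \<omega> \<partial>M)"
      using AM by (intro nn_integral_cong) (auto simp: A'_def indicator_def)
    finally show ?thesis .
  qed
  have "AE \<omega> in M. ?E \<omega> = nn_cond_exp M (P k) ?S \<omega>"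
    by (rule S.nn_cond_exp_charact[OF set_eq S E])
  then have "(\<integral>\<^sup>+\<omega>. g \<omega> * ?E \<omega> \<partial>M) = (\<integral>\<^sup>+\<omega>. g \<omega> * nn_cond_exp M (P k) ?S \<omega> \<partial>M)"
    by (intro nn_integral_cong_AE) (auto elim: eventually_mono)
  also have "\<dots> = (\<integral>\<^sup>+\<omega>. g \<omega> * ?S \<omega> \<partial>M)"
    by (rule S.nn_cond_exp_intg) measurable
  finally show ?thesis ..
qed

lemma hazard_density:
  assumes \<omega>: "\<omega> \<in> space M" and T: "T k \<omega> \<le> ennreal t" and t: "0 \<le> t"
  shows "(\<integral>\<^sup>+u. indicator {0..t} u * ennreal (\<rho> k u \<omega>) *
      (if T k \<omega> \<le> ennreal u then ennreal (exp (- hazard_integral k (u - \<tau> k \<omega>) \<omega>)) else 0) \<partial>lborel)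
    = ennreal (1 - exp (- hazard_integral k (t - \<tau> k \<omega>) \<omega>))" (is "(\<integral>\<^sup>+u. ?f u \<partial>lborel) = _")
proof -
  have fin: "T k \<omega> < \<infinity>" using T by (auto intro: le_less_trans)
  have v: "0 \<le> t - \<tau> k \<omega>" using T t fin by (simp add: le_ennreal_iff_enn2real_le)
  have [measurable]: "(\<lambda>u. \<rho> k u \<omega>) \<in> borel_measurable borel"
    "(\<lambda>u. hazard_integral k (u - \<tau> k \<omega>) \<omega>) \<in> borel_measurable borel"
    using \<omega> by (auto intro!: rate_measurable_at hazard_integral_measurable)
  have "(\<integral>\<^sup>+u. ?f u \<partial>lborel) = (\<integral>\<^sup>+s. ?f (\<tau> k \<omega> + 1 * s) \<partial>lborel)"
    by (subst nn_integral_real_affine[where c = 1 and t = "\<tau> k \<omega>"]) auto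
  also have "\<dots> = (\<integral>\<^sup>+s. ennreal (indicator {0..t - \<tau> k \<omega>} s *
      (\<rho> k (\<tau> k \<omega> + s) \<omega> * exp (- hazard_integral k s \<omega>))) \<partial>lborel)"
  proof (intro nn_integral_cong)
    fix s :: real
    have *: "0 \<le> \<tau> k \<omega> + s \<Longrightarrow> T k \<omega> \<le> ennreal (\<tau> k \<omega> + s) \<longleftrightarrow> 0 \<le> s"
      using fin by (subst le_ennreal_iff_enn2real_le) auto
    have "0 \<le> s \<Longrightarrow> 0 \<le> \<tau> k \<omega> + s" by simp
    then show "?f (\<tau> k \<omega> + 1 * s) = ennreal (indicator {0..t - \<tau> k \<omega>} s *
      (\<rho> k (\<tau> k \<omega> + s) \<omega> * exp (- hazard_integral k s \<omega>)))"
      using * by (auto simp: indicator_def ennreal_mult' rate_nonneg simp del: ennreal_plus)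
  qed
  also have "\<dots> = ennreal (1 - exp (- hazard_integral k (t - \<tau> k \<omega>) \<omega>))"
    by (rule hazard_integral_props(2)[OF \<omega> fin v])
  finally show ?thesis .
qed

text \<open>
  After exchanging the integrals, the indicator of \<open>T k \<le> u < T (k + 1)\<close> may be replaced by its conditional
  expectation, since the rest of the integrand is known at \<open>T k\<close>. What is left is the density
  \<open>\<rho> * exp (- \<integral> \<rho>)\<close> of \<open>T (k + 1)\<close>, whose integral up to \<open>t\<close> is the conditional probability of a
  jump before \<open>t\<close>.
\<close>

lemma jump_compensation:
  assumes B: "B \<in> sets (P k)" and t: "0 \<le> t"
  shows "emeasure M {\<omega> \<in> B. T (Suc k) \<omega> \<le> ennreal t}
    = (\<integral>\<^sup>+\<omega>. indicator B \<omega> * (\<integral>\<^sup>+u. indicator {0..t} u * ennreal (\<rho> k u \<omega>) *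
        (if T k \<omega> \<le> ennreal u \<and> ennreal u < T (Suc k) \<omega> then 1 else 0) \<partial>lborel) \<partial>M)"
proof -
  interpret pair_sigma_finite M lborel ..
  note [measurable] = B past_sets[OF B]
  have BM: "\<omega> \<in> B \<Longrightarrow> \<omega> \<in> space M" for \<omega> using sets.sets_into_space[OF B] by auto
  have [measurable]: "(\<lambda>x. x) \<in> measurable M (P k)"
    by (rule measurable_past[of _ k]) simp
  let ?w = "\<lambda>u \<omega>. indicator B \<omega> * (indicator {0..t} u * ennreal (\<rho> k u \<omega>))"
  let ?S = "\<lambda>u \<omega>. if T k \<omega> \<le> ennreal u \<and> ennreal u < T (Suc k) \<omega> then 1 else 0 :: ennreal"
  let ?E = "\<lambda>u \<omega>. if T k \<omega> \<le> ennreal u then ennreal (exp (- hazard_integral k (u - \<tau> k \<omega>) \<omega>)) else 0"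
  define A where "A = {\<omega> \<in> B. T k \<omega> \<le> ennreal t}"
  have A: "A \<in> sets (P k)"
  proof -
    have "A = B \<inter> {\<omega> \<in> space (P k). T k \<omega> \<le> ennreal t}" using BM by (auto simp: A_def)
    moreover have "{\<omega> \<in> space (P k). T k \<omega> \<le> ennreal t} \<in> sets (P k)" by measurable
    ultimately show ?thesis using B by (metis sets.Int)
  qed
  note [measurable] = past_sets[OF A]
  have intA: "integrable M (indicator A :: 'w \<Rightarrow> real)"
    by (intro integrable_real_indicator) (auto simp: less_top[symmetric])
  have "(\<integral>\<^sup>+\<omega>. indicator B \<omega> * (\<integral>\<^sup>+u. indicator {0..t} u * ennreal (\<rho> k u \<omega>) * ?S u \<omega> \<partial>lborel) \<partial>M)
      = (\<integral>\<^sup>+\<omega>. (\<integral>\<^sup>+u. ?w u \<omega> * ?S u \<omega> \<partial>lborel) \<partial>M)"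
  proof (rule nn_integral_cong)
    fix \<omega> assume "\<omega> \<in> space M"
    then have [measurable]: "(\<lambda>u. \<rho> k u \<omega>) \<in> borel_measurable borel"
      by (intro rate_measurable_at) auto
    have "(\<lambda>u. indicator {0..t} u * ennreal (\<rho> k u \<omega>) * ?S u \<omega>) \<in> borel_measurable lborel"
      by measurable
    from nn_integral_cmult[OF this, of "indicator B \<omega>"]
    show "indicator B \<omega> * (\<integral>\<^sup>+u. indicator {0..t} u * ennreal (\<rho> k u \<omega>) * ?S u \<omega> \<partial>lborel)
        = (\<integral>\<^sup>+u. ?w u \<omega> * ?S u \<omega> \<partial>lborel)"
      by (simp only: mult.assoc)
  qed
  also have "\<dots> = (\<integral>\<^sup>+u. (\<integral>\<^sup>+\<omega>. ?w u \<omega> * ?S u \<omega> \<partial>M) \<partial>lborel)"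
    by (rule Fubini'[symmetric]) measurable
  also have "\<dots> = (\<integral>\<^sup>+u. (\<integral>\<^sup>+\<omega>. ?w u \<omega> * ?E u \<omega> \<partial>M) \<partial>lborel)"
  proof (rule nn_integral_cong)
    fix u
    show "(\<integral>\<^sup>+\<omega>. ?w u \<omega> * ?S u \<omega> \<partial>M) = (\<integral>\<^sup>+\<omega>. ?w u \<omega> * ?E u \<omega> \<partial>M)"
    proof (cases "0 \<le> u")
      case True
      then show ?thesis by (intro nn_survival) auto
    qed simp
  qed
  also have "\<dots> = (\<integral>\<^sup>+\<omega>. (\<integral>\<^sup>+u. ?w u \<omega> * ?E u \<omega> \<partial>lborel) \<partial>M)"
    by (rule Fubini') measurable
  also have "\<dots> = (\<integral>\<^sup>+\<omega>. ennreal (indicator A \<omega> - indicator A \<omega> * exp (- hazard_integral k (t - \<tau> k \<omega>) \<omega>)) \<partial>M)"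
  proof (rule nn_integral_cong)
    fix \<omega> assume \<omega>: "\<omega> \<in> space M"
    show "(\<integral>\<^sup>+u. ?w u \<omega> * ?E u \<omega> \<partial>lborel)
        = ennreal (indicator A \<omega> - indicator A \<omega> * exp (- hazard_integral k (t - \<tau> k \<omega>) \<omega>))"
    proof (cases "\<omega> \<in> A")
      case True
      then show ?thesis using hazard_density[OF \<omega> _ t, of k] by (simp add: A_def)
    next
      case False
      have "(\<lambda>u. ?w u \<omega> * ?E u \<omega>) = (\<lambda>u. 0)"
        using False by (auto simp: A_def indicator_def fun_eq_iff dest: order_trans[OF _ ennreal_leI])
      with False show ?thesis by (simp only:) simp
    qed
  qed
  also have "\<dots> = ennreal (\<integral>\<omega>. indicator A \<omega> - indicator A \<omega> * exp (- hazard_integral k (t - \<tau> k \<omega>) \<omega>) \<partial>M)"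
    by (intro nn_integral_eq_integral Bochner_Integration.integrable_diff integrable_survival intA AE_I2)
      (auto simp: hazard_integral_nonneg split: split_indicator)
  also have "(\<integral>\<omega>. indicator A \<omega> - indicator A \<omega> * exp (- hazard_integral k (t - \<tau> k \<omega>) \<omega>) \<partial>M)
      = measure M A - (\<integral>\<omega>. indicator A \<omega> * exp (- hazard_integral k (t - \<tau> k \<omega>) \<omega>) \<partial>M)"
    by (subst Bochner_Integration.integral_diff) (auto intro!: integrable_survival intA)
  also have "(\<integral>\<omega>. indicator A \<omega> * exp (- hazard_integral k (t - \<tau> k \<omega>) \<omega>) \<partial>M)
      = (\<integral>\<omega>. indicator A \<omega> * indicator {\<omega>' \<in> space M. ennreal t < T (Suc k) \<omega>'} \<omega> \<partial>M)"
    by (rule survival_at_time[OF A _ t, symmetric]) (auto simp: A_def)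
  also have "\<dots> = (\<integral>\<omega>. indicator {\<omega> \<in> A. ennreal t < T (Suc k) \<omega>} \<omega> \<partial>M)"
    using BM by (intro Bochner_Integration.integral_cong) (auto simp: indicator_def A_def)
  also have "\<dots> = measure M {\<omega> \<in> A. ennreal t < T (Suc k) \<omega>}" by simp
  also have "measure M A - \<dots> = measure M (A - {\<omega> \<in> A. ennreal t < T (Suc k) \<omega>})"
    by (rule finite_measure_Diff[symmetric]) auto
  also have "A - {\<omega> \<in> A. ennreal t < T (Suc k) \<omega>} = {\<omega> \<in> B. T (Suc k) \<omega> \<le> ennreal t}"
    using T_mono[of _ k "Suc k"] BM by (auto simp: A_def not_less intro: order_trans)
  finally show ?thesis by (simp add: emeasure_eq_measure)
qed

section \<open>Non-explosion\<close>

lemma sojourn_unique: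
  assumes "\<omega> \<in> space M" "T j \<omega> \<le> u" "u < T (Suc j) \<omega>" "T k \<omega> \<le> u" "u < T (Suc k) \<omega>"
  shows "j = k"
  using assms T_mono[of \<omega> "Suc j" k] T_mono[of \<omega> "Suc k" j]
  by (metis leD le_less_trans not_less_eq_eq le_antisym order.trans Suc_leI linorder_neqE_nat)

text \<open>
  Let \<open>E\<close> be the event that all times are at most \<open>t\<close>. Then \<open>P E \<le> P (T (k + 1) \<le> t)\<close> for every \<open>k\<close>, and
  \<open>jump_compensation\<close> with \<open>\<rho> k \<le> a + b * k\<close> bounds \<open>P E / (a + b * k)\<close> by the expected length of
  \<open>[T k, T (k + 1)) \<inter> [0, t]\<close>. The sum of these lengths over \<open>k\<close> is at most \<open>t\<close>, so a positive
  \<open>P E\<close> would make the series of \<open>1 / (a + b * k)\<close> converge.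
\<close>

lemma non_explosion: "AE \<omega> in M. \<forall>t. \<exists>k. ennreal t < T k \<omega>"
proof -
  have "AE \<omega> in M. \<exists>k. ennreal (real i) < T k \<omega>" for i :: nat
  proof -
    define t where "t = real i"
    obtain a b where ab: "a > 0" "b \<ge> 0" "\<And>k u \<omega>. \<omega> \<in> space M \<Longrightarrow> 0 \<le> u \<Longrightarrow> u \<le> t \<Longrightarrow> T k \<omega> \<le> ennreal u \<Longrightarrow>
        \<rho> k u \<omega> \<le> a + b * real k"
      using rate_bound[of t] by blast
    define r where "r k = 1 / (a + b * real k)" for k
    have den: "0 < a + b * real k" for k using ab(1,2) by (simp add: add_pos_nonneg)
    have r0: "0 \<le> r k" for k unfolding r_def using den[of k] by simp
    define E where "E = {\<omega> \<in> space M. \<forall>k. T k \<omega> \<le> ennreal t}"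
    have [measurable]: "E \<in> sets M" unfolding E_def by measurable
    let ?S = "\<lambda>k u \<omega>. if T k \<omega> \<le> ennreal u \<and> ennreal u < T (Suc k) \<omega> then 1 else 0 :: ennreal"
    have t: "0 \<le> t" by (simp add: t_def)
    have step: "ennreal (r k) * emeasure M E \<le> (\<integral>\<^sup>+\<omega>. (\<integral>\<^sup>+u. indicator {0..t} u * ?S k u \<omega> \<partial>lborel) \<partial>M)" for k
    proof -
      have [measurable]: "(\<lambda>x. x) \<in> measurable M (P k)" by (rule measurable_past[of _ k]) simp
      have "emeasure M E \<le> emeasure M {\<omega> \<in> space M. T (Suc k) \<omega> \<le> ennreal t}"
        by (intro emeasure_mono) (auto simp: E_def)
      also have "\<dots> = (\<integral>\<^sup>+\<omega>. indicator (space M) \<omega> * (\<integral>\<^sup>+u. indicator {0..t} u * ennreal (\<rho> k u \<omega>) * ?S k u \<omega> \<partial>lborel) \<partial>M)"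
        using sets.top[of "P k"] by (intro jump_compensation t) simp
      finally have "ennreal (r k) * emeasure M E \<le> ennreal (r k) * \<dots>"
        by (intro mult_left_mono) auto
      also have "\<dots> = (\<integral>\<^sup>+\<omega>. ennreal (r k) * (indicator (space M) \<omega> * (\<integral>\<^sup>+u. indicator {0..t} u * ennreal (\<rho> k u \<omega>) * ?S k u \<omega> \<partial>lborel)) \<partial>M)"
        by (intro nn_integral_cmult[symmetric]) measurable
      also have "\<dots> \<le> (\<integral>\<^sup>+\<omega>. (\<integral>\<^sup>+u. indicator {0..t} u * ?S k u \<omega> \<partial>lborel) \<partial>M)"
      proof (rule nn_integral_mono)
        fix \<omega> assume \<omega>: "\<omega> \<in> space M"
        then have [measurable]: "(\<lambda>u. \<rho> k u \<omega>) \<in> borel_measurable borel"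
          by (intro rate_measurable_at) auto
        have "ennreal (r k) * (indicator (space M) \<omega> * (\<integral>\<^sup>+u. indicator {0..t} u * ennreal (\<rho> k u \<omega>) * ?S k u \<omega> \<partial>lborel))
          = ennreal (r k) * (\<integral>\<^sup>+u. indicator {0..t} u * ennreal (\<rho> k u \<omega>) * ?S k u \<omega> \<partial>lborel)"
          using \<omega> by simp
        also have "\<dots> = (\<integral>\<^sup>+u. ennreal (r k) * (indicator {0..t} u * ennreal (\<rho> k u \<omega>) * ?S k u \<omega>) \<partial>lborel)"
          by (intro nn_integral_cmult[symmetric]) measurable
        also have "\<dots> \<le> (\<integral>\<^sup>+u. indicator {0..t} u * ?S k u \<omega> \<partial>lborel)"
        proof (rule nn_integral_mono)
          fix u
          show "ennreal (r k) * (indicator {0..t} u * ennreal (\<rho> k u \<omega>) * ?S k u \<omega>) \<le> indicator {0..t} u * ?S k u \<omega>"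
          proof (cases "u \<in> {0..t} \<and> T k \<omega> \<le> ennreal u")
            case True
            then have "r k * \<rho> k u \<omega> \<le> 1"
              using ab(3)[OF \<omega>, of u k] den[of k] by (simp add: r_def divide_le_eq)
            then have "ennreal (r k) * ennreal (\<rho> k u \<omega>) \<le> 1"
              using r0 by (simp add: ennreal_mult'[symmetric])
            then show ?thesis using True by (auto simp: indicator_def)
          qed auto
        qed
        finally show "ennreal (r k) * (indicator (space M) \<omega> * (\<integral>\<^sup>+u. indicator {0..t} u * ennreal (\<rho> k u \<omega>) * ?S k u \<omega> \<partial>lborel))
          \<le> (\<integral>\<^sup>+u. indicator {0..t} u * ?S k u \<omega> \<partial>lborel)" .
      qed
      finally show ?thesis .
    qed
    have "(\<Sum>k. ennreal (r k)) * emeasure M E = (\<Sum>k. ennreal (r k) * emeasure M E)"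
      by (rule ennreal_suminf_multc[symmetric])
    also have "\<dots> \<le> (\<Sum>k. \<integral>\<^sup>+\<omega>. (\<integral>\<^sup>+u. indicator {0..t} u * ?S k u \<omega> \<partial>lborel) \<partial>M)"
      by (intro suminf_le step) auto
    also have "\<dots> = (\<integral>\<^sup>+\<omega>. (\<Sum>k. \<integral>\<^sup>+u. indicator {0..t} u * ?S k u \<omega> \<partial>lborel) \<partial>M)"
      by (intro nn_integral_suminf[symmetric]) measurable
    also have "\<dots> = (\<integral>\<^sup>+\<omega>. (\<integral>\<^sup>+u. (\<Sum>k. indicator {0..t} u * ?S k u \<omega>) \<partial>lborel) \<partial>M)"
      by (intro nn_integral_cong nn_integral_suminf[symmetric]) measurable
    also have "\<dots> \<le> (\<integral>\<^sup>+\<omega>. (\<integral>\<^sup>+u. indicator {0..t} u \<partial>lborel) \<partial>M)"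
    proof (intro nn_integral_mono)
      fix \<omega> and u :: real assume \<omega>: "\<omega> \<in> space M"
      have "(\<Sum>k. ?S k u \<omega>) \<le> 1"
      proof (cases "\<exists>j. T j \<omega> \<le> ennreal u \<and> ennreal u < T (Suc j) \<omega>")
        case True
        then obtain j where j: "T j \<omega> \<le> ennreal u" "ennreal u < T (Suc j) \<omega>" by blast
        have "(\<Sum>k. ?S k u \<omega>) = (\<Sum>k\<in>{j}. ?S k u \<omega>)"
          using sojourn_unique[OF \<omega> j] by (intro suminf_finite) auto
        then show ?thesis using j by simp
      next
        case False
        then have "(\<lambda>k. ?S k u \<omega>) = (\<lambda>k. 0)" by auto
        then show ?thesis by (simp only:) simp
      qed
      then show "(\<Sum>k. indicator {0..t} u * ?S k u \<omega>) \<le> indicator {0..t} u"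
        by (auto simp: indicator_def)
    qed
    also have "\<dots> = ennreal t" by (simp add: emeasure_space_1 t)
    finally have fin: "(\<Sum>k. ennreal (r k)) * emeasure M E < \<infinity>" by (auto intro: le_less_trans)
    have "emeasure M E = 0"
    proof (rule ccontr)
      assume "emeasure M E \<noteq> 0"
      with fin have "(\<Sum>k. ennreal (r k)) \<noteq> top" by (auto simp: ennreal_top_mult)
      with r0 have "summable r" by (intro summable_suminf_not_top)
      then have "summable (\<lambda>k. (a + b) * r k)" by (rule summable_mult)
      then have "summable (\<lambda>k. inverse (real (Suc k)))"
      proof (rule summable_comparison_test'[of _ 0])
        fix k :: nat
        \<comment> \<open>comparison with the harmonic series\<close>
        have "a + b * real k \<le> (a + b) * real (Suc k)" using ab(1,2) by (simp add: algebra_simps)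
        then have "inverse (real (Suc k)) \<le> (a + b) / (a + b * real k)"
          using den[of k] by (simp add: field_simps)
        then show "norm (inverse (real (Suc k))) \<le> (a + b) * r k" by (simp add: r_def)
      qed
      then show False using not_summable_harmonic[where 'a = real]
        by (subst (asm) summable_Suc_iff) auto
    qed
    then have "E \<in> null_sets M" by auto
    then show ?thesis
      by (rule AE_I') (auto simp: E_def t_def not_less)
  qed
  then have "AE \<omega> in M. \<forall>i :: nat. \<exists>k. ennreal (real i) < T k \<omega>" by (simp add: AE_all_countable)
  then show ?thesis
  proof (eventually_elim, intro allI)
    fix \<omega> t assume *: "\<forall>i :: nat. \<exists>k. ennreal (real i) < T k \<omega>"
    obtain i :: nat where "t \<le> real i" using real_arch_simple by blast
    moreover obtain k where "ennreal (real i) < T k \<omega>" using * by blast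
    ultimately show "\<exists>k. ennreal t < T k \<omega>" by (meson ennreal_leI le_less_trans)
  qed
qed

end

section \<open>The point process of the jumps and its history\<close>

locale hazard_point_process = hazard_times M T \<rho>
  for M :: "'w measure" and T \<rho> +
  fixes N :: "'w \<Rightarrow> real measure"
  assumes N_eq: "\<And>\<omega>. \<omega> \<in> space M \<Longrightarrow>
    N \<omega> = counting_measure {enn2real (T (Suc k) \<omega>) | k. T (Suc k) \<omega> < \<infinity>}"
begin

abbreviation history :: "real \<Rightarrow> 'w measure" where "history \<equiv> natural_filtration M N"

lemma T_pos: "\<omega> \<in> space M \<Longrightarrow> 0 < T (Suc k) \<omega>"
  using T_strict[of \<omega> 0 "Suc k"] T_0 by simp

lemma \<tau>_inj: "\<omega> \<in> space M \<Longrightarrow> inj_on (\<lambda>k. \<tau> (Suc k) \<omega>) {k. T (Suc k) \<omega> < \<infinity>}"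
proof (rule inj_onI)
  fix j k assume \<omega>: "\<omega> \<in> space M" and jk: "j \<in> {k. T (Suc k) \<omega> < \<infinity>}" "k \<in> {k. T (Suc k) \<omega> < \<infinity>}"
    and eq: "\<tau> (Suc j) \<omega> = \<tau> (Suc k) \<omega>"
  from jk have "ennreal (\<tau> (Suc j) \<omega>) = T (Suc j) \<omega>" "ennreal (\<tau> (Suc k) \<omega>) = T (Suc k) \<omega>"
    by simp_all
  with eq have "T (Suc j) \<omega> = T (Suc k) \<omega>" by metis
  with T_strict[OF \<omega>, of "Suc j" "Suc k"] T_strict[OF \<omega>, of "Suc k" "Suc j"] jk
  show "j = k" by (metis less_irrefl linorder_neqE_nat mem_Collect_eq Suc_less_eq)
qed

lemma N_distr:
  assumes "\<omega> \<in> space M"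
  shows "N \<omega> = distr (count_space {k. T (Suc k) \<omega> < \<infinity>}) borel (\<lambda>k. \<tau> (Suc k) \<omega>)"
proof -
  let ?K = "{k. T (Suc k) \<omega> < \<infinity>}" and ?f = "\<lambda>k. \<tau> (Suc k) \<omega>"
  have J: "{enn2real (T (Suc k) \<omega>) | k. T (Suc k) \<omega> < \<infinity>} = ?f ` ?K" by auto
  have "count_space (?f ` ?K) = distr (count_space ?K) (count_space (?f ` ?K)) ?f"
    using \<tau>_inj[OF assms] by (intro distr_bij_count_space[symmetric]) (auto simp: bij_betw_def)
  then have "N \<omega> = distr (distr (count_space ?K) (count_space (?f ` ?K)) ?f) borel (\<lambda>t. t)"
    unfolding N_eq[OF assms] counting_measure_def J by simp
  also have "\<dots> = distr (count_space ?K) borel ?f"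
    by (subst distr_distr) (auto simp: comp_def)
  finally show ?thesis .
qed

lemma sets_N: "\<omega> \<in> space M \<Longrightarrow> sets (N \<omega>) = sets borel"
  by (simp add: N_distr)

lemma emeasure_N:
  assumes \<omega>: "\<omega> \<in> space M" and A: "A \<in> sets borel"
  shows "emeasure (N \<omega>) A = (\<Sum>k. if T (Suc k) \<omega> < \<infinity> \<and> \<tau> (Suc k) \<omega> \<in> A then 1 else 0)"
proof -
  let ?K = "{k. T (Suc k) \<omega> < \<infinity>}"
  have "emeasure (N \<omega>) A = (\<integral>\<^sup>+x. indicator A x \<partial>N \<omega>)"
    using A sets_N[OF \<omega>] by simp
  also have "\<dots> = (\<integral>\<^sup>+k. indicator A (\<tau> (Suc k) \<omega>) \<partial>count_space ?K)"
    unfolding N_distr[OF \<omega>] using A by (intro nn_integral_distr) auto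
  also have "\<dots> = (\<integral>\<^sup>+k. indicator A (\<tau> (Suc k) \<omega>) * indicator ?K k \<partial>count_space UNIV)"
    by (subst nn_integral_count_space_indicator) auto
  also have "\<dots> = (\<Sum>k. indicator A (\<tau> (Suc k) \<omega>) * indicator ?K k)"
    by (rule nn_integral_count_space_nat)
  also have "\<dots> = (\<Sum>k. if T (Suc k) \<omega> < \<infinity> \<and> \<tau> (Suc k) \<omega> \<in> A then 1 else 0)"
    by (intro suminf_cong) (auto simp: indicator_def)
  finally show ?thesis .
qed

lemma emeasure_N_interval:
  assumes \<omega>: "\<omega> \<in> space M" and t: "0 \<le> t"
  shows "emeasure (N \<omega>) {0<..t} = (\<Sum>k. if T (Suc k) \<omega> \<le> ennreal t then 1 else 0)"
proof -
  have "T (Suc k) \<omega> < \<infinity> \<and> \<tau> (Suc k) \<omega> \<in> {0<..t} \<longleftrightarrow> T (Suc k) \<omega> \<le> ennreal t" for k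
    using T_pos[OF \<omega>, of k] t
    by (cases "T (Suc k) \<omega>" rule: ennreal_cases) (auto simp: top_unique)
  then show ?thesis by (simp add: emeasure_N[OF \<omega>])
qed

lemma measure_N_interval:
  assumes \<omega>: "\<omega> \<in> space M" and t: "0 \<le> t" and n: "\<And>k. n \<le> k \<Longrightarrow> \<not> T (Suc k) \<omega> \<le> ennreal t"
  shows "measure (N \<omega>) {0<..t} = (\<Sum>k<n. if T (Suc k) \<omega> \<le> ennreal t then 1 else 0)"
proof -
  have "emeasure (N \<omega>) {0<..t} = (\<Sum>k<n. if T (Suc k) \<omega> \<le> ennreal t then 1 else 0)"
    unfolding emeasure_N_interval[OF \<omega> t] using n by (intro suminf_finite) (auto simp: not_less)
  also have "\<dots> = (\<Sum>k<n. ennreal (if T (Suc k) \<omega> \<le> ennreal t then 1 else 0))"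
    by (intro sum.cong) auto
  also have "\<dots> = ennreal (\<Sum>k<n. if T (Suc k) \<omega> \<le> ennreal t then 1 else 0)"
    by (rule sum_ennreal) auto
  finally show ?thesis by (simp add: measure_def sum_nonneg)
qed

text \<open>
  This makes the jump times stopping times for the history of the point process, even on paths
  with explosion, where the count may be infinite.
\<close>

lemma time_le_iff_count:
  assumes \<omega>: "\<omega> \<in> space M" and t: "0 \<le> t"
  shows "T (Suc k) \<omega> \<le> ennreal t \<longleftrightarrow> of_nat (Suc k) \<le> emeasure (N \<omega>) {0<..t}"
proof
  assume le: "T (Suc k) \<omega> \<le> ennreal t"
  have "T (Suc j) \<omega> \<le> ennreal t" if "j \<le> k" for j
    using T_mono[OF \<omega>, of "Suc j" "Suc k"] that le by (auto intro: order_trans)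
  then have "(of_nat (Suc k) :: ennreal) = (\<Sum>j<Suc k. if T (Suc j) \<omega> \<le> ennreal t then 1 else 0)"
    by simp
  also have "\<dots> \<le> (\<Sum>j. if T (Suc j) \<omega> \<le> ennreal t then 1 else 0)"
    by (intro sum_le_suminf) auto
  finally show "of_nat (Suc k) \<le> emeasure (N \<omega>) {0<..t}"
    by (simp only: emeasure_N_interval[OF \<omega> t])
next
  assume ge: "of_nat (Suc k) \<le> emeasure (N \<omega>) {0<..t}"
  show "T (Suc k) \<omega> \<le> ennreal t"
  proof (rule ccontr)
    assume gt: "\<not> T (Suc k) \<omega> \<le> ennreal t"
    have "\<not> T (Suc j) \<omega> \<le> ennreal t" if "k \<le> j" for j
      using T_mono[OF \<omega>, of "Suc k" "Suc j"] that gt by (auto dest: order_trans)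
    then have "emeasure (N \<omega>) {0<..t} = (\<Sum>j<k. if T (Suc j) \<omega> \<le> ennreal t then 1 else 0)"
      unfolding emeasure_N_interval[OF \<omega> t] by (intro suminf_finite) (auto simp: not_less)
    also have "\<dots> \<le> (\<Sum>j<k. 1)" by (intro sum_mono) auto
    also have "\<dots> = of_nat k" by simp
    finally have "(of_nat (Suc k) :: ennreal) \<le> of_nat k" using ge by (rule order_trans[rotated])
    then show False unfolding of_nat_le_iff by simp
  qed
qed

lemma N_measurable:
  assumes [measurable]: "A \<in> sets borel"
  shows "(\<lambda>\<omega>. emeasure (N \<omega>) A) \<in> borel_measurable M"
  by (subst measurable_cong[OF emeasure_N[OF _ assms]]) measurable

lemma space_history [simp]: "space (history t) = space M"
  unfolding natural_filtration_def by (intro space_measure_of) auto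

lemma history_eq: "sets (history t) = sigma_sets (space M) {(\<lambda>\<omega>. emeasure (N \<omega>) A) -` B \<inter> space M | A B.
          A \<in> sets borel \<and> A \<subseteq> {0<..t} \<and> B \<in> sets borel}"
  unfolding natural_filtration_def by (intro sets_measure_of) auto

lemma N_history_measurable:
  assumes "A \<in> sets borel" "A \<subseteq> {0<..t}"
  shows "(\<lambda>\<omega>. emeasure (N \<omega>) A) \<in> borel_measurable (history t)"
  by (rule measurableI) (use assms in \<open>auto simp: history_eq\<close>)

lemma history_subalgebra: "subalgebra M (history t)"
proof -
  have "sets (history t) \<subseteq> sets M"
    unfolding history_eq by (intro sets.sigma_sets_subset) (auto intro!: measurable_sets N_measurable)
  then show ?thesis by (simp add: subalgebra_def)
qed

lemma history_mono: "s \<le> t \<Longrightarrow> sets (history s) \<subseteq> sets (history t)"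
  unfolding history_eq by (intro sigma_sets_mono') (auto, force)

lemma history_sets: "A \<in> sets (history t) \<Longrightarrow> A \<in> sets M"
  using history_subalgebra by (auto simp: subalgebra_def)

lemma history_sigma_finite: "sigma_finite_subalgebra M (history t)"
proof -
  interpret finite_measure_subalgebra M "history t"
    by unfold_locales (rule history_subalgebra)
  show ?thesis by unfold_locales
qed

lemma stopping_sets:
  assumes "0 \<le> t"
  shows "{\<omega> \<in> space M. T k \<omega> \<le> ennreal t} \<in> sets (history t)"
proof (cases k)
  case 0
  then have "{\<omega> \<in> space M. T k \<omega> \<le> ennreal t} = space (history t)" by (auto simp: T_0)
  then show ?thesis by (simp only: sets.top)
next
  case (Suc j)
  have [measurable]: "(\<lambda>\<omega>. emeasure (N \<omega>) {0<..t}) \<in> borel_measurable (history t)"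
    by (rule N_history_measurable) auto
  have "{\<omega> \<in> space M. T k \<omega> \<le> ennreal t} = {\<omega> \<in> space (history t). of_nat (Suc j) \<le> emeasure (N \<omega>) {0<..t}}"
    using time_le_iff_count[OF _ assms, of _ j] Suc by auto
  also have "\<dots> \<in> sets (history t)" by measurable
  finally show ?thesis .
qed

text \<open>
  Before \<open>T (k + 1)\<close> the history up to \<open>s\<close> has seen no jumps but the first \<open>k\<close>. For events that
  count points this is evident, and the property passes to the generated \<open>\<sigma>\<close>-algebra.
\<close>

lemma trace_before_jump:
  assumes "B \<in> sets (history s)"
  shows "\<exists>B'\<in>sets (P k). \<forall>\<omega>\<in>space M. ennreal s < T (Suc k) \<omega> \<longrightarrow> (\<omega> \<in> B \<longleftrightarrow> \<omega> \<in> B')"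
  using assms unfolding history_eq
proof (induction rule: sigma_sets.induct)
  case (Basic B)
  then obtain A C where AC: "A \<in> sets borel" "A \<subseteq> {0<..s}" "C \<in> sets borel"
    and B: "B = (\<lambda>\<omega>. emeasure (N \<omega>) A) -` C \<inter> space M" by auto
  let ?n = "\<lambda>\<omega>. \<Sum>j<k. if T (Suc j) \<omega> < \<infinity> \<and> \<tau> (Suc j) \<omega> \<in> A then 1 else 0 :: ennreal"
  have "?n \<in> borel_measurable (P k)"
  proof (rule borel_measurable_sum)
    fix j assume "j \<in> {..<k}"
    then have [measurable]: "T (Suc j) \<in> borel_measurable (P k)" by (intro past_time_measurable) auto
    show "(\<lambda>\<omega>. if T (Suc j) \<omega> < \<infinity> \<and> \<tau> (Suc j) \<omega> \<in> A then 1 else 0 :: ennreal) \<in> borel_measurable (P k)"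
      using AC(1) by measurable
  qed
  then have "?n -` C \<inter> space (P k) \<in> sets (P k)" using AC(3) by (rule measurable_sets)
  moreover have "\<omega> \<in> B \<longleftrightarrow> \<omega> \<in> ?n -` C \<inter> space (P k)" if \<omega>: "\<omega> \<in> space M" and s: "ennreal s < T (Suc k) \<omega>" for \<omega>
  proof -
    have "\<not> (T (Suc j) \<omega> < \<infinity> \<and> \<tau> (Suc j) \<omega> \<in> A)" if "k \<le> j" for j
    proof
      assume *: "T (Suc j) \<omega> < \<infinity> \<and> \<tau> (Suc j) \<omega> \<in> A"
      then have "0 \<le> s" "\<tau> (Suc j) \<omega> \<le> s" using AC(2) by (force simp: subset_eq)+
      with * have "T (Suc j) \<omega> \<le> ennreal s" by (simp add: le_ennreal_iff_enn2real_le)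
      with T_mono[OF \<omega>, of "Suc k" "Suc j"] that s show False by simp
    qed
    then have "emeasure (N \<omega>) A = ?n \<omega>"
      unfolding emeasure_N[OF \<omega> AC(1)] by (intro suminf_finite) (auto simp: not_less)
    then show ?thesis using \<omega> B by simp
  qed
  ultimately show ?case by blast
next
  case Empty
  show ?case by (intro bexI[of _ "{}"]) auto
next
  case (Compl B)
  then obtain B' where "B' \<in> sets (P k)" "\<forall>\<omega>\<in>space M. ennreal s < T (Suc k) \<omega> \<longrightarrow> (\<omega> \<in> B \<longleftrightarrow> \<omega> \<in> B')"
    by blast
  then show ?case using sets.compl_sets[of B' "P k"] by (intro bexI[of _ "space (P k) - B'"]) auto
next
  case (Union B)
  then obtain B' where B': "\<And>i. B' i \<in> sets (P k)"
    "\<And>i. \<forall>\<omega>\<in>space M. ennreal s < T (Suc k) \<omega> \<longrightarrow> (\<omega> \<in> B i \<longleftrightarrow> \<omega> \<in> B' i)"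
    by metis
  then show ?case by (intro bexI[of _ "\<Union>i. B' i"]) auto
qed

section \<open>Predictability\<close>

abbreviation predictable_algebra :: "(real \<times> 'w) measure" where "predictable_algebra \<equiv> predictable_sigma M history"

lemma predictable_generator_subset:
  "{{s<..t} \<times> A | s t A. 0 \<le> s \<and> s \<le> t \<and> A \<in> sets (history s)} \<subseteq> Pow ({0<..} \<times> space M)"
  using sets.sets_into_space[of _ "history s" for s] by fastforce

lemma space_predictable_algebra [simp]: "space predictable_algebra = {0<..} \<times> space M"
  unfolding predictable_sigma_def by (rule space_measure_of[OF predictable_generator_subset])

lemma interval_predictable: "0 \<le> s \<Longrightarrow> s \<le> t \<Longrightarrow> A \<in> sets (history s) \<Longrightarrow> {s<..t} \<times> A \<in> sets predictable_algebra"
  unfolding predictable_sigma_def sets_measure_of[OF predictable_generator_subset] by blast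

lemma ray_predictable:
  assumes "0 \<le> a" "A \<in> sets (history a)"
  shows "{a<..} \<times> A \<in> sets predictable_algebra"
proof -
  have "{a<..} \<times> A = (\<Union>m :: nat. {a<..a + real m} \<times> A)"
  proof (intro equalityI subsetI; clarsimp)
    fix u assume "a < u"
    obtain m :: nat where "u - a \<le> real m" using real_arch_simple by blast
    then show "\<exists>m :: nat. u \<le> a + real m" by (intro exI[of _ m]) simp
  qed
  also have "\<dots> \<in> sets predictable_algebra" using assms by (intro sets.countable_UN) (auto intro!: interval_predictable)
  finally show ?thesis .
qed

lemma time_predictable: "fst \<in> borel_measurable predictable_algebra"
proof (rule borel_measurable_iff_greater[THEN iffD2], intro allI)
  fix a :: real
  show "{w \<in> space predictable_algebra. a < fst w} \<in> sets predictable_algebra"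
  proof (cases "0 \<le> a")
    case True
    then have "{w \<in> space predictable_algebra. a < fst w} = {a<..} \<times> space (history a)" by auto
    then show ?thesis using True by (simp only: ray_predictable sets.top)
  next
    case False
    then have "{w \<in> space predictable_algebra. a < fst w} = space predictable_algebra" by auto
    then show ?thesis by (simp only: sets.top)
  qed
qed

text \<open>
  What a predictable process does after time \<open>a\<close> may depend on events of the history at \<open>a\<close>. Pulled
  back along \<open>e\<close>, these events have to be measurable in \<open>Q\<close>, but only on \<open>{a < b}\<close>, since only the
  times \<open>s \<le> b x\<close> occur.
  With \<open>b\<close> constant this gives progressive measurability, and with \<open>Q\<close> the predictable
  \<open>\<sigma>\<close>-algebra and \<open>b\<close> the time it gives predictability of the integrated process.
\<close>

lemma predictable_integrand:
  assumes Y: "predictable M history Y"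
    and b[measurable]: "b \<in> borel_measurable Q"
    and e: "\<And>x. x \<in> space Q \<Longrightarrow> e x \<in> space M"
    and Q: "\<And>a A. 0 \<le> a \<Longrightarrow> A \<in> sets (history a) \<Longrightarrow> {x \<in> space Q. a < b x \<and> e x \<in> A} \<in> sets Q"
  shows "(\<lambda>(x, s). indicator {0<..b x} s * Y s (e x)) \<in> borel_measurable (Q \<Otimes>\<^sub>M borel)"
proof -
  let ?D = "{z \<in> space (Q \<Otimes>\<^sub>M borel). 0 < snd z \<and> snd z \<le> b (fst z)}"
  let ?R = "restrict_space (Q \<Otimes>\<^sub>M borel) ?D"
  have D: "?D \<in> sets (Q \<Otimes>\<^sub>M borel)" by measurable
  have spR: "space ?R = ?D" by (auto simp: space_restrict_space)
  have "(\<lambda>(x, s). (s, e x)) \<in> measurable ?R predictable_algebra"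
    unfolding predictable_sigma_def
  proof (rule measurable_measure_of[OF predictable_generator_subset])
    show "(\<lambda>(x, s). (s, e x)) \<in> space ?R \<rightarrow> {0<..} \<times> space M"
      unfolding spR using e by (auto simp: space_pair_measure)
  next
    fix G assume "G \<in> {{s<..t} \<times> A | s t A. 0 \<le> s \<and> s \<le> t \<and> A \<in> sets (history s)}"
    then obtain a c A where G: "G = {a<..c} \<times> A" "0 \<le> a" "A \<in> sets (history a)" by auto
    have "(\<lambda>(x, s). (s, e x)) -` G \<inter> space ?R
        = ({x \<in> space Q. a < b x \<and> e x \<in> A} \<times> {a<..c}) \<inter> ?D"
      unfolding spR G(1) using G(2) by (auto simp: space_pair_measure)
    also have "\<dots> \<in> sets ?R"
      using Q[OF G(2,3)] D by (auto simp: sets_restrict_space_iff intro!: sets.Int pair_measureI)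
    finally show "(\<lambda>(x, s). (s, e x)) -` G \<inter> space ?R \<in> sets ?R" .
  qed
  from measurable_compose[OF this Y[unfolded predictable_def]]
  have "(\<lambda>(x, s). Y s (e x)) \<in> borel_measurable ?R" by (simp add: case_prod_beta')
  then have "(\<lambda>z. indicator ?D z *\<^sub>R (case z of (x, s) \<Rightarrow> Y s (e x))) \<in> borel_measurable (Q \<Otimes>\<^sub>M borel)"
    using D by (subst (asm) borel_measurable_restrict_space_iff) auto
  then show ?thesis
    by (rule measurable_cong[THEN iffD1, rotated]) (auto simp: indicator_def)
qed

lemma predictable_progressive:
  assumes "predictable M history Y" "0 \<le> t"
  shows "(\<lambda>(\<omega>, s). indicator {0<..t} s * Y s \<omega>) \<in> borel_measurable (history t \<Otimes>\<^sub>M borel)"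
proof (rule predictable_integrand[OF assms(1), where b = "\<lambda>_. t" and e = "\<lambda>\<omega>. \<omega>"])
  fix a A assume A: "0 \<le> a" "A \<in> sets (history a)"
  show "{x \<in> space (history t). a < t \<and> x \<in> A} \<in> sets (history t)"
  proof (cases "a < t")
    case True
    then have "A \<in> sets (history t)" using A history_mono[of a t] by auto
    moreover have "{x \<in> space (history t). a < t \<and> x \<in> A} = A"
      using True sets.sets_into_space[OF \<open>A \<in> sets (history t)\<close>] by auto
    ultimately show ?thesis by (simp only:)
  qed simp
qed auto

lemma predictable_section:
  assumes "predictable M history Y" "0 \<le> t" "\<omega> \<in> space M"
  shows "(\<lambda>s. indicator {0<..t} s * Y s \<omega>) \<in> borel_measurable borel"
  using measurable_compose[OF measurable_Pair1'[of \<omega> "history t" borel] predictable_progressive[OF assms(1,2)]]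
    assms(3) by simp

lemma integral_adapted:
  assumes "predictable M history Y" "0 \<le> t"
  shows "(\<lambda>\<omega>. LINT s:{0<..t}|lborel. Y s \<omega>) \<in> borel_measurable (history t)"
  using lborel.borel_measurable_lebesgue_integral[of "\<lambda>\<omega> s. indicator {0<..t} s * Y s \<omega>" "history t"]
    predictable_progressive[OF assms]
  by (simp add: set_lebesgue_integral_def)

lemma integral_predictable:
  assumes "predictable M history Y"
  shows "predictable M history (\<lambda>t \<omega>. LINT s:{0<..t}|lborel. Y s \<omega>)"
proof -
  have "(\<lambda>(x, s). indicator {0<..fst x} s * Y s (snd x)) \<in> borel_measurable (predictable_algebra \<Otimes>\<^sub>M borel)"
  proof (rule predictable_integrand[OF assms time_predictable, where e = snd])
    fix a A assume A: "0 \<le> a" "A \<in> sets (history a)"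
    then have "{x \<in> space predictable_algebra. a < fst x \<and> snd x \<in> A} = {a<..} \<times> A"
      using sets.sets_into_space[OF A(2)] by auto
    then show "{x \<in> space predictable_algebra. a < fst x \<and> snd x \<in> A} \<in> sets predictable_algebra"
      using A by (simp only: ray_predictable)
  qed auto
  then show ?thesis
    using lborel.borel_measurable_lebesgue_integral[of "\<lambda>x s. indicator {0<..fst x} s * Y s (snd x)" predictable_algebra]
    by (simp add: set_lebesgue_integral_def predictable_def case_prod_beta')
qed

text \<open>
  If \<open>T k < u\<close>, then there is a rational number \<open>q\<close> with \<open>T k \<le> q < u\<close>, and whether \<open>T k \<le> q\<close> is
  known at \<open>q\<close>.
\<close>

lemma elapsed_jump_predictable:
  assumes "0 \<le> a"
  shows "{(u, \<omega>) \<in> space predictable_algebra. T k \<omega> < ennreal u \<and> T k \<omega> \<le> ennreal a} \<in> sets predictable_algebra"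
proof -
  let ?Q = "\<rat> \<inter> {0..} :: real set"
  have "{(u, \<omega>) \<in> space predictable_algebra. T k \<omega> < ennreal u \<and> T k \<omega> \<le> ennreal a}
      = (\<Union>q\<in>?Q. {q<..} \<times> {\<omega> \<in> space M. T k \<omega> \<le> ennreal (min q a)})"
    (is "?L = ?R")
  proof (intro equalityI subsetI)
    fix w assume "w \<in> ?L"
    then obtain u \<omega> where w: "w = (u, \<omega>)" "\<omega> \<in> space M"
      and u: "0 < u" "T k \<omega> < ennreal u" "T k \<omega> \<le> ennreal a" by auto
    from u have fin: "T k \<omega> < \<infinity>" by (auto intro: less_le_trans)
    have "\<tau> k \<omega> < u" using u fin by (cases "T k \<omega>" rule: ennreal_cases) (auto simp: ennreal_less_iff)
    then obtain q where q: "q \<in> \<rat>" "\<tau> k \<omega> < q" "q < u" using Rats_dense_in_real by blast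
    have q0: "0 \<le> q" using q(2) enn2real_nonneg[of "T k \<omega>"] by linarith
    then have "T k \<omega> \<le> ennreal q"
      using le_ennreal_iff_enn2real_le[OF fin q0] less_imp_le[OF q(2)] by blast
    then have "T k \<omega> \<le> ennreal (min q a)" using u(3) by (simp add: min_def)
    then show "w \<in> ?R" using q q0 w by auto
  next
    fix w assume "w \<in> ?R"
    then obtain q u \<omega> where w: "w = (u, \<omega>)" "\<omega> \<in> space M"
      and q: "0 \<le> q" "q < u" "T k \<omega> \<le> ennreal (min q a)" by auto
    have "ennreal (min q a) \<le> ennreal q" "ennreal (min q a) \<le> ennreal a" "ennreal q < ennreal u"
      using q by (auto simp: ennreal_leI ennreal_less_iff)
    then have "T k \<omega> < ennreal u" "T k \<omega> \<le> ennreal a"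
      using q(3) by (meson le_less_trans order_trans)+
    then show "w \<in> ?L" using w q by simp
  qed
  also have "\<dots> \<in> sets predictable_algebra"
  proof (intro sets.countable_UN'' ray_predictable)
    show "countable ?Q" by (intro countable_Int1 countable_rat)
    fix q assume q: "q \<in> ?Q"
    then show "0 \<le> q" by simp
    have "{\<omega> \<in> space M. T k \<omega> \<le> ennreal (min q a)} \<in> sets (history (min q a))"
      using q assms by (intro stopping_sets) auto
    then show "{\<omega> \<in> space M. T k \<omega> \<le> ennreal (min q a)} \<in> sets (history q)"
      using history_mono[of "min q a" q] by auto
  qed
  finally show ?thesis .
qed

lemma jump_passed_predictable: "{(u, \<omega>) \<in> space predictable_algebra. T k \<omega> < ennreal u} \<in> sets predictable_algebra"
proof -
  have "{(u, \<omega>) \<in> space predictable_algebra. T k \<omega> < ennreal u}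
      = (\<Union>i :: nat. {(u, \<omega>) \<in> space predictable_algebra. T k \<omega> < ennreal u \<and> T k \<omega> \<le> ennreal (real i)})"
  proof (intro equalityI subsetI; clarsimp)
    fix u \<omega> assume u: "0 < u" "T k \<omega> < ennreal u"
    obtain i :: nat where "u \<le> real i" using real_arch_simple by blast
    then show "\<exists>i. T k \<omega> \<le> ennreal (real i)"
      using u by (intro exI[of _ i]) (meson ennreal_leI less_imp_le order_trans)
  qed
  also have "\<dots> \<in> sets predictable_algebra" by (intro sets.countable_UN'' elapsed_jump_predictable) auto
  finally show ?thesis .
qed

text \<open>
  The value \<open>- 1\<close> marks a jump that has not happened strictly before \<open>u\<close>; the jump times themselves are
  nonnegative.
\<close>

lemma last_time_predictable:
  "(\<lambda>(u, \<omega>). if T k \<omega> < ennreal u then \<tau> k \<omega> else - 1) \<in> borel_measurable predictable_algebra"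
proof (rule borel_measurable_iff_le[THEN iffD2], intro allI)
  fix a :: real
  let ?f = "\<lambda>(u, \<omega>). if T k \<omega> < ennreal u then \<tau> k \<omega> else - 1"
  let ?E = "{(u, \<omega>) \<in> space predictable_algebra. T k \<omega> < ennreal u \<and> T k \<omega> \<le> ennreal a}"
  let ?J = "{(u, \<omega>) \<in> space predictable_algebra. T k \<omega> < ennreal u}"
  have fin: "T k \<omega> < \<infinity>" if "T k \<omega> < ennreal u" for u \<omega> using that by (auto intro: less_trans)
  have neg: "\<not> \<tau> k \<omega> \<le> a" if "a < 0" for \<omega>
    using that enn2real_nonneg[of "T k \<omega>"] by linarith
  consider "a < - 1" | "- 1 \<le> a" "a < 0" | "0 \<le> a" by linarith
  then show "{w \<in> space predictable_algebra. ?f w \<le> a} \<in> sets predictable_algebra"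
  proof cases
    case 1
    have "{w \<in> space predictable_algebra. ?f w \<le> a} = {}"
    proof (rule ccontr)
      assume "{w \<in> space predictable_algebra. ?f w \<le> a} \<noteq> {}"
      then obtain u \<omega> where "?f (u, \<omega>) \<le> a" by force
      with 1 neg show False by (auto split: if_splits)
    qed
    then show ?thesis by (simp only: sets.empty_sets)
  next
    case 2
    with neg have "{w \<in> space predictable_algebra. ?f w \<le> a} = space predictable_algebra - ?J" by (auto split: if_splits)
    then show ?thesis by (simp only: sets.compl_sets[OF jump_passed_predictable])
  next
    case 3
    then have "{w \<in> space predictable_algebra. ?f w \<le> a} = (space predictable_algebra - ?J) \<union> ?E"
      using fin by (auto simp: le_ennreal_iff_enn2real_le split: if_splits)
    then show ?thesis
      using 3 by (simp only: sets.Un sets.compl_sets jump_passed_predictable elapsed_jump_predictable)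
  qed
qed

section \<open>The compensator of the counting process\<close>

context
  fixes l :: "real \<Rightarrow> 'w \<Rightarrow> real"
  assumes l_predictable: "predictable M history l"
    and l_eq_rate: "\<And>k u \<omega>. \<omega> \<in> space M \<Longrightarrow> T k \<omega> < ennreal u \<Longrightarrow> ennreal u \<le> T (Suc k) \<omega> \<Longrightarrow> l u \<omega> = \<rho> k u \<omega>"
begin

text \<open>
  The part of the intensity that belongs to the jump from \<open>T k\<close> to \<open>T (k + 1)\<close>. The interval is closed
  on the right, in contrast to the one in \<open>jump_compensation\<close>, which makes this part predictable.
\<close>

definition intensity_piece :: "nat \<Rightarrow> real \<Rightarrow> 'w \<Rightarrow> real" where
  "intensity_piece k u \<omega> = (if T k \<omega> < ennreal u \<and> ennreal u \<le> T (Suc k) \<omega> then l u \<omega> else 0)"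

definition compensator_piece :: "nat \<Rightarrow> real \<Rightarrow> 'w \<Rightarrow> real" where
  "compensator_piece k t \<omega> = (LINT u:{0<..t}|lborel. intensity_piece k u \<omega>)"

definition jump_martingale :: "nat \<Rightarrow> real \<Rightarrow> 'w \<Rightarrow> real" where
  "jump_martingale k t \<omega> = (if T (Suc k) \<omega> \<le> ennreal t then 1 else 0) - compensator_piece k t \<omega>"

lemma intensity_piece_predictable: "predictable M history (intensity_piece k)"
proof -
  have [measurable]: "(\<lambda>(u, \<omega>). l u \<omega>) \<in> borel_measurable predictable_algebra"
    using l_predictable by (simp add: predictable_def)
  have [measurable]: "Measurable.pred predictable_algebra (\<lambda>(u, \<omega>). T j \<omega> < ennreal u)" for j
  proof -
    have "{w \<in> space predictable_algebra. case w of (u, \<omega>) \<Rightarrow> T j \<omega> < ennreal u} = {(u, \<omega>) \<in> space predictable_algebra. T j \<omega> < ennreal u}"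
      by auto
    then show ?thesis by (simp only: pred_def jump_passed_predictable)
  qed
  have "(\<lambda>w. if (case w of (u, \<omega>) \<Rightarrow> T k \<omega> < ennreal u) \<and> \<not> (case w of (u, \<omega>) \<Rightarrow> T (Suc k) \<omega> < ennreal u)
      then (case w of (u, \<omega>) \<Rightarrow> l u \<omega>) else 0) \<in> borel_measurable predictable_algebra"
    by measurable
  then show ?thesis
    unfolding predictable_def by (rule measurable_cong[THEN iffD1, rotated]) (auto simp: intensity_piece_def not_less)
qed

lemma intensity_piece_bound:
  "\<exists>C\<ge>0. \<forall>\<omega>\<in>space M. \<forall>u. u \<le> t \<longrightarrow> 0 \<le> intensity_piece k u \<omega> \<and> intensity_piece k u \<omega> \<le> C"
proof -
  obtain a b where ab: "a > 0" "b \<ge> 0" "\<And>k u \<omega>. \<omega> \<in> space M \<Longrightarrow> 0 \<le> u \<Longrightarrow> u \<le> t \<Longrightarrow> T k \<omega> \<le> ennreal u \<Longrightarrow>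
      \<rho> k u \<omega> \<le> a + b * real k"
    using rate_bound[of t] by blast
  have pos: "0 \<le> a + b * real k" using ab(1,2) by simp
  have "0 \<le> intensity_piece k u \<omega> \<and> intensity_piece k u \<omega> \<le> a + b * real k" if "\<omega> \<in> space M" "u \<le> t" for u \<omega>
  proof (cases "T k \<omega> < ennreal u \<and> ennreal u \<le> T (Suc k) \<omega>")
    case True
    then have "0 \<le> u" by (metis ennreal_neg linorder_le_cases not_less_zero)
    with True show ?thesis
      using ab(3)[OF that(1), of u k] that(2) rate_nonneg[of k u \<omega>] l_eq_rate[OF that(1), of k u]
      by (auto simp: intensity_piece_def less_imp_le)
  next
    case False
    then show ?thesis using pos by (auto simp: intensity_piece_def)
  qed
  with pos show ?thesis by blast
qed

lemma intensity_piece_integrable: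
  assumes \<omega>: "\<omega> \<in> space M" and t: "0 \<le> t"
  shows "set_integrable lborel {0<..t} (\<lambda>u. intensity_piece k u \<omega>)"
proof -
  obtain C where C: "C \<ge> 0" "\<And>u. u \<le> t \<Longrightarrow> 0 \<le> intensity_piece k u \<omega> \<and> intensity_piece k u \<omega> \<le> C"
    using intensity_piece_bound[of t k] \<omega> by blast
  show ?thesis
    unfolding set_integrable_def
  proof (rule Bochner_Integration.integrable_bound[of _ "\<lambda>u. indicator {0<..t} u * C"])
    show "integrable lborel (\<lambda>u. indicator {0<..t} u * C)"
      using t by (intro integrable_mult_left integrable_real_indicator) (simp_all add: ennreal_less_top)
    show "(\<lambda>u. indicat_real {0<..t} u *\<^sub>R intensity_piece k u \<omega>) \<in> borel_measurable lborel"
      using predictable_section[OF intensity_piece_predictable t \<omega>] by simp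
    show "AE u in lborel. norm (indicat_real {0<..t} u *\<^sub>R intensity_piece k u \<omega>) \<le> norm (indicator {0<..t} u * C)"
      using C by (intro AE_I2) (auto simp: indicator_def)
  qed
qed

lemma compensator_piece_nonneg: "\<omega> \<in> space M \<Longrightarrow> 0 \<le> compensator_piece k t \<omega>"
  unfolding compensator_piece_def set_lebesgue_integral_def
proof (intro Bochner_Integration.integral_nonneg)
  fix u assume "\<omega> \<in> space M"
  then show "0 \<le> indicat_real {0<..t} u *\<^sub>R intensity_piece k u \<omega>"
    using intensity_piece_bound[of t k] by (auto simp: indicator_def)
qed

text \<open>
  The two intervals between \<open>T k\<close> and \<open>T (k + 1)\<close> differ only in their endpoints, a null set.
\<close>

lemma compensator_piece_eq:
  assumes \<omega>: "\<omega> \<in> space M" and t: "0 \<le> t"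
  shows "ennreal (compensator_piece k t \<omega>) = (\<integral>\<^sup>+u. indicator {0..t} u * ennreal (\<rho> k u \<omega>) *
        (if T k \<omega> \<le> ennreal u \<and> ennreal u < T (Suc k) \<omega> then 1 else 0) \<partial>lborel)"
proof -
  have "ennreal (compensator_piece k t \<omega>) = (\<integral>\<^sup>+u. ennreal (indicator {0<..t} u * intensity_piece k u \<omega>) \<partial>lborel)"
    using intensity_piece_integrable[OF \<omega> t, of k] intensity_piece_bound[of t k] \<omega>
    unfolding compensator_piece_def set_lebesgue_integral_def set_integrable_def
    by (subst nn_integral_eq_integral) (auto simp: indicator_def)
  also have "\<dots> = (\<integral>\<^sup>+u. indicator {0..t} u * ennreal (\<rho> k u \<omega>) *
        (if T k \<omega> \<le> ennreal u \<and> ennreal u < T (Suc k) \<omega> then 1 else 0) \<partial>lborel)"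
  proof (rule nn_integral_cong_AE)
    show "AE u in lborel. ennreal (indicator {0<..t} u * intensity_piece k u \<omega>) =
        indicator {0..t} u * ennreal (\<rho> k u \<omega>) *
        (if T k \<omega> \<le> ennreal u \<and> ennreal u < T (Suc k) \<omega> then 1 else 0)"
      using AE_lborel_singleton[of 0] AE_lborel_singleton[of "\<tau> k \<omega>"] AE_lborel_singleton[of "\<tau> (Suc k) \<omega>"]
    proof eventually_elim
      fix u :: real assume u: "u \<noteq> 0" "u \<noteq> \<tau> k \<omega>" "u \<noteq> \<tau> (Suc k) \<omega>"
      show "ennreal (indicator {0<..t} u * intensity_piece k u \<omega>) = indicator {0..t} u * ennreal (\<rho> k u \<omega>) *
        (if T k \<omega> \<le> ennreal u \<and> ennreal u < T (Suc k) \<omega> then 1 else 0)"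
      proof (cases "u \<in> {0<..t}")
        case True
        then have ne: "T k \<omega> \<noteq> ennreal u" "T (Suc k) \<omega> \<noteq> ennreal u" using u by auto
        then have "T k \<omega> \<le> ennreal u \<longleftrightarrow> T k \<omega> < ennreal u"
          "ennreal u < T (Suc k) \<omega> \<longleftrightarrow> ennreal u \<le> T (Suc k) \<omega>" by (auto simp: less_le)
        then show ?thesis using True l_eq_rate[OF \<omega>, of k u] by (auto simp: intensity_piece_def)
      next
        case False
        with u(1) have "u \<notin> {0..t}" by auto
        with False show ?thesis by simp
      qed
    qed
  qed
  finally show ?thesis .
qed

lemma compensator_piece_adapted: "0 \<le> t \<Longrightarrow> compensator_piece k t \<in> borel_measurable (history t)"
  using integral_adapted[OF intensity_piece_predictable] unfolding compensator_piece_def[abs_def] .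

lemma compensator_piece_measurable: "0 \<le> t \<Longrightarrow> compensator_piece k t \<in> borel_measurable M"
  using compensator_piece_adapted by (rule measurable_from_subalg[OF history_subalgebra])

lemma compensator_piece_expectation:
  assumes B: "B \<in> sets (P k)" and t: "0 \<le> t"
  shows "integrable M (\<lambda>\<omega>. indicator B \<omega> * compensator_piece k t \<omega>)"
    and "(\<integral>\<omega>. indicator B \<omega> * compensator_piece k t \<omega> \<partial>M) = measure M {\<omega> \<in> B. T (Suc k) \<omega> \<le> ennreal t}"
proof -
  note [measurable] = compensator_piece_measurable[OF t] past_sets[OF B]
  have "(\<integral>\<^sup>+\<omega>. ennreal (indicator B \<omega> * compensator_piece k t \<omega>) \<partial>M)
      = (\<integral>\<^sup>+\<omega>. indicator B \<omega> * (\<integral>\<^sup>+u. indicator {0..t} u * ennreal (\<rho> k u \<omega>) *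
        (if T k \<omega> \<le> ennreal u \<and> ennreal u < T (Suc k) \<omega> then 1 else 0) \<partial>lborel) \<partial>M)"
    by (intro nn_integral_cong) (auto simp: indicator_def compensator_piece_eq[OF _ t] simp del: mult_eq_0_iff)
  also have "\<dots> = emeasure M {\<omega> \<in> B. T (Suc k) \<omega> \<le> ennreal t}"
    by (rule jump_compensation[OF B t, symmetric])
  finally have nn: "(\<integral>\<^sup>+\<omega>. ennreal (indicator B \<omega> * compensator_piece k t \<omega>) \<partial>M)
      = emeasure M {\<omega> \<in> B. T (Suc k) \<omega> \<le> ennreal t}" .
  have pos: "AE \<omega> in M. 0 \<le> indicator B \<omega> * compensator_piece k t \<omega>"
    by (intro AE_I2) (simp add: compensator_piece_nonneg)
  show "integrable M (\<lambda>\<omega>. indicator B \<omega> * compensator_piece k t \<omega>)"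
    by (rule integrableI_nonneg[OF _ pos]) (auto simp: nn less_top[symmetric])
  show "(\<integral>\<omega>. indicator B \<omega> * compensator_piece k t \<omega> \<partial>M) = measure M {\<omega> \<in> B. T (Suc k) \<omega> \<le> ennreal t}"
    by (subst integral_eq_nn_integral[OF _ pos]) (simp_all add: nn measure_def)
qed

text \<open>
  After \<open>T (k + 1)\<close> neither the indicator nor the integral changes any more.
\<close>

lemma jump_martingale_stopped:
  assumes \<omega>: "\<omega> \<in> space M" and st: "0 \<le> s" "s \<le> t" and T: "T (Suc k) \<omega> \<le> ennreal s"
  shows "jump_martingale k t \<omega> = jump_martingale k s \<omega>"
proof -
  have "indicator {0<..t} u *\<^sub>R intensity_piece k u \<omega> = indicator {0<..s} u *\<^sub>R intensity_piece k u \<omega>" for u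
  proof (cases "s < u")
    case True
    then have "T (Suc k) \<omega> < ennreal u" using T st by (meson ennreal_lessI le_less_trans)
    then show ?thesis by (simp add: intensity_piece_def not_le[symmetric])
  next
    case False
    with st show ?thesis by (simp add: indicator_def)
  qed
  then have "compensator_piece k t \<omega> = compensator_piece k s \<omega>"
    by (simp only: compensator_piece_def set_lebesgue_integral_def)
  moreover have "T (Suc k) \<omega> \<le> ennreal t" using T st(2) by (meson ennreal_leI order_trans)
  ultimately show ?thesis using T by (simp add: jump_martingale_def)
qed

lemma jump_martingale_integrable:
  assumes t: "0 \<le> t"
  shows "integrable M (jump_martingale k t)"
proof -
  have "integrable M (\<lambda>\<omega>. indicator (space M) \<omega> * compensator_piece k t \<omega>)"
    using sets.top[of "P k"] by (intro compensator_piece_expectation t) simp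
  then have "integrable M (compensator_piece k t)"
    by (rule Bochner_Integration.integrable_cong[THEN iffD1, rotated 2]) auto
  moreover have "integrable M (\<lambda>\<omega>. if T (Suc k) \<omega> \<le> ennreal t then 1 else 0 :: real)"
    by (rule integrable_const_bound[of _ 1]) auto
  ultimately show ?thesis
    unfolding jump_martingale_def[abs_def] by (intro Bochner_Integration.integrable_diff)
qed

lemma jump_martingale_centered:
  assumes B: "B \<in> sets (P k)" and t: "0 \<le> t"
  shows "(\<integral>\<omega>. indicator B \<omega> * jump_martingale k t \<omega> \<partial>M) = 0"
proof -
  note [measurable] = past_sets[OF B]
  let ?I = "\<lambda>\<omega>. indicator {\<omega> \<in> B. T (Suc k) \<omega> \<le> ennreal t} \<omega> :: real"
  have m: "{\<omega> \<in> B. T (Suc k) \<omega> \<le> ennreal t} \<in> sets M"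
  proof -
    have "{\<omega> \<in> B. T (Suc k) \<omega> \<le> ennreal t} = B \<inter> {\<omega> \<in> space M. T (Suc k) \<omega> \<le> ennreal t}"
      using sets.sets_into_space[OF past_sets[OF B]] by auto
    also have "\<dots> \<in> sets M" by measurable
    finally show ?thesis .
  qed
  have "(\<integral>\<omega>. indicator B \<omega> * jump_martingale k t \<omega> \<partial>M)
      = (\<integral>\<omega>. ?I \<omega> - indicator B \<omega> * compensator_piece k t \<omega> \<partial>M)"
    by (intro Bochner_Integration.integral_cong) (auto simp: jump_martingale_def indicator_def)
  also have "\<dots> = measure M {\<omega> \<in> B. T (Suc k) \<omega> \<le> ennreal t} - (\<integral>\<omega>. indicator B \<omega> * compensator_piece k t \<omega> \<partial>M)"
    using m by (subst Bochner_Integration.integral_diff)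
      (auto intro!: compensator_piece_expectation[OF B t] integrable_real_indicator simp: less_top[symmetric] Int_absorb2
        sets.sets_into_space)
  also have "\<dots> = 0" by (simp add: compensator_piece_expectation[OF B t])
  finally show ?thesis .
qed

lemma jump_martingale_adapted:
  assumes "0 \<le> t"
  shows "jump_martingale k t \<in> borel_measurable (history t)"
proof -
  note [measurable] = compensator_piece_adapted[OF assms, of k]
  have [measurable]: "Measurable.pred (history t) (\<lambda>\<omega>. T (Suc k) \<omega> \<le> ennreal t)"
    unfolding pred_def space_history by (rule stopping_sets[OF assms])
  show ?thesis unfolding jump_martingale_def[abs_def] by measurable
qed

text \<open>
  On \<open>{T (k + 1) \<le> s}\<close> the increment is \<open>0\<close>, and on \<open>{s < T (k + 1)}\<close> the event \<open>B\<close> may be replaced by an event of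
  the past of \<open>T k\<close>. Against such an event the process has mean \<open>0\<close> at all times.
\<close>

lemma jump_martingale_increment:
  assumes B: "B \<in> sets (history s)" and st: "0 \<le> s" "s \<le> t"
  shows "(\<integral>\<omega>. indicator B \<omega> * jump_martingale k t \<omega> \<partial>M) = (\<integral>\<omega>. indicator B \<omega> * jump_martingale k s \<omega> \<partial>M)"
proof -
  obtain B' where B': "B' \<in> sets (P k)"
    "\<And>\<omega>. \<omega> \<in> space M \<Longrightarrow> ennreal s < T (Suc k) \<omega> \<Longrightarrow> \<omega> \<in> B \<longleftrightarrow> \<omega> \<in> B'"
    using trace_before_jump[OF B, of k] by blast
  have int: "integrable M (\<lambda>\<omega>. indicator C \<omega> * jump_martingale k r \<omega>)" if "C \<in> sets M" "0 \<le> r" for C r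
    using integrable_mult_indicator[OF that(1) jump_martingale_integrable[OF that(2), of k]] by simp
  have t: "0 \<le> t" using st by simp
  have "(\<integral>\<omega>. indicator B \<omega> * jump_martingale k t \<omega> \<partial>M) - (\<integral>\<omega>. indicator B \<omega> * jump_martingale k s \<omega> \<partial>M)
      = (\<integral>\<omega>. indicator B \<omega> * jump_martingale k t \<omega> - indicator B \<omega> * jump_martingale k s \<omega> \<partial>M)"
    using history_sets[OF B] st t by (intro Bochner_Integration.integral_diff[symmetric] int)
  also have "\<dots> = (\<integral>\<omega>. indicator B' \<omega> * jump_martingale k t \<omega> - indicator B' \<omega> * jump_martingale k s \<omega> \<partial>M)"
  proof (rule Bochner_Integration.integral_cong[OF refl])
    fix \<omega> assume \<omega>: "\<omega> \<in> space M"
    show "indicator B \<omega> * jump_martingale k t \<omega> - indicator B \<omega> * jump_martingale k s \<omega>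
        = indicator B' \<omega> * jump_martingale k t \<omega> - indicator B' \<omega> * jump_martingale k s \<omega>"
      using B'(2)[OF \<omega>] jump_martingale_stopped[OF \<omega> st, of k]
      by (cases "T (Suc k) \<omega> \<le> ennreal s") (auto simp: not_le indicator_def)
  qed
  also have "\<dots> = (\<integral>\<omega>. indicator B' \<omega> * jump_martingale k t \<omega> \<partial>M) - (\<integral>\<omega>. indicator B' \<omega> * jump_martingale k s \<omega> \<partial>M)"
    using past_sets[OF B'(1)] st t by (intro Bochner_Integration.integral_diff int)
  also have "\<dots> = 0" using jump_martingale_centered[OF B'(1)] st t by simp
  finally show ?thesis by simp
qed

text \<open>
  The minimum with \<open>n\<close> keeps the time finite when there are fewer than \<open>n\<close> jumps.
\<close>

definition localizing_time :: "nat \<Rightarrow> 'w \<Rightarrow> real" where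
  "localizing_time n \<omega> = enn2real (min (T n \<omega>) (ennreal (real n)))"

lemma localizing_time_ennreal: "ennreal (localizing_time n \<omega>) = min (T n \<omega>) (ennreal (real n))"
  unfolding localizing_time_def by (rule ennreal_enn2real) (auto simp: min_def less_top intro: le_less_trans)

lemma le_localizing_time_iff: "0 \<le> u \<Longrightarrow> u \<le> localizing_time n \<omega> \<longleftrightarrow> ennreal u \<le> T n \<omega> \<and> u \<le> real n"
proof -
  assume u: "0 \<le> u"
  have "u \<le> localizing_time n \<omega> \<longleftrightarrow> ennreal u \<le> ennreal (localizing_time n \<omega>)"
    by (rule ennreal_le_iff[symmetric]) (simp add: localizing_time_def)
  also have "\<dots> \<longleftrightarrow> ennreal u \<le> T n \<omega> \<and> u \<le> real n"
    unfolding localizing_time_ennreal by auto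
  finally show ?thesis .
qed

lemma localizing_time_le_iff:
  assumes "0 \<le> t"
  shows "localizing_time n \<omega> \<le> t \<longleftrightarrow> T n \<omega> \<le> ennreal t \<or> real n \<le> t"
proof -
  have "localizing_time n \<omega> \<le> t \<longleftrightarrow> ennreal (localizing_time n \<omega>) \<le> ennreal t"
    by (rule ennreal_le_iff[OF assms, symmetric])
  also have "\<dots> \<longleftrightarrow> T n \<omega> \<le> ennreal t \<or> real n \<le> t"
    unfolding localizing_time_ennreal min_le_iff_disj using assms by simp
  finally show ?thesis .
qed

lemma localizing_time_stopping: "stopping_time history (localizing_time n)"
  unfolding stopping_time_def
proof
  fix t :: real
  show "Measurable.pred (history t) (\<lambda>\<omega>. localizing_time n \<omega> \<le> t)"
  proof (cases "0 \<le> t")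
    case True
    have [measurable]: "Measurable.pred (history t) (\<lambda>\<omega>. T n \<omega> \<le> ennreal t)"
      unfolding pred_def space_history by (rule stopping_sets[OF True])
    show ?thesis unfolding localizing_time_le_iff[OF True] by measurable
  next
    case False
    then have "\<not> localizing_time n \<omega> \<le> t" for \<omega>
      using enn2real_nonneg[of "min (T n \<omega>) (ennreal (real n))"] unfolding localizing_time_def by linarith
    then show ?thesis by simp
  qed
qed

lemma localizing_time_limit:
  "AE \<omega> in M. incseq (\<lambda>n. localizing_time n \<omega>) \<and> filterlim (\<lambda>n. localizing_time n \<omega>) at_top sequentially"
  using non_explosion AE_space
proof eventually_elim
  fix \<omega> assume ex: "\<forall>t. \<exists>k. ennreal t < T k \<omega>" and \<omega>: "\<omega> \<in> space M"
  have inc: "incseq (\<lambda>n. localizing_time n \<omega>)"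
  proof (rule incseq_SucI)
    fix n
    have "0 \<le> localizing_time n \<omega>" by (simp add: localizing_time_def)
    moreover have "ennreal (localizing_time n \<omega>) \<le> T (Suc n) \<omega>"
      using T_mono[OF \<omega>, of n "Suc n"] unfolding localizing_time_ennreal by (auto simp: min_le_iff_disj)
    moreover have "localizing_time n \<omega> \<le> real (Suc n)"
      using le_localizing_time_iff[of "localizing_time n \<omega>" n \<omega>] by (simp add: localizing_time_def)
    ultimately show "localizing_time n \<omega> \<le> localizing_time (Suc n) \<omega>"
      by (subst le_localizing_time_iff) auto
  qed
  moreover have "filterlim (\<lambda>n. localizing_time n \<omega>) at_top sequentially"
    unfolding filterlim_at_top
  proof
    fix Z :: real
    obtain k where k: "ennreal (max Z 0) < T k \<omega>" using ex by blast
    obtain i :: nat where i: "max Z 0 \<le> real i" using real_arch_simple by blast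
    show "\<forall>\<^sub>F n in sequentially. Z \<le> localizing_time n \<omega>"
      using eventually_ge_at_top[of "max k i"]
    proof eventually_elim
      fix n assume n: "max k i \<le> n"
      then have "ennreal (max Z 0) \<le> T n \<omega>" using k T_mono[OF \<omega>, of k n] by auto
      moreover have "max Z 0 \<le> real n" using i n by linarith
      ultimately have "max Z 0 \<le> localizing_time n \<omega>" by (subst le_localizing_time_iff) auto
      then show "Z \<le> localizing_time n \<omega>" by simp
    qed
  qed
  ultimately show "incseq (\<lambda>n. localizing_time n \<omega>) \<and> filterlim (\<lambda>n. localizing_time n \<omega>) at_top sequentially" ..
qed

lemma current_piece:
  assumes \<omega>: "\<omega> \<in> space M" and u: "0 < u" "ennreal u \<le> T n \<omega>"
  shows "\<exists>k<n. T k \<omega> < ennreal u \<and> ennreal u \<le> T (Suc k) \<omega>"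
  using u(2)
proof (induction n)
  case 0
  then show ?case using T_0[OF \<omega>] u(1) by simp
next
  case (Suc n)
  then show ?case by (cases "ennreal u \<le> T n \<omega>") (auto simp: not_le intro: less_SucI)
qed

lemma piece_unique:
  assumes "\<omega> \<in> space M" "T j \<omega> < u" "u \<le> T (Suc j) \<omega>" "T k \<omega> < u" "u \<le> T (Suc k) \<omega>"
  shows "j = k"
  using assms T_mono[of \<omega> "Suc j" k] T_mono[of \<omega> "Suc k" j]
  by (metis leD less_le_trans le_less_trans not_less_eq_eq le_antisym order.trans Suc_leI linorder_neqE_nat)

lemma l_eq_sum_pieces:
  assumes \<omega>: "\<omega> \<in> space M" and u: "0 < u" "ennreal u \<le> T n \<omega>"
  shows "l u \<omega> = (\<Sum>k<n. intensity_piece k u \<omega>)"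
proof -
  obtain j where j: "j < n" "T j \<omega> < ennreal u" "ennreal u \<le> T (Suc j) \<omega>"
    using current_piece[OF \<omega> u] by blast
  have "intensity_piece k u \<omega> = (if k = j then l u \<omega> else 0)" for k
  proof (cases "k = j")
    case False
    then have "\<not> (T k \<omega> < ennreal u \<and> ennreal u \<le> T (Suc k) \<omega>)"
      using piece_unique[OF \<omega> j(2,3), of k] by blast
    with False show ?thesis by (auto simp: intensity_piece_def)
  qed (use j in \<open>simp add: intensity_piece_def\<close>)
  then have "(\<Sum>k<n. intensity_piece k u \<omega>) = (\<Sum>k<n. if k = j then l u \<omega> else 0)"
    by (simp only:)
  also have "\<dots> = l u \<omega>" using j(1) by (subst sum.delta) auto
  finally show ?thesis ..
qed

text \<open>
  Up to \<open>T n\<close> only the first \<open>n\<close> jumps and the first \<open>n\<close> parts of the intensity occur. This holds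
  on every path, so the stopped process is exactly adapted, and not merely up to a null set.
\<close>

lemma stopped_decomposition:
  fixes n :: nat
  assumes \<omega>: "\<omega> \<in> space M" and t: "0 \<le> t"
  defines "s \<equiv> min t (localizing_time n \<omega>)"
  shows "measure (N \<omega>) {0<..s} - (LINT u:{0<..s}|lborel. l u \<omega>)
    = (\<Sum>k<n. jump_martingale k (min t (real n)) \<omega>)"
proof -
  let ?t = "min t (real n)"
  have s0: "0 \<le> s" using t by (simp add: s_def localizing_time_def)
  have s_iff: "u \<le> s \<longleftrightarrow> u \<le> ?t \<and> ennreal u \<le> T n \<omega>" if "0 \<le> u" for u
    unfolding s_def using le_localizing_time_iff[OF that] by auto
  have sT: "ennreal s \<le> T n \<omega>" using s_iff[OF s0] by simp
  have jump: "T (Suc k) \<omega> \<le> ennreal s \<longleftrightarrow> T (Suc k) \<omega> \<le> ennreal ?t" if "k < n" for k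
  proof
    assume "T (Suc k) \<omega> \<le> ennreal s"
    moreover have "ennreal s \<le> ennreal ?t" using s_iff[OF s0] by (intro ennreal_leI) auto
    ultimately show "T (Suc k) \<omega> \<le> ennreal ?t" by (rule order_trans)
  next
    assume *: "T (Suc k) \<omega> \<le> ennreal ?t"
    then have fin: "T (Suc k) \<omega> < \<infinity>" by (auto intro: le_less_trans)
    then have eq: "ennreal (\<tau> (Suc k) \<omega>) = T (Suc k) \<omega>" by simp
    have "\<tau> (Suc k) \<omega> \<le> ?t" using * fin t le_ennreal_iff_enn2real_le[OF fin, of ?t] by simp
    moreover have "T (Suc k) \<omega> \<le> T n \<omega>" using that by (intro T_mono[OF \<omega>]) auto
    ultimately have "\<tau> (Suc k) \<omega> \<le> s" using eq by (subst s_iff) simp_all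
    then show "T (Suc k) \<omega> \<le> ennreal s" using le_ennreal_iff_enn2real_le[OF fin s0] by blast
  qed
  have late: "\<not> T (Suc k) \<omega> \<le> ennreal s" if "n \<le> k" for k
  proof
    assume *: "T (Suc k) \<omega> \<le> ennreal s"
    then have "T (Suc k) \<omega> \<le> T n \<omega>" using sT by (rule order_trans)
    moreover have "T n \<omega> \<le> ennreal s" using T_mono[OF \<omega>, of n "Suc k"] that * by (auto intro: order_trans)
    then have "T n \<omega> < \<infinity>" by (auto intro: le_less_trans)
    ultimately show False using T_strict[OF \<omega>, of n "Suc k"] that by simp
  qed
  have "measure (N \<omega>) {0<..s} = (\<Sum>k<n. if T (Suc k) \<omega> \<le> ennreal s then 1 else 0)"
    by (rule measure_N_interval[OF \<omega> s0 late])
  also have "\<dots> = (\<Sum>k<n. if T (Suc k) \<omega> \<le> ennreal ?t then 1 else 0)"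
    using jump by (intro sum.cong) auto
  finally have count: "measure (N \<omega>) {0<..s} = (\<Sum>k<n. if T (Suc k) \<omega> \<le> ennreal ?t then 1 else 0)" .
  have pieces: "indicator {0<..s} u *\<^sub>R l u \<omega> = (\<Sum>k<n. indicator {0<..?t} u *\<^sub>R intensity_piece k u \<omega>)" for u
  proof (cases "0 < u \<and> u \<le> ?t")
    case True
    show ?thesis
    proof (cases "ennreal u \<le> T n \<omega>")
      case le: True
      moreover have "u \<in> {0<..s}" using s_iff[of u] True le by simp
      ultimately show ?thesis
        using True l_eq_sum_pieces[OF \<omega> _ le] by (simp add: sum_distrib_left[symmetric])
    next
      case False
      have "intensity_piece k u \<omega> = 0" if "k < n" for k
        using False T_mono[OF \<omega>, of "Suc k" n] that by (auto simp: intensity_piece_def)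
      then show ?thesis using False s_iff[of u] True by simp
    qed
  next
    case False
    then have "u \<notin> {0<..s}" "u \<notin> {0<..?t}" using s_iff[of u] by auto
    then show ?thesis by simp
  qed
  have "(LINT u:{0<..s}|lborel. l u \<omega>) = (\<Sum>k<n. compensator_piece k ?t \<omega>)"
    unfolding compensator_piece_def set_lebesgue_integral_def pieces
    using intensity_piece_integrable[OF \<omega>, of ?t] t
    by (intro Bochner_Integration.integral_sum) (auto simp: set_integrable_def)
  with count show ?thesis by (simp add: jump_martingale_def sum_subtractf)
qed

lemma compensated_local_martingale:
  "local_martingale M history (\<lambda>t \<omega>. measure (N \<omega>) {0<..t} - (LINT u:{0<..t}|lborel. l u \<omega>))"
  unfolding local_martingale_def
proof (intro exI[of _ localizing_time] conjI allI ballI localizing_time_stopping localizing_time_limit)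
  fix n \<omega> show "0 \<le> localizing_time n \<omega>" by (simp add: localizing_time_def)
next
  fix n
  let ?Y = "\<lambda>t \<omega>. measure (N \<omega>) {0<..min t (localizing_time n \<omega>)}
      - (LINT u:{0<..min t (localizing_time n \<omega>)}|lborel. l u \<omega>)"
  let ?Z = "\<lambda>t \<omega>. \<Sum>k<n. jump_martingale k (min t (real n)) \<omega>"
  have YZ: "?Y t \<omega> = ?Z t \<omega>" if "\<omega> \<in> space M" "0 \<le> t" for t \<omega>
    by (rule stopped_decomposition[OF that])
  have Zm: "?Z t \<in> borel_measurable (history t)" if "0 \<le> t" for t
  proof (rule borel_measurable_sum)
    fix k
    have "jump_martingale k (min t (real n)) \<in> borel_measurable (history (min t (real n)))"
      using that by (intro jump_martingale_adapted) auto
    moreover have "subalgebra (history t) (history (min t (real n)))"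
      using history_mono[of "min t (real n)" t] by (simp add: subalgebra_def)
    ultimately show "jump_martingale k (min t (real n)) \<in> borel_measurable (history t)"
      by (rule measurable_from_subalg[rotated])
  qed
  have Zi: "integrable M (?Z t)" if "0 \<le> t" for t
    using that by (intro Bochner_Integration.integrable_sum jump_martingale_integrable) auto
  have Ym: "?Y t \<in> borel_measurable (history t)" if "0 \<le> t" for t
    using Zm[OF that] by (rule measurable_cong[THEN iffD1, rotated]) (simp add: YZ that)
  have Yi: "integrable M (?Y t)" if "0 \<le> t" for t
    using Zi[OF that] by (rule Bochner_Integration.integrable_cong[THEN iffD1, rotated 2]) (simp_all add: YZ that)
  have "AE \<omega> in M. real_cond_exp M (history s) (?Y t) \<omega> = ?Y s \<omega>" if st: "0 \<le> s" "s \<le> t" for s t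
  proof -
    interpret S: sigma_finite_subalgebra M "history s" by (rule history_sigma_finite)
    show ?thesis
    proof (rule S.real_cond_exp_charact)
      fix B assume B: "B \<in> sets (history s)"
      have int: "integrable M (\<lambda>\<omega>. indicator B \<omega> * jump_martingale k r \<omega>)" if "0 \<le> r" for k r
        using integrable_mult_indicator[OF history_sets[OF B] jump_martingale_integrable[OF that, of k]] by simp
      have "(\<integral>\<omega>\<in>B. ?Y r \<omega> \<partial>M) = (\<Sum>k<n. \<integral>\<omega>. indicator B \<omega> * jump_martingale k (min r (real n)) \<omega> \<partial>M)"
        if r: "0 \<le> r" for r
      proof -
        have "(\<integral>\<omega>\<in>B. ?Y r \<omega> \<partial>M) = (\<integral>\<omega>. (\<Sum>k<n. indicator B \<omega> * jump_martingale k (min r (real n)) \<omega>) \<partial>M)"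
          unfolding set_lebesgue_integral_def[of M]
          by (intro Bochner_Integration.integral_cong refl)
            (simp only: YZ[OF _ r] sum_distrib_left real_scaleR_def)
        also have "\<dots> = (\<Sum>k<n. \<integral>\<omega>. indicator B \<omega> * jump_martingale k (min r (real n)) \<omega> \<partial>M)"
          using r by (intro Bochner_Integration.integral_sum int) simp
        finally show ?thesis .
      qed
      moreover have "(\<integral>\<omega>. indicator B \<omega> * jump_martingale k (min t (real n)) \<omega> \<partial>M)
          = (\<integral>\<omega>. indicator B \<omega> * jump_martingale k (min s (real n)) \<omega> \<partial>M)" for k
      proof (cases "s \<le> real n")
        case True
        with st have "min s (real n) = s" "s \<le> min t (real n)" by auto
        then show ?thesis using jump_martingale_increment[OF B st(1), of "min t (real n)" k] by simp
      next
        case False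
        with st show ?thesis by (simp add: min_def)
      qed
      ultimately show "(\<integral>\<omega>\<in>B. ?Y t \<omega> \<partial>M) = (\<integral>\<omega>\<in>B. ?Y s \<omega> \<partial>M)"
        using st by simp
    qed (use Yi Ym st in auto)
  qed
  then show "martingale M history ?Y"
    unfolding martingale_def using Ym Yi by blast
qed

lemma l_bound:
  assumes \<omega>: "\<omega> \<in> space M" and n: "ennreal t \<le> T n \<omega>"
  shows "\<exists>C. \<forall>u. 0 < u \<longrightarrow> u \<le> t \<longrightarrow> 0 \<le> l u \<omega> \<and> l u \<omega> \<le> C"
proof -
  obtain C where C: "\<And>k u. u \<le> t \<Longrightarrow> 0 \<le> intensity_piece k u \<omega> \<and> intensity_piece k u \<omega> \<le> C k"
    using intensity_piece_bound[of t] \<omega> by metis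
  have "0 \<le> l u \<omega> \<and> l u \<omega> \<le> (\<Sum>k<n. C k)" if u: "0 < u" "u \<le> t" for u
  proof -
    have "ennreal u \<le> T n \<omega>" using n u by (meson ennreal_leI order_trans)
    from l_eq_sum_pieces[OF \<omega> u(1) this] show ?thesis
      using C[OF u(2)] by (simp add: sum_nonneg sum_mono)
  qed
  then show ?thesis by blast
qed

lemma l_locally_integrable:
  assumes \<omega>: "\<omega> \<in> space M" and t: "0 \<le> t" and n: "ennreal t \<le> T n \<omega>"
  shows "set_integrable lborel {0<..t} (\<lambda>u. l u \<omega>)"
proof -
  have "(\<lambda>u. indicator {0<..t} u *\<^sub>R l u \<omega>) = (\<lambda>u. \<Sum>k<n. indicator {0<..t} u *\<^sub>R intensity_piece k u \<omega>)"
  proof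
    fix u
    show "indicator {0<..t} u *\<^sub>R l u \<omega> = (\<Sum>k<n. indicator {0<..t} u *\<^sub>R intensity_piece k u \<omega>)"
    proof (cases "u \<in> {0<..t}")
      case True
      then have "ennreal u \<le> T n \<omega>" using n by (meson ennreal_leI order_trans greaterThanAtMost_iff)
      with True l_eq_sum_pieces[OF \<omega>, of u n] show ?thesis by (simp add: sum_distrib_left[symmetric])
    qed simp
  qed
  then show ?thesis
    using intensity_piece_integrable[OF \<omega> t] unfolding set_integrable_def
    by (simp only: Bochner_Integration.integrable_sum)
qed

text \<open>
  On a path with \<open>T n \<ge> v\<close> the intensity is bounded on \<open>(0, v]\<close>, since it consists of \<open>n\<close> bounded parts.
\<close>

lemma integrated_intensity_lipschitz:
  assumes \<omega>: "\<omega> \<in> space M" and v: "0 \<le> v" and n: "ennreal v \<le> T n \<omega>"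
  defines "A \<equiv> \<lambda>t. LINT u:{0<..t}|lborel. l u \<omega>"
  shows "\<exists>C. \<forall>x y. 0 \<le> x \<longrightarrow> x \<le> y \<longrightarrow> y \<le> v \<longrightarrow> 0 \<le> A y - A x \<and> A y - A x \<le> C * (y - x)"
proof -
  obtain C where C: "\<And>u. 0 < u \<Longrightarrow> u \<le> v \<Longrightarrow> 0 \<le> l u \<omega> \<and> l u \<omega> \<le> C"
    using l_bound[OF \<omega> n] by blast
  let ?g = "\<lambda>u. indicator {0<..v} u * l u \<omega>"
  have A: "A x = (LINT s:{0..x}|lborel. ?g s)" if "x \<le> v" for x
    unfolding A_def set_lebesgue_integral_def
    using that by (intro Bochner_Integration.integral_cong) (auto simp: indicator_def)
  have "?g \<in> borel_measurable borel" by (rule predictable_section[OF l_predictable v \<omega>])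
  moreover have "0 \<le> ?g s" for s using C[of s] by (auto simp: indicator_def)
  moreover have "?g s \<le> max C 0" for s using C[of s] by (auto simp: indicator_def)
  ultimately have "\<And>x y. 0 \<le> x \<Longrightarrow> x \<le> y \<Longrightarrow> y \<le> v \<Longrightarrow> 0 \<le> A y - A x \<and> A y - A x \<le> max C 0 * (y - x)"
    using exp_cumulative_hazard(1)[of ?g v "max C 0"] v by (simp only: A)
  then show ?thesis by blast
qed

lemma compensator_count:
  "compensator M history (\<lambda>t \<omega>. measure (N \<omega>) {0<..t}) (\<lambda>t \<omega>. LINT u:{0<..t}|lborel. l u \<omega>)"
  unfolding compensator_def
proof (intro conjI integral_predictable l_predictable compensated_local_martingale)
  show "AE \<omega> in M. (LINT u:{0<..0}|lborel. l u \<omega>) = 0 \<and>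
      mono_on {0..} (\<lambda>t. LINT u:{0<..t}|lborel. l u \<omega>) \<and>
      (\<forall>t\<ge>0. continuous (at_right t) (\<lambda>t. LINT u:{0<..t}|lborel. l u \<omega>))"
    using non_explosion AE_space
  proof eventually_elim
    fix \<omega> assume ex: "\<forall>t. \<exists>k. ennreal t < T k \<omega>" and \<omega>: "\<omega> \<in> space M"
    define A where "A t = (LINT u:{0<..t}|lborel. l u \<omega>)" for t
    have lip: "\<exists>C. \<forall>x y. 0 \<le> x \<longrightarrow> x \<le> y \<longrightarrow> y \<le> v \<longrightarrow> 0 \<le> A y - A x \<and> A y - A x \<le> C * (y - x)"
      if "0 \<le> v" for v
    proof -
      obtain k where "ennreal v < T k \<omega>" using ex by blast
      then show ?thesis
        unfolding A_def using integrated_intensity_lipschitz[OF \<omega> that, of k] by simp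
    qed
    have "A 0 = 0" by (simp add: A_def set_lebesgue_integral_def)
    moreover have "mono_on {0..} A"
    proof (rule mono_onI)
      fix x y :: real assume "x \<in> {0..}" "x \<le> y"
      then show "A x \<le> A y" using lip[of y] by fastforce
    qed
    moreover have "continuous (at_right t) A" if t: "0 \<le> t" for t
    proof -
      obtain C where C: "\<And>x y. 0 \<le> x \<Longrightarrow> x \<le> y \<Longrightarrow> y \<le> t + 1 \<Longrightarrow> 0 \<le> A y - A x \<and> A y - A x \<le> C * (y - x)"
        using lip[of "t + 1"] t by fastforce
      have "((\<lambda>u. A u - A t) \<longlongrightarrow> 0) (at_right t)"
      proof (rule Lim_null_comparison)
        show "\<forall>\<^sub>F u in at_right t. norm (A u - A t) \<le> C * (u - t)"
          unfolding eventually_at_right_field using C[OF t] by (intro exI[of _ "t + 1"]) auto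
        show "((\<lambda>u. C * (u - t)) \<longlongrightarrow> 0) (at_right t)"
          by (auto intro!: tendsto_eq_intros)
      qed
      then show ?thesis by (simp add: continuous_within LIM_zero_iff)
    qed
    ultimately show "(LINT u:{0<..0}|lborel. l u \<omega>) = 0 \<and>
      mono_on {0..} (\<lambda>t. LINT u:{0<..t}|lborel. l u \<omega>) \<and>
      (\<forall>t\<ge>0. continuous (at_right t) (\<lambda>t. LINT u:{0<..t}|lborel. l u \<omega>))"
      unfolding A_def by blast
  qed
qed

lemma l_integrable_AE: "AE \<omega> in M. \<forall>t\<ge>0. set_integrable lborel {0<..t} (\<lambda>u. l u \<omega>)"
  using non_explosion AE_space
  by eventually_elim (metis l_locally_integrable less_imp_le)

end

lemma N_simple: "AE \<omega> in M. simple_point_configuration {0<..} (N \<omega>)"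
  using non_explosion AE_space
proof eventually_elim
  fix \<omega> assume ex: "\<forall>t. \<exists>k. ennreal t < T k \<omega>" and \<omega>: "\<omega> \<in> space M"
  let ?K = "{k. T (Suc k) \<omega> < \<infinity>}" and ?f = "\<lambda>k. \<tau> (Suc k) \<omega>"
  have em: "emeasure (N \<omega>) A = emeasure (count_space ?K) (?f -` A \<inter> ?K)" if "A \<in> sets borel" for A
    unfolding N_distr[OF \<omega>] using that by (subst emeasure_distr) auto
  have "emeasure (N \<omega>) A \<in> range ennreal_of_enat" if "A \<in> sets borel" for A
  proof (cases "finite (?f -` A \<inter> ?K)")
    case True
    then have "emeasure (N \<omega>) A = ennreal_of_enat (enat (card (?f -` A \<inter> ?K)))"
      unfolding em[OF that] by simp
    then show ?thesis by blast
  next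
    case False
    then have "emeasure (N \<omega>) A = ennreal_of_enat \<infinity>"
      unfolding em[OF that] by simp
    then show ?thesis by blast
  qed
  moreover have "emeasure (N \<omega>) (- {0<..}) = 0"
  proof -
    have "0 < ?f k" if "T (Suc k) \<omega> < \<infinity>" for k
      using T_pos[OF \<omega>, of k] that by (simp add: enn2real_positive_iff)
    then have "?f -` (- {0<..}) \<inter> ?K = {}" by fastforce
    then show ?thesis by (subst em) simp_all
  qed
  moreover have "emeasure (N \<omega>) K < \<infinity>" if cK: "compact K" for K
  proof -
    have K: "K \<in> sets borel" using compact_imp_closed[OF cK] by simp
    obtain b where b: "\<And>x. x \<in> K \<Longrightarrow> x \<le> b"
      using compact_imp_bounded[OF cK] unfolding bounded_real by (meson abs_le_D1)
    obtain n where n: "ennreal b < T n \<omega>" using ex by blast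
    have "\<not> (T (Suc k) \<omega> < \<infinity> \<and> ?f k \<in> K)" if "n \<le> k" for k
    proof
      assume *: "T (Suc k) \<omega> < \<infinity> \<and> ?f k \<in> K"
      then have "ennreal (?f k) \<le> ennreal b" using b by (intro ennreal_leI) auto
      moreover have "T n \<omega> \<le> T (Suc k) \<omega>" using that by (intro T_mono[OF \<omega>]) simp
      ultimately show False using n * by simp
    qed
    then have "emeasure (N \<omega>) K = (\<Sum>k<n. if T (Suc k) \<omega> < \<infinity> \<and> ?f k \<in> K then 1 else 0)"
      unfolding emeasure_N[OF \<omega> K] by (intro suminf_finite) (auto simp: not_less)
    also have "\<dots> < \<infinity>" by (simp add: less_top)
    finally show ?thesis .
  qed
  moreover have "emeasure (N \<omega>) {t} \<le> 1" for t
  proof -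
    have "card (?f -` {t} \<inter> ?K) \<le> 1 \<and> finite (?f -` {t} \<inter> ?K)"
    proof (cases "?f -` {t} \<inter> ?K = {}")
      case False
      then obtain j where j: "j \<in> ?f -` {t} \<inter> ?K" by blast
      have "?f -` {t} \<inter> ?K = {j}"
        using j \<tau>_inj[OF \<omega>] by (auto dest: inj_onD)
      then show ?thesis by simp
    qed simp
    then show ?thesis by (subst em) simp_all
  qed
  ultimately show "simple_point_configuration {0<..} (N \<omega>)"
    unfolding simple_point_configuration_def point_configuration_def using sets_N[OF \<omega>] by blast
qed

section \<open>The intensity as a functional of the point process\<close>

text \<open>
  The sum over the index of the jumps, instead of over their positions, shows that the integral
  depends measurably on \<open>u\<close> and \<open>\<omega>\<close>, also on paths with infinitely many jumps before \<open>u\<close>.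
\<close>

lemma integral_N_before:
  fixes g :: "real \<Rightarrow> real"
  assumes \<omega>: "\<omega> \<in> space M" and g[measurable]: "g \<in> borel_measurable borel" and u: "0 < u"
  shows "(LINT s:{0<..<u}|N \<omega>. g s)
    = (LINT j|count_space UNIV. (if T (Suc j) \<omega> < ennreal u then g (\<tau> (Suc j) \<omega>) else 0))"
proof -
  let ?K = "{k. T (Suc k) \<omega> < \<infinity>}"
  have "(LINT s:{0<..<u}|N \<omega>. g s)
      = (LINT j|count_space ?K. indicator {0<..<u} (\<tau> (Suc j) \<omega>) *\<^sub>R g (\<tau> (Suc j) \<omega>))"
    unfolding set_lebesgue_integral_def N_distr[OF \<omega>] by (subst Bochner_Integration.integral_distr) simp_all
  also have "\<dots> = (LINT j|restrict_space (count_space UNIV) ?K.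
      indicator {0<..<u} (\<tau> (Suc j) \<omega>) *\<^sub>R g (\<tau> (Suc j) \<omega>))"
    by (simp add: restrict_count_space)
  also have "\<dots> = (LINT j|count_space UNIV.
      indicator ?K j *\<^sub>R (indicator {0<..<u} (\<tau> (Suc j) \<omega>) *\<^sub>R g (\<tau> (Suc j) \<omega>)))"
    by (rule integral_restrict_space) simp
  also have "\<dots> = (LINT j|count_space UNIV. (if T (Suc j) \<omega> < ennreal u then g (\<tau> (Suc j) \<omega>) else 0))"
  proof (rule Bochner_Integration.integral_cong[OF refl])
    fix j
    have restrict: "indicator A x *\<^sub>R (indicator B y *\<^sub>R z) = (if x \<in> A \<and> y \<in> B then z else 0)"
      for A and x :: nat and B and y z :: real
      by (auto simp: indicator_def)
    have iff: "T (Suc j) \<omega> < ennreal u \<longleftrightarrow> j \<in> ?K \<and> \<tau> (Suc j) \<omega> \<in> {0<..<u}"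
      using T_pos[OF \<omega>, of j] u
      by (cases "T (Suc j) \<omega>" rule: ennreal_cases) (auto simp: ennreal_less_iff)
    show "indicator ?K j *\<^sub>R (indicator {0<..<u} (\<tau> (Suc j) \<omega>) *\<^sub>R g (\<tau> (Suc j) \<omega>))
        = (if T (Suc j) \<omega> < ennreal u then g (\<tau> (Suc j) \<omega>) else 0)"
      unfolding iff by (rule restrict)
  qed
  finally show ?thesis .
qed

lemma integral_N_before_finite:
  fixes g :: "real \<Rightarrow> real"
  assumes \<omega>: "\<omega> \<in> space M" and g: "g \<in> borel_measurable borel"
    and k: "T k \<omega> < ennreal u" "ennreal u \<le> T (Suc k) \<omega>"
  shows "(LINT s:{0<..<u}|N \<omega>. g s) = (\<Sum>m=1..k. g (\<tau> m \<omega>))"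
proof -
  have u: "0 < u" using k(1) by (metis ennreal_neg linorder_not_le not_less_zero)
  have iff: "T (Suc j) \<omega> < ennreal u \<longleftrightarrow> j < k" for j
    using T_mono[OF \<omega>, of "Suc j" k] T_mono[OF \<omega>, of "Suc k" "Suc j"] k
    by (cases "j < k") (auto intro: le_less_trans dest: order_trans)
  have "(LINT s:{0<..<u}|N \<omega>. g s) = (LINT j|count_space UNIV. (if j < k then g (\<tau> (Suc j) \<omega>) else 0))"
    unfolding integral_N_before[OF \<omega> g u] iff ..
  also have "\<dots> = (\<Sum>j<k. g (\<tau> (Suc j) \<omega>))"
    by (subst lebesgue_integral_count_space_finite_support)
      (auto intro: finite_subset[of _ "{..<k}"] intro!: sum.mono_neutral_cong_left)
  also have "\<dots> = (\<Sum>m=1..k. g (\<tau> m \<omega>))"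
    by (rule sum.reindex_bij_witness[of _ "\<lambda>m. m - 1" Suc]) auto
  finally show ?thesis .
qed

text \<open>
  It suffices that the hazard rate after \<open>k\<close> jumps is the Hawkes intensity computed from the first \<open>k\<close>
  times, because strictly before any \<open>u \<in> (T k, T (k + 1)]\<close> there are no further jumps.
\<close>

lemma hawkes_process_if_rate:
  assumes f: "\<And>x. 0 \<le> f x" "f \<in> borel_measurable borel"
    and h[measurable]: "h \<in> borel_measurable borel"
    and b: "(\<lambda>u. LINT s:{..0}|\<eta>. h (u - s)) \<in> borel_measurable borel"
    and rate: "\<And>k u \<omega>. \<omega> \<in> space M \<Longrightarrow> T k \<omega> < ennreal u \<Longrightarrow>
      \<rho> k u \<omega> = f ((LINT s:{..0}|\<eta>. h (u - s)) + (\<Sum>m=1..k. h (u - \<tau> m \<omega>)))"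
  shows "hawkes_process M f h \<eta> N"
proof -
  let ?l = "hawkes_intensity f h \<eta> N"
  have l_eq_rate: "?l u \<omega> = \<rho> k u \<omega>"
    if "\<omega> \<in> space M" "T k \<omega> < ennreal u" "ennreal u \<le> T (Suc k) \<omega>" for k u \<omega>
  proof -
    have "(LINT s:{0<..<u}|N \<omega>. h (u - s)) = (\<Sum>m=1..k. h (u - \<tau> m \<omega>))"
      by (rule integral_N_before_finite[OF that(1) _ that(2,3)]) measurable
    with rate[OF that(1,2)] show ?thesis by (simp add: hawkes_intensity_def)
  qed
  have l_predictable: "predictable M history ?l"
  proof -
    let ?F = "\<lambda>j w. case w of (u, \<omega>) \<Rightarrow> if T (Suc j) \<omega> < ennreal u then \<tau> (Suc j) \<omega> else - 1"
    let ?t = "\<lambda>w j. if 0 \<le> ?F j w then h (fst w - ?F j w) else 0"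
    note [measurable] = last_time_predictable[of "Suc _"] time_predictable
    have term_eq: "?t (u, \<omega>) j = (if T (Suc j) \<omega> < ennreal u then h (u - \<tau> (Suc j) \<omega>) else 0)" for u \<omega> j
      by simp
    have "(\<lambda>(w, j). ?t w j) \<in> borel_measurable (predictable_algebra \<Otimes>\<^sub>M count_space UNIV)"
      unfolding case_prod_beta'[where f = ?t]
    proof (rule measurable_compose_countable[where f = "\<lambda>j z. ?t (fst z) j" and g = snd])
      fix j
      have "(\<lambda>w. ?t w j) \<in> borel_measurable predictable_algebra" by measurable
      from measurable_compose[OF measurable_fst this]
      show "(\<lambda>z. ?t (fst z) j) \<in> borel_measurable (predictable_algebra \<Otimes>\<^sub>M count_space UNIV)" .
    qed simp
    from sigma_finite_measure.borel_measurable_lebesgue_integral[OF sigma_finite_measure_count_space this]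
    have "(\<lambda>w. LINT j|count_space UNIV. ?t w j) \<in> borel_measurable predictable_algebra" by simp
    then have "(\<lambda>w. f ((LINT s:{..0}|\<eta>. h (fst w - s)) + (LINT j|count_space UNIV. ?t w j))) \<in> borel_measurable predictable_algebra"
      using measurable_compose[OF time_predictable b]
      by (intro measurable_compose[OF _ f(2)] borel_measurable_add)
    then show ?thesis
      unfolding predictable_def
    proof (rule measurable_cong[THEN iffD1, rotated])
      fix w assume "w \<in> space predictable_algebra"
      then obtain u \<omega> where w: "w = (u, \<omega>)" "0 < u" "\<omega> \<in> space M" by auto
      have "(LINT s:{0<..<u}|N \<omega>. h (u - s)) = (LINT j|count_space UNIV. ?t w j)"
        unfolding w(1) term_eq by (rule integral_N_before[OF w(3) _ w(2)]) measurable
      then show "f ((LINT s:{..0}|\<eta>. h (fst w - s)) + (LINT j|count_space UNIV. ?t w j))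
          = (case w of (u, \<omega>) \<Rightarrow> ?l u \<omega>)"
        by (simp add: w(1) hawkes_intensity_def)
    qed
  qed
  show ?thesis
    unfolding hawkes_process_def Let_def
    using prob_space_axioms sets_N N_measurable N_simple f(1) l_predictable
      l_integrable_AE[OF l_predictable l_eq_rate] compensator_count[OF l_predictable l_eq_rate]
    by (auto simp: hawkes_intensity_def)
qed

end

section \<open>The piecewise deterministic Markov process\<close>

lemma memory_measurable: "memory L \<alpha> n x \<in> borel_measurable borel"
  unfolding memory_def[abs_def] by measurable

lemma continuous_on_memory: "continuous_on A (memory L \<alpha> n x)"
  unfolding memory_def[abs_def] by (intro continuous_intros)

lemma erlang_kernel_fun: "erlang_kernel L c \<alpha> n = (\<lambda>t. \<Sum>i=1..L. c i * decay (\<alpha> i) (n i) t)"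
  by (simp add: erlang_kernel_decay fun_eq_iff)

lemma continuous_on_erlang_kernel: "continuous_on A (erlang_kernel L c \<alpha> n)"
  unfolding erlang_kernel_fun by (intro continuous_intros)

lemma erlang_kernel_measurable: "erlang_kernel L c \<alpha> n \<in> borel_measurable borel"
  by (intro borel_measurable_continuous_onI continuous_on_erlang_kernel)

text \<open>
  Both growth conditions on \<open>f\<close> enter the argument through this affine bound.
\<close>

lemma linear_growth:
  fixes f :: "real \<Rightarrow> real"
  assumes "bounded (range f) \<or> (\<exists>C. C-lipschitz_on UNIV f)"
  shows "\<exists>a\<ge>0. \<exists>b\<ge>0. \<forall>x. f x \<le> a + b * \<bar>x\<bar>"
  using assms
proof
  assume "bounded (range f)"
  then obtain B where "\<And>x. \<bar>f x\<bar> \<le> B" unfolding bounded_real by auto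
  then show ?thesis
    by (intro exI[of _ "\<bar>B\<bar>"] exI[of _ 0] conjI) (auto intro: order_trans[OF abs_ge_self] order_trans)
next
  assume "\<exists>C. C-lipschitz_on UNIV f"
  then obtain C where C: "C-lipschitz_on UNIV f" by blast
  have "f x \<le> \<bar>f 0\<bar> + C * \<bar>x\<bar>" for x
    using lipschitz_onD[OF C, of x 0] by (simp add: dist_real_def)
  then show ?thesis
    using lipschitz_on_nonneg[OF C] by (intro exI[of _ "\<bar>f 0\<bar>"] exI[of _ C] conjI) auto
qed

lemma continuous_bound_on_interval:
  fixes g :: "real \<Rightarrow> real"
  assumes "continuous_on UNIV g"
  shows "\<exists>B\<ge>0. \<forall>u. 0 \<le> u \<longrightarrow> u \<le> t \<longrightarrow> \<bar>g u\<bar> \<le> B"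
proof -
  have "compact (g ` {0..t})"
    using assms by (intro compact_continuous_image continuous_on_subset[OF assms]) auto
  from compact_imp_bounded[OF this] obtain B where B: "\<forall>x\<in>g ` {0..t}. \<bar>x\<bar> \<le> B"
    unfolding bounded_real by blast
  have "\<bar>g u\<bar> \<le> \<bar>B\<bar>" if "0 \<le> u" "u \<le> t" for u
  proof -
    have "g u \<in> g ` {0..t}" using that by simp
    with B have "\<bar>g u\<bar> \<le> B" by blast
    then show ?thesis by linarith
  qed
  then show ?thesis
    by (intro exI[of _ "\<bar>B\<bar>"]) simp
qed

locale erlang_pdmp =
  pdmp M "erlang_space L n" "erlang_field L \<alpha> n" "\<lambda>x. f (\<Sum>i=1..L. x (i, 0))" "erlang_jump L c n" x0 \<phi> T X
  for M :: "'w measure" and f :: "real \<Rightarrow> real" and L :: nat and c \<alpha> :: "nat \<Rightarrow> real" and n :: "nat \<Rightarrow> nat"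
    and x0 :: "nat \<times> nat \<Rightarrow> real" and \<phi> T X +
  assumes f_nonneg: "\<And>u. 0 \<le> f u"
    and f_measurable: "f \<in> borel_measurable borel"
    and f_growth: "bounded (range f) \<or> (\<exists>C. C-lipschitz_on UNIV f)"
begin

abbreviation state_path :: "'w \<Rightarrow> nat \<Rightarrow> real \<Rightarrow> nat \<times> nat \<Rightarrow> real" where
  "state_path \<omega> \<equiv> erlang_path L c \<alpha> n x0 (\<lambda>m. enn2real (T m \<omega>))"

text \<open>
  The jump rate at time \<open>u\<close> along the continuation of the state after \<open>k\<close> jumps, as a function of the
  jump times only.
\<close>

definition rate :: "nat \<Rightarrow> real \<Rightarrow> 'w \<Rightarrow> real" where
  "rate k u \<omega> = f (memory L \<alpha> n x0 u + (\<Sum>m=1..k. erlang_kernel L c \<alpha> n (u - enn2real (T m \<omega>))))"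

lemma rate_eq_path: "rate k u \<omega> = f (\<Sum>i=1..L. state_path \<omega> k u (i, 0))"
  unfolding rate_def sum_erlang_path ..

lemma flow_eq_path:
  assumes x: "x \<in> erlang_space L n" and eq: "x = state_path \<omega> k s" and v: "0 \<le> v"
  shows "\<phi> v x = state_path \<omega> k (s + v)"
proof (rule erlang_field_unique[where y = "\<lambda>v. \<phi> v x" and z = "\<lambda>v. state_path \<omega> k (s + v)", OF _ _ _ v])
  show "\<phi> 0 x = state_path \<omega> k (s + 0)" using flow x eq by (simp add: flow_on_def)
  show "((\<lambda>u. \<phi> u x p) has_real_derivative erlang_field L \<alpha> n (\<phi> t x) p) (at t within {0..})"
    if "0 \<le> t" for t p
    using flow x that unfolding flow_on_def by blast
qed (rule erlang_path_derivative)

lemma flow_in: "x \<in> erlang_space L n \<Longrightarrow> 0 \<le> v \<Longrightarrow> \<phi> v x \<in> erlang_space L n"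
  using flow unfolding flow_on_def by blast

lemma state_after_jump:
  assumes \<omega>: "\<omega> \<in> space M"
  shows "T k \<omega> < \<infinity> \<Longrightarrow> X (enn2real (T k \<omega>)) \<omega> = state_path \<omega> k (enn2real (T k \<omega>)) \<and>
    X (enn2real (T k \<omega>)) \<omega> \<in> erlang_space L n"
proof (induction k)
  case 0
  show ?case using X_0[OF \<omega>] T_0[OF \<omega>] start_in erlang_path_0[OF start_in] by simp
next
  case (Suc k)
  let ?s = "enn2real (T k \<omega>)" and ?s' = "enn2real (T (Suc k) \<omega>)"
  have fin: "T k \<omega> < \<infinity>" using T_top[OF \<omega>, of k] Suc.prems
    by (metis infinity_ennreal_def less_irrefl top.not_eq_extremum)
  note IH = Suc.IH[OF fin]
  have le: "0 \<le> ?s' - ?s"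
    using T_Suc[OF \<omega> fin] Suc.prems by (simp add: enn2real_mono)
  have flow: "\<phi> (?s' - ?s) (X ?s \<omega>) = state_path \<omega> k ?s'"
    using flow_eq_path[OF conjunct2[OF IH] conjunct1[OF IH] le] by simp
  have X: "X ?s' \<omega> = (\<lambda>p. state_path \<omega> k ?s' p + erlang_jump L c n p)"
    using X_jump[OF \<omega> Suc.prems] unfolding flow by (simp add: fun_eq_iff)
  have "state_path \<omega> k ?s' \<in> erlang_space L n"
    unfolding flow[symmetric] using IH le by (intro flow_in) auto
  from shift_in[OF this] show ?case
    unfolding X using erlang_path_jump[of L c \<alpha> n x0 "\<lambda>m. enn2real (T m \<omega>)" k] by (auto simp: fun_eq_iff)
qed

lemma flow_after_jump:
  assumes \<omega>: "\<omega> \<in> space M" and fin: "T k \<omega> < \<infinity>" and v: "0 \<le> v"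
  shows "\<phi> v (X (enn2real (T k \<omega>)) \<omega>) = state_path \<omega> k (enn2real (T k \<omega>) + v)"
  using state_after_jump[OF \<omega> fin] v by (intro flow_eq_path) auto

text \<open>
  On \<open>[0, t]\<close> the kernel and the memory are bounded, so after \<open>k\<close> jumps the argument of \<open>f\<close> is at most affine in
  \<open>k\<close>, and by linear growth so is the rate. The conditional law of the waiting times is that of the
  Markov process, expressed through the closed form of the flow.
\<close>

sublocale hazard_times M T rate
proof
  fix k
  show "T k \<in> borel_measurable M" by (rule T_measurable)
  show "T 0 \<omega> = 0" if "\<omega> \<in> space M" for \<omega> using that by (rule T_0)
  show "T k \<omega> < T (Suc k) \<omega>" if "\<omega> \<in> space M" "T k \<omega> < \<infinity>" for \<omega> using that by (rule T_Suc)
  show "T (Suc k) \<omega> = \<infinity>" if "\<omega> \<in> space M" "T k \<omega> = \<infinity>" for \<omega> using that by (rule T_top)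
  show "0 \<le> rate k u \<omega>" for u \<omega> by (simp add: rate_def f_nonneg)
  show "(\<lambda>(\<omega>, u). rate k u \<omega>) \<in> borel_measurable (past M T k \<Otimes>\<^sub>M borel)"
  proof -
    note [measurable] = f_measurable memory_measurable erlang_kernel_measurable
    have "(\<lambda>z. \<Sum>m=1..k. erlang_kernel L c \<alpha> n (snd z - enn2real (T m (fst z))))
        \<in> borel_measurable (past M T k \<Otimes>\<^sub>M borel)"
    proof (rule borel_measurable_sum)
      fix m assume "m \<in> {1..k}"
      then have [measurable]: "T m \<in> borel_measurable (past M T k)" by (intro past_time_measurable) simp
      show "(\<lambda>z. erlang_kernel L c \<alpha> n (snd z - enn2real (T m (fst z))))
          \<in> borel_measurable (past M T k \<Otimes>\<^sub>M borel)" by measurable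
    qed
    then show ?thesis unfolding rate_def case_prod_beta' by measurable
  qed
next
  fix t
  obtain a b where ab: "a \<ge> 0" "b \<ge> 0" "\<And>x. f x \<le> a + b * \<bar>x\<bar>"
    using linear_growth[OF f_growth] by blast
  obtain K where K: "K \<ge> 0" "\<And>u. 0 \<le> u \<Longrightarrow> u \<le> t \<Longrightarrow> \<bar>memory L \<alpha> n x0 u\<bar> \<le> K"
    using continuous_bound_on_interval[OF continuous_on_memory] by blast
  obtain H where H: "H \<ge> 0" "\<And>u. 0 \<le> u \<Longrightarrow> u \<le> t \<Longrightarrow> \<bar>erlang_kernel L c \<alpha> n u\<bar> \<le> H"
    using continuous_bound_on_interval[OF continuous_on_erlang_kernel] by blast
  have "rate k u \<omega> \<le> (a + b * K + 1) + (b * H) * real k"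
    if \<omega>: "\<omega> \<in> space M" and u: "0 \<le> u" "u \<le> t" and T: "T k \<omega> \<le> ennreal u" for k u \<omega>
  proof -
    have mono: "incseq (\<lambda>k. T k \<omega>)"
    proof (rule incseq_SucI)
      fix k show "T k \<omega> \<le> T (Suc k) \<omega>"
        using T_Suc[OF \<omega>, of k] T_top[OF \<omega>, of k] by (cases "T k \<omega> = \<infinity>") (auto simp: less_top)
    qed
    have "\<bar>erlang_kernel L c \<alpha> n (u - enn2real (T m \<omega>))\<bar> \<le> H" if "m \<in> {1..k}" for m
    proof (rule H(2))
      have "T m \<omega> \<le> ennreal u" using incseqD[OF mono, of m k] that T by (auto intro: order_trans)
      then have "enn2real (T m \<omega>) \<le> u" using u(1) by (rule enn2real_leI[rotated])
      then show "0 \<le> u - enn2real (T m \<omega>)" by simp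
      show "u - enn2real (T m \<omega>) \<le> t" using u(2) enn2real_nonneg[of "T m \<omega>"] by linarith
    qed
    then have "(\<Sum>m=1..k. \<bar>erlang_kernel L c \<alpha> n (u - enn2real (T m \<omega>))\<bar>) \<le> real k * H"
      using sum_bounded_above[of "{1..k}" "\<lambda>m. \<bar>erlang_kernel L c \<alpha> n (u - enn2real (T m \<omega>))\<bar>" H] by simp
    then have "\<bar>memory L \<alpha> n x0 u + (\<Sum>m=1..k. erlang_kernel L c \<alpha> n (u - enn2real (T m \<omega>)))\<bar> \<le> K + real k * H"
      using K(2)[OF u] sum_abs[of "\<lambda>m. erlang_kernel L c \<alpha> n (u - enn2real (T m \<omega>))" "{1..k}"] by linarith
    then have "b * \<bar>memory L \<alpha> n x0 u + (\<Sum>m=1..k. erlang_kernel L c \<alpha> n (u - enn2real (T m \<omega>)))\<bar> \<le> b * (K + real k * H)"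
      using ab(2) by (intro mult_left_mono)
    with ab(3)[of "memory L \<alpha> n x0 u + (\<Sum>m=1..k. erlang_kernel L c \<alpha> n (u - enn2real (T m \<omega>)))"]
    show ?thesis unfolding rate_def by (simp add: algebra_simps)
  qed
  moreover have "a + b * K + 1 > 0" "b * H \<ge> 0" using ab K(1) H(1) by (simp_all add: add_nonneg_pos)
  ultimately show "\<exists>a>0. \<exists>b\<ge>0. \<forall>k u. \<forall>\<omega>\<in>space M.
      0 \<le> u \<longrightarrow> u \<le> t \<longrightarrow> T k \<omega> \<le> ennreal u \<longrightarrow> rate k u \<omega> \<le> a + b * real k"
    by blast
next
  fix k and v :: real assume v: "0 \<le> v"
  show "AE \<omega> in M. T k \<omega> < \<infinity> \<longrightarrow>
      real_cond_exp M (past M T k)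
        (indicator {\<omega>' \<in> space M. T k \<omega>' + ennreal v < T (Suc k) \<omega>'}) \<omega>
      = exp (- (LINT s:{0..v}|lborel. rate k (enn2real (T k \<omega>) + s) \<omega>))"
    using jump_rate[OF v, of k] AE_space
  proof eventually_elim
    fix \<omega> assume \<omega>: "\<omega> \<in> space M" and
      *: "T k \<omega> < \<infinity> \<longrightarrow>
      real_cond_exp M
        (sigma (space M) {T j -` B \<inter> space M | j B. j \<le> k \<and> B \<in> sets borel})
        (indicator {\<omega>' \<in> space M. T k \<omega>' + ennreal v < T (Suc k) \<omega>'}) \<omega>
      = exp (- (LINT s:{0..v}|lborel. f (\<Sum>i=1..L. \<phi> s (X (enn2real (T k \<omega>)) \<omega>) (i, 0))))"
    have "(LINT s:{0..v}|lborel. f (\<Sum>i=1..L. \<phi> s (X (enn2real (T k \<omega>)) \<omega>) (i, 0)))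
        = (LINT s:{0..v}|lborel. rate k (enn2real (T k \<omega>) + s) \<omega>)" if "T k \<omega> < \<infinity>"
      unfolding set_lebesgue_integral_def
    proof (rule Bochner_Integration.integral_cong[OF refl])
      fix s
      show "indicator {0..v} s *\<^sub>R f (\<Sum>i=1..L. \<phi> s (X (enn2real (T k \<omega>)) \<omega>) (i, 0))
          = indicator {0..v} s *\<^sub>R rate k (enn2real (T k \<omega>) + s) \<omega>"
      proof (cases "s \<in> {0..v}")
        case True
        then have "\<phi> s (X (enn2real (T k \<omega>)) \<omega>) = state_path \<omega> k (enn2real (T k \<omega>) + s)"
          by (intro flow_after_jump[OF \<omega> that]) simp
        then show ?thesis by (simp only: rate_eq_path)
      qed simp
    qed
    with * show "T k \<omega> < \<infinity> \<longrightarrow>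
      real_cond_exp M (past M T k)
        (indicator {\<omega>' \<in> space M. T k \<omega>' + ennreal v < T (Suc k) \<omega>'}) \<omega>
      = exp (- (LINT s:{0..v}|lborel. rate k (enn2real (T k \<omega>) + s) \<omega>))"
      unfolding past_def by metis
  qed
qed

lemma X_eq_path:
  assumes \<omega>: "\<omega> \<in> space M" and t: "0 \<le> t" "T k \<omega> \<le> ennreal t" "ennreal t < T (Suc k) \<omega>"
  shows "X t \<omega> = state_path \<omega> k t"
proof -
  have fin: "T k \<omega> < \<infinity>" using t(2) by (auto intro: le_less_trans)
  then have "0 \<le> t - enn2real (T k \<omega>)"
    using le_ennreal_iff_enn2real_le[OF fin t(1)] t(2) by simp
  from flow_after_jump[OF \<omega> fin this] X_flow[OF \<omega> t] show ?thesis by simp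
qed

lemma left_limit:
  assumes \<omega>: "\<omega> \<in> space M" and s: "0 < s" and k: "T k \<omega> < ennreal s" "ennreal s \<le> T (Suc k) \<omega>"
  shows "Lim (at_left s) (\<lambda>u. X u \<omega> p) = state_path \<omega> k s p"
proof (rule tendsto_Lim)
  have fin: "T k \<omega> < \<infinity>" using k(1) by (auto intro: less_trans)
  have "((\<lambda>v. state_path \<omega> k (0 + v) p) has_real_derivative erlang_field L \<alpha> n (state_path \<omega> k (0 + s)) p) (at s)"
    by (rule erlang_path_derivative)
  then have "isCont (\<lambda>u. state_path \<omega> k u p) s" by (auto dest: DERIV_isCont)
  then have lim: "((\<lambda>u. state_path \<omega> k u p) \<longlongrightarrow> state_path \<omega> k s p) (at_left s)"
    by (auto simp: isCont_def intro: tendsto_mono[OF at_le])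
  have "enn2real (T k \<omega>) < s"
    using k(1) s fin by (cases "T k \<omega>" rule: ennreal_cases) (auto simp: ennreal_less_iff)
  then have "\<forall>\<^sub>F u in at_left s. state_path \<omega> k u p = X u \<omega> p"
    unfolding eventually_at_left_field
  proof (intro exI[of _ "enn2real (T k \<omega>)"] conjI allI impI)
    fix u assume u: "enn2real (T k \<omega>) < u" "u < s"
    then have u0: "0 \<le> u" using enn2real_nonneg[of "T k \<omega>"] by linarith
    have "T k \<omega> \<le> ennreal u" using le_ennreal_iff_enn2real_le[OF fin u0] less_imp_le[OF u(1)] by blast
    moreover have "ennreal u < ennreal s" using u(2) u0 by (simp add: ennreal_less_iff)
    then have "ennreal u < T (Suc k) \<omega>" using k(2) by (rule less_le_trans)
    ultimately show "state_path \<omega> k u p = X u \<omega> p" using X_eq_path[OF \<omega> u0] by simp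
  qed
  with lim show "((\<lambda>u. X u \<omega> p) \<longlongrightarrow> state_path \<omega> k s p) (at_left s)"
    by (rule Lim_transform_eventually)
qed simp

text \<open>
  The path is continuous between the times \<open>T k\<close> and jumps by \<open>erlang_jump\<close> at each finite \<open>T (Suc k)\<close>. If all \<open>c i\<close>
  vanished, these jumps would be invisible in the state.
\<close>

lemma jump_process_eq:
  assumes \<omega>: "\<omega> \<in> space M" and c: "\<exists>i\<in>{1..L}. c i \<noteq> 0"
  shows "jump_process T X \<omega> = counting_measure {enn2real (T (Suc k) \<omega>) | k. T (Suc k) \<omega> < \<infinity>}"
proof -
  obtain i where i: "i \<in> {1..L}" "c i \<noteq> 0" using c by blast
  then have "erlang_jump L c n (i, n i) \<noteq> 0" by (simp add: erlang_jump_eq erlang_index_def)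
  then have jump: "erlang_jump L c n \<noteq> (\<lambda>p. 0)" by (metis (full_types))
  have "{s. 0 < s \<and> ennreal s < lifetime T \<omega> \<and> jump_size X s \<omega> \<noteq> (\<lambda>p. 0)}
      = {enn2real (T (Suc k) \<omega>) | k. T (Suc k) \<omega> < \<infinity>}" (is "?J = ?T")
  proof (intro equalityI subsetI)
    fix s assume "s \<in> ?J"
    then have s: "0 < s" "ennreal s < lifetime T \<omega>" "jump_size X s \<omega> \<noteq> (\<lambda>p. 0)" by auto
    define k where "k = (LEAST k. ennreal s < T k \<omega>)"
    have "\<exists>k. ennreal s < T k \<omega>" using s(2) by (simp add: lifetime_def less_SUP_iff)
    then have k: "ennreal s < T k \<omega>" "\<And>j. j < k \<Longrightarrow> T j \<omega> \<le> ennreal s"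
      unfolding k_def by (auto intro: LeastI_ex dest: not_less_Least simp: not_less)
    then obtain j where j: "k = Suc j" using T_0[OF \<omega>] by (cases k) auto
    have le: "T j \<omega> \<le> ennreal s" using k(2)[of j] j by simp
    have Xs: "X s \<omega> = state_path \<omega> j s" using X_eq_path[OF \<omega> _ le] k(1) j s(1) by simp
    have "T j \<omega> = ennreal s"
    proof (rule ccontr)
      assume "T j \<omega> \<noteq> ennreal s"
      with le have "T j \<omega> < ennreal s" by simp
      then have "jump_size X s \<omega> = (\<lambda>p. 0)"
        using left_limit[OF \<omega> s(1), of j] k(1) j unfolding jump_size_def Xs by (auto simp: fun_eq_iff)
      with s(3) show False by simp
    qed
    moreover from this obtain m where "j = Suc m" using T_0[OF \<omega>] s(1) by (cases j) auto
    ultimately show "s \<in> ?T" using s(1) by (auto intro!: exI[of _ m])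
  next
    fix s assume "s \<in> ?T"
    then obtain k where k: "s = enn2real (T (Suc k) \<omega>)" "T (Suc k) \<omega> < \<infinity>" by blast
    then have Ts: "T (Suc k) \<omega> = ennreal s" by simp
    have fin: "T k \<omega> < \<infinity>" using T_top[OF \<omega>, of k] k(2)
      by (metis infinity_ennreal_def less_irrefl top.not_eq_extremum)
    have lt: "T k \<omega> < ennreal s" using T_Suc[OF \<omega> fin] unfolding Ts .
    then have s0: "0 < s" by (metis ennreal_neg linorder_not_le not_less_zero)
    have "ennreal s < T (Suc (Suc k)) \<omega>" using T_Suc[OF \<omega> k(2)] unfolding Ts .
    also have "\<dots> \<le> lifetime T \<omega>" unfolding lifetime_def by (intro SUP_upper) simp
    finally have "ennreal s < lifetime T \<omega>" .
    moreover have "jump_size X s \<omega> = erlang_jump L c n"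
    proof
      fix p
      have "X s \<omega> = state_path \<omega> (Suc k) s" using state_after_jump[OF \<omega> k(2)] k(1) by simp
      moreover have "state_path \<omega> (Suc k) s p = state_path \<omega> k s p + erlang_jump L c n p"
        using erlang_path_jump[of L c \<alpha> n x0 "\<lambda>m. enn2real (T m \<omega>)" k p] k(1) by simp
      moreover have "Lim (at_left s) (\<lambda>u. X u \<omega> p) = state_path \<omega> k s p"
        by (rule left_limit[OF \<omega> s0 lt]) (simp add: Ts)
      ultimately show "jump_size X s \<omega> p = erlang_jump L c n p" by (simp add: jump_size_def)
    qed
    ultimately show "s \<in> ?J" using s0 jump by simp
  qed
  then show ?thesis by (simp add: jump_process_def)
qed

end

theorem proposition1:
  fixes f :: "real \<Rightarrow> real"
    and L :: nat and c \<alpha> :: "nat \<Rightarrow> real" and n :: "nat \<Rightarrow> nat"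
    and \<eta> :: "real measure"
    and M :: "'w measure"
    and \<phi> :: "real \<Rightarrow> (nat \<times> nat \<Rightarrow> real) \<Rightarrow> nat \<times> nat \<Rightarrow> real"
    and T :: "nat \<Rightarrow> 'w \<Rightarrow> ennreal"
    and X :: "real \<Rightarrow> 'w \<Rightarrow> nat \<times> nat \<Rightarrow> real"
  assumes f_nonneg: "\<And>u. 0 \<le> f u"
    and f_measurable: "f \<in> borel_measurable borel"
    and f_growth: "bounded (range f) \<or> (\<exists>C. C-lipschitz_on UNIV f)"
    and \<alpha>_pos: "\<And>i. i \<in> {1..L} \<Longrightarrow> 0 < \<alpha> i"
    and \<eta>_point: "point_configuration {..0} \<eta>"
    and \<eta>_kernel: "\<And>t. 0 \<le> t \<Longrightarrow> set_integrable \<eta> {..0} (\<lambda>s. erlang_kernel L c \<alpha> n (t - s))"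
    and \<eta>_init: "\<And>p. p \<in> erlang_index L n \<Longrightarrow>
      set_integrable \<eta> {..0} (erlang_init_integrand c \<alpha> n p)"
    and X_pdmp: "pdmp M (erlang_space L n) (erlang_field L \<alpha> n)
      (\<lambda>x. f (\<Sum>i=1..L. x (i, 0))) (erlang_jump L c n) (erlang_init L c \<alpha> n \<eta>) \<phi> T X"
  shows "(AE \<omega> in M. \<forall>s t. 0 \<le> s \<longrightarrow> s < t \<longrightarrow>
            finite {k. ennreal s \<le> T (Suc k) \<omega> \<and> T (Suc k) \<omega> \<le> ennreal t}) \<and>
         ((\<exists>i\<in>{1..L}. c i \<noteq> 0) \<longrightarrow>
            hawkes_process M f (erlang_kernel L c \<alpha> n) \<eta> (jump_process T X))"
proof (intro conjI impI)
  interpret pdmp M "erlang_space L n" "erlang_field L \<alpha> n" "\<lambda>x. f (\<Sum>i=1..L. x (i, 0))"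
      "erlang_jump L c n" "erlang_init L c \<alpha> n \<eta>" \<phi> T X
    by (rule X_pdmp)
  interpret erlang_pdmp M f L c \<alpha> n "erlang_init L c \<alpha> n \<eta>" \<phi> T X
    by unfold_locales (rule f_nonneg f_measurable f_growth)+
  show "AE \<omega> in M. \<forall>s t. 0 \<le> s \<longrightarrow> s < t \<longrightarrow>
      finite {k. ennreal s \<le> T (Suc k) \<omega> \<and> T (Suc k) \<omega> \<le> ennreal t}"
    using non_explosion AE_space
  proof (eventually_elim, intro allI impI)
    fix \<omega> s t assume ex: "\<forall>t. \<exists>k. ennreal t < T k \<omega>" and \<omega>: "\<omega> \<in> space M"
    obtain j where j: "ennreal t < T j \<omega>" using ex by blast
    have "{k. ennreal s \<le> T (Suc k) \<omega> \<and> T (Suc k) \<omega> \<le> ennreal t} \<subseteq> {..j}"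
    proof (rule subsetI, rule ccontr)
      fix k assume k: "k \<in> {k. ennreal s \<le> T (Suc k) \<omega> \<and> T (Suc k) \<omega> \<le> ennreal t}" "k \<notin> {..j}"
      then have "T j \<omega> \<le> T (Suc k) \<omega>" by (intro T_mono[OF \<omega>]) simp
      also have "\<dots> \<le> ennreal t" using k(1) by simp
      finally show False using j by simp
    qed
    then show "finite {k. ennreal s \<le> T (Suc k) \<omega> \<and> T (Suc k) \<omega> \<le> ennreal t}"
      by (rule finite_subset) simp
  qed
  assume c: "\<exists>i\<in>{1..L}. c i \<noteq> 0"
  interpret hazard_point_process M T rate "jump_process T X"
    by unfold_locales (rule jump_process_eq[OF _ c])
  have memory: "(LINT s:{..0}|\<eta>. erlang_kernel L c \<alpha> n (u - s)) = memory L \<alpha> n (erlang_init L c \<alpha> n \<eta>) u" for u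
    by (rule memory_erlang_init[OF \<eta>_init])
  show "hawkes_process M f (erlang_kernel L c \<alpha> n) \<eta> (jump_process T X)"
  proof (rule hawkes_process_if_rate[OF f_nonneg f_measurable erlang_kernel_measurable])
    show "(\<lambda>u. LINT s:{..0}|\<eta>. erlang_kernel L c \<alpha> n (u - s)) \<in> borel_measurable borel"
      unfolding memory by (rule memory_measurable)
    show "rate k u \<omega> = f ((LINT s:{..0}|\<eta>. erlang_kernel L c \<alpha> n (u - s))
        + (\<Sum>m=1..k. erlang_kernel L c \<alpha> n (u - enn2real (T m \<omega>))))" for k u \<omega>
      unfolding memory rate_def ..
  qed
qed

end
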